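(* Let $0<\varepsilon<1/2$. There is $p_0(\varepsilon)$ such that for every prime $p>p_0(\varepsilon)$ and all subsets $A,B\subseteq\mathbb{F}_p$ with $|A|,|B|\ge 2$ and $A+B=P_p$, we have $$\left(\frac12-\varepsilon\right)\frac{\varphi(p-1)}{\sqrt{p}}\le |A|,\,|B|\le 3\sqrt{p}.$$
   Context: $\mathbb{F}_p$ is the finite field with $p$ elements. $P_p$ denotes the set of primitive elements of $\mathbb{F}_p$, i.e. the generators of the cyclic group $\mathbb{F}_p^{\times}$. For $A,B\subseteq\mathbb{F}_p$, $A+B=\{a+b: a\in A,\ b\in B\}$. $\varphi$ is Euler's totient function. *)

theory Defs
  imports Complex_Main "HOL-Number_Theory.Number_Theory"
begin

text \<open>F_p is modelled by the residues {0..<p} (p prime), with addition mod p.\<close>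

definition primitive_elems :: "nat \<Rightarrow> nat set" where
  "primitive_elems p = {g \<in> {0..<p}. residue_primroot p g}"

definition sumset_mod :: "nat \<Rightarrow> nat set \<Rightarrow> nat set \<Rightarrow> nat set" where
  "sumset_mod p A B = {(a + b) mod p | a b. a \<in> A \<and> b \<in> B}"

end

theory Submission
  imports Defs "HOL-Computational_Algebra.Polynomial" "HOL-Library.FuncSet"
begin

text \<open>
  Primitive roots are quadratic nonresidues, so \<open>A + B = P\<close> forces \<open>\<chi> (a + b) = -1\<close> for the
  quadratic character \<open>\<chi>\<close> and all \<open>a \<in> A\<close>, \<open>b \<in> B\<close>. With \<open>k = card B\<close>, the fourth moment of
  \<open>\<Sum>b\<in>B. \<chi> (x + b)\<close> and the sharp Hasse bound \<open>2 * sqrt p\<close> for character sums over quartics give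
  \<open>card A \<le> 3 * p / k\<^sup>2 + (2 + o(1)) * sqrt p\<close>. As \<open>card A * k \<ge> \<phi>(p - 1)\<close> and \<open>\<phi>(p - 1)\<close> is
  almost \<open>p\<close>, either \<open>k\<close> is large enough for the first term to be negligible, or
  \<open>k = O(2 ^ \<omega>(p - 1))\<close>. The latter is impossible: for few shifts \<open>c\<close>, the values \<open>\<chi> (x + c)\<close> are
  equidistributed as \<open>x\<close> runs through the primitive roots. That follows by inclusion-exclusion
  over the power residues \<open>x = y ^ d\<close> from the Weil bound for \<open>\<Prod>c. \<chi> (y ^ d + c)\<close>. The bound on
  \<open>A\<close> gives the bound from below on \<open>B\<close>.

  Both character sum estimates come from Stepanov's method. On \<open>y\<^sup>2 = f x\<close> with \<open>deg f \<le> 2 * (g + 1)\<close>,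
  a nonzero \<open>\<Sum>j. x ^ (p * j) * (r j + \<epsilon> * s j * f ^ ((p + 1) / 2))\<close> is found by the pigeonhole
  principle that vanishes to order \<open>M\<close>, about \<open>sqrt p\<close>, at every \<open>x\<close> with \<open>\<chi> (f x) = \<epsilon>\<close>. The
  constant is sharp because the vanishing conditions are imposed one order at a time: once those of
  order less than \<open>k\<close> hold, the polynomial expressing the condition of order \<open>k\<close> has smaller degree
  than it has in general.
\<close>

section \<open>Integer polynomials modulo a prime\<close>

text \<open>Any constant below 3 would do for the upper bound; the factor \<open>1/2\<close> in the
  lower bound is what forces the sharp 2, since \<open>card A * card B\<close> need only reach
  \<open>\<phi> (p - 1)\<close>. With \<open>L = (p - 1) / 2\<close>, \<open>J = \<mu> + g\<close>
  and \<open>M = 2 * \<mu> + 1\<close>, the auxiliary polynomial has degree at most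
  \<open>L + p * J\<close>, so about \<open>p / 2 + g * p / M\<close> points at most take a given
  sign, and \<open>M\<close> must reach \<open>sqrt p\<close>. Some
  \<open>(2 * \<mu> + g) * L\<close> coefficients are available. Imposed all at once, the condition
  of order \<open>k\<close> would cost up to about \<open>L + J + g * k\<close> of them, which to
  leading order needs \<open>2 * (g + 1) * \<mu>\<^sup>2 < g * L\<close>; for \<open>g = 1\<close>
  the result would be \<open>2 * sqrt 2\<close>. Saving \<open>k\<close> at order \<open>k\<close>
  relaxes this to \<open>2 * \<mu>\<^sup>2 < L\<close>. The other obstacle is that the auxiliary
  polynomial might vanish identically. Squaring and the Frobenius map reduce this to
  \<open>f 0 * f\<close> not being a square, with \<open>f 0\<close> nonzero. That is why all shifts
  are kept away from 0.\<close>

locale odd_prime =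
  fixes p :: nat
  assumes prime_p: "prime p" and p_gt_2: "2 < p"
begin

text \<open>Polynomials over the field with \<open>p\<close> elements are represented by integer polynomials:
  \<open>pz f\<close> says that \<open>f\<close> is zero over that field, and \<open>pdvd\<close> is divisibility over it.\<close>

definition pz :: "int poly \<Rightarrow> bool" where
  "pz f \<longleftrightarrow> [:int p:] dvd f"

definition pdvd :: "int poly \<Rightarrow> int poly \<Rightarrow> bool" where
  "pdvd E f \<longleftrightarrow> (\<exists>q. pz (f - E * q))"

lemma p_pos: "0 < p" and odd_p: "odd p" and prime_int_p: "prime (int p)"
  using prime_p p_gt_2 prime_odd_nat[of p] by (auto simp: prime_gt_0_nat)

lemma pz_iff: "pz f \<longleftrightarrow> (\<forall>i. int p dvd coeff f i)"
  by (simp add: pz_def const_poly_dvd_iff)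

lemma pz_0 [simp]: "pz 0"
  by (simp add: pz_def)

lemma pz_add: "pz f \<Longrightarrow> pz g \<Longrightarrow> pz (f + g)"
  and pz_diff: "pz f \<Longrightarrow> pz g \<Longrightarrow> pz (f - g)"
  and pz_minus: "pz f \<Longrightarrow> pz (- f)"
  and pz_mult_left: "pz g \<Longrightarrow> pz (f * g)"
  and pz_mult_right: "pz f \<Longrightarrow> pz (f * g)"
  by (simp_all add: pz_def)

lemma pz_smult_p: "int p dvd c \<Longrightarrow> pz (smult c f)"
  by (simp add: pz_iff)

lemma pz_sum: "(\<And>i. i \<in> A \<Longrightarrow> pz (f i)) \<Longrightarrow> pz (sum f A)"
  unfolding pz_def by (rule dvd_sum)

lemma pz_pderiv: "pz f \<Longrightarrow> pz (pderiv f)"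
  by (simp add: pz_iff coeff_pderiv)

lemma pz_mult_iff: "pz (f * g) \<longleftrightarrow> pz f \<or> pz g"
proof -
  have "prime_elem [:int p:]"
    using prime_int_p by (simp add: prime_elem_const_poly_iff)
  then show ?thesis
    unfolding pz_def by (rule prime_elem_dvd_mult_iff)
qed

lemma pz_power_iff: "pz (f ^ n) \<longleftrightarrow> n > 0 \<and> pz f"
proof (induction n)
  case 0
  have "\<not> int p dvd 1" using p_gt_2 by auto
  then show ?case by (auto simp: pz_iff)
next
  case (Suc n)
  then show ?case by (auto simp: pz_mult_iff)
qed

lemma pz_const [simp]: "pz [:c:] \<longleftrightarrow> int p dvd c"
  by (simp add: pz_def)

lemma pz_poly: "pz f \<Longrightarrow> int p dvd poly f a"
  by (auto simp: pz_def elim!: dvdE)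

lemma pz_trans: "pz (f - g) \<Longrightarrow> pz (g - h) \<Longrightarrow> pz (f - h)"
  using pz_add[of "f - g" "g - h"] by simp

lemma pz_cong: "pz (f - g) \<Longrightarrow> pz f \<longleftrightarrow> pz g"
  using pz_add[of "f - g" g] pz_diff[of f "f - g"] by auto

lemma pz_diff_power: "pz (f - g) \<Longrightarrow> pz (f ^ n - g ^ n)"
  by (simp add: power_diff_sumr2 pz_mult_right)

lemma monic_not_pz: "lead_coeff E = 1 \<Longrightarrow> \<not> pz E"
  using p_gt_2 by (auto simp: pz_iff intro!: exI[of _ "degree E"])

text \<open>If \<open>q\<close> had a coefficient nonzero mod \<open>p\<close>, the last one, at
  \<open>m\<close>, would survive at \<open>degree E + m\<close> in \<open>E * q\<close> because
  \<open>E\<close> is monic, but \<open>r\<close> vanishes there. The hypothesis speaks of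
  coefficients since the degree over the integers may exceed the degree mod
  \<open>p\<close>.\<close>

lemma pz_degree_lt:
  assumes "lead_coeff E = 1" and "pz (r - E * q)" and "\<And>i. i \<ge> degree E \<Longrightarrow> int p dvd coeff r i"
  shows "pz r"
proof (rule ccontr)
  assume r: "\<not> pz r"
  define S where "S = {i. \<not> int p dvd coeff q i}"
  have "S \<subseteq> {..degree q}"
    by (auto simp: S_def intro!: le_degree)
  then have fin: "finite S" by (rule finite_subset) simp
  have "\<not> pz q"
    using r assms(2) pz_cong[OF assms(2)] by (auto simp: pz_mult_iff)
  then have "S \<noteq> {}" by (auto simp: S_def pz_iff)
  define m where "m = Max S"
  have m: "m \<in> S" and max: "\<And>i. i \<in> S \<Longrightarrow> i \<le> m"
    using fin \<open>S \<noteq> {}\<close> by (auto simp: m_def)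
  define n where "n = degree E"
  have "coeff (E * q) (n + m) = (\<Sum>i\<le>n + m. coeff E i * coeff q (n + m - i))"
    by (simp add: coeff_mult)
  also have "\<dots> = coeff E n * coeff q m + (\<Sum>i\<in>{..n + m} - {n}. coeff E i * coeff q (n + m - i))"
    by (subst sum.remove[of _ n]) auto
  finally have "coeff (E * q) (n + m) = coeff q m
      + (\<Sum>i\<in>{..n + m} - {n}. coeff E i * coeff q (n + m - i))"
    using assms(1) by (simp add: n_def)
  moreover have "int p dvd (\<Sum>i\<in>{..n + m} - {n}. coeff E i * coeff q (n + m - i))"
  proof (rule dvd_sum)
    fix i assume i: "i \<in> {..n + m} - {n}"
    show "int p dvd coeff E i * coeff q (n + m - i)"
    proof (cases "i < n")
      case True
      then have "n + m - i \<notin> S" using max by fastforce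
      then show ?thesis by (auto simp: S_def)
    next
      case False
      then have "i > degree E" using i by (auto simp: n_def)
      then show ?thesis by (simp add: coeff_eq_0)
    qed
  qed
  moreover have "int p dvd coeff r (n + m) - coeff (E * q) (n + m)"
    using assms(2) by (auto simp: pz_iff)
  moreover have "int p dvd coeff r (n + m)"
    using assms(3) by (auto simp: n_def)
  ultimately have "int p dvd coeff q m"
    by (metis dvd_add_left_iff dvd_diff_right_iff dvd_diff_commute)
  with m show False by (simp add: S_def)
qed

lemma pdvd_pz: "pz f \<Longrightarrow> pdvd E f"
  unfolding pdvd_def by (rule exI[of _ 0]) simp

lemma pdvd_cong: "pz (f - g) \<Longrightarrow> pdvd E f \<longleftrightarrow> pdvd E g"
proof -
  have *: "pdvd E g" if "pz (f - g)" "pdvd E f" for f g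
  proof -
    from that obtain q where "pz (f - E * q)" by (auto simp: pdvd_def)
    then have "pz ((f - E * q) - (f - g))" using that by (rule_tac pz_diff)
    then show ?thesis by (auto simp: pdvd_def)
  qed
  assume a: "pz (f - g)"
  then have "pz (g - f)" using pz_minus[of "f - g"] by simp
  with a * show ?thesis by blast
qed

lemma pdvd_add: "pdvd E f \<Longrightarrow> pdvd E g \<Longrightarrow> pdvd E (f + g)"
proof -
  assume "pdvd E f" "pdvd E g"
  then obtain q q' where "pz (f - E * q)" "pz (g - E * q')" by (auto simp: pdvd_def)
  from pz_add[OF this] have "pz (f + g - E * (q + q'))" by (simp add: algebra_simps)
  then show ?thesis by (auto simp: pdvd_def)
qed

lemma pdvd_mult_right: "pdvd E f \<Longrightarrow> pdvd E (f * g)"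
proof -
  assume "pdvd E f"
  then obtain q where "pz (f - E * q)" by (auto simp: pdvd_def)
  from pz_mult_right[OF this, of g] have "pz (f * g - E * (q * g))" by (simp add: algebra_simps)
  then show ?thesis by (auto simp: pdvd_def)
qed

lemma pdvd_mult_left: "pdvd E f \<Longrightarrow> pdvd E (g * f)"
  using pdvd_mult_right[of E f g] by (simp add: mult.commute)

lemma pdvd_minus: "pdvd E f \<Longrightarrow> pdvd E (- f)"
  using pdvd_mult_right[of E f "-1"] by simp

lemma pdvd_diff: "pdvd E f \<Longrightarrow> pdvd E g \<Longrightarrow> pdvd E (f - g)"
  using pdvd_add[of E f "- g"] pdvd_minus[of E g] by simp

lemma pdvd_triv [simp]: "pdvd E (E * f)" "pdvd E (f * E)"
  by (auto simp: pdvd_def intro!: exI[of _ f] simp: mult.commute)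

lemma pdvd_mult_cancel:
  assumes "\<not> pz E" shows "pdvd (E * F) (E * f) \<longleftrightarrow> pdvd F f"
proof -
  have "pz (E * f - E * F * q) \<longleftrightarrow> pz (f - F * q)" for q
    using assms pz_mult_iff[of E "f - F * q"] by (simp add: algebra_simps)
  then show ?thesis by (simp add: pdvd_def)
qed

lemma pdvd_degree_lt:
  assumes "lead_coeff E = 1" "pdvd E r" "\<And>i. i \<ge> degree E \<Longrightarrow> int p dvd coeff r i"
  shows "pz r"
  using assms pz_degree_lt by (auto simp: pdvd_def)

lemma unit_mod_p:
  fixes c :: int
  assumes "\<not> int p dvd c"
  obtains c' where "int p dvd c' * c - 1"
proof -
  have "coprime c (int p)"
    using assms prime_int_p by (metis coprime_commute prime_imp_coprime)
  then obtain c' where "[c * c' = 1] (mod int p)"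
    using cong_solve_coprime_int by blast
  then show thesis using that by (simp add: cong_iff_dvd_diff mult.commute)
qed

lemma pdvd_smult_cancel:
  assumes "\<not> int p dvd c" "pdvd E (smult c f)" shows "pdvd E f"
proof -
  obtain c' where "int p dvd c' * c - 1" using assms(1) by (rule unit_mod_p)
  then have "pz (smult (c' * c - 1) f)" by (rule pz_smult_p)
  then have "pz ([:c':] * smult c f - f)" by (simp add: smult_diff_left mult.commute)
  with pdvd_mult_left[OF assms(2), of "[:c':]"] show ?thesis
    by (simp only: pdvd_cong)
qed

lemma pdvd_linear_iff: "pdvd [:- a, 1:] f \<longleftrightarrow> int p dvd poly f a"
proof
  assume "pdvd [:- a, 1:] f"
  then obtain q where "pz (f - [:- a, 1:] * q)" by (auto simp: pdvd_def)
  from pz_poly[OF this, of a] show "int p dvd poly f a" by simp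
next
  assume "int p dvd poly f a"
  then have "pz (f - (f - [:poly f a:]))" by simp
  moreover have "[:- a, 1:] dvd f - [:poly f a:]"
    by (simp add: dvd_iff_poly_eq_0)
  then have "pdvd [:- a, 1:] (f - [:poly f a:])"
    by (elim dvdE) (simp only: pdvd_triv)
  ultimately show "pdvd [:- a, 1:] f" by (simp only: pdvd_cong)
qed

lemma pdvd_linear_power_cancel:
  assumes "pdvd ([:- a, 1:] ^ m) (g * f)" "\<not> int p dvd poly g a"
  shows "pdvd ([:- a, 1:] ^ m) f"
  using assms(1)
proof (induction m)
  case 0
  then show ?case using pdvd_triv(1)[of 1 f] by simp
next
  case (Suc m)
  define l where "l = [:- a, 1:]"
  have l: "\<not> pz (l ^ m)" by (rule monic_not_pz) (simp add: lead_coeff_power l_def)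
  obtain t where t: "pz (g * f - l ^ Suc m * t)" using Suc.prems by (auto simp: pdvd_def l_def)
  then have "pdvd (l ^ m) (g * f)"
    unfolding pdvd_def by (intro exI[of _ "l * t"]) (simp only: power_Suc2 mult.assoc)
  then obtain q where q: "pz (f - l ^ m * q)" using Suc.IH by (auto simp: pdvd_def l_def)
  from pz_mult_left[OF this, of g] have "pz (g * f - g * (l ^ m * q))" by (simp add: right_diff_distrib)
  from pz_diff[OF t this] have "pz (l ^ m * (g * q - l * t))"
    by (simp only: power_Suc2) (simp add: algebra_simps)
  then have "pz (g * q - l * t)" using l by (simp add: pz_mult_iff)
  then have "pdvd l (g * q)" by (auto simp: pdvd_def)
  then have "int p dvd poly q a"
    using assms(2) prime_int_p by (simp add: l_def pdvd_linear_iff prime_dvd_mult_iff)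
  then have "pdvd l q" by (simp only: l_def pdvd_linear_iff)
  then have "pdvd (l ^ m * l) (l ^ m * q)"
    by (subst pdvd_mult_cancel[OF l])
  then show ?case using q by (simp only: pdvd_cong power_Suc2 l_def)
qed

lemma pdvd_prod_linear_power:
  assumes "finite N" "N \<subseteq> {0..<p}" "\<And>a. a \<in> N \<Longrightarrow> pdvd ([:- int a, 1:] ^ M) F"
  shows "pdvd (\<Prod>a\<in>N. [:- int a, 1:] ^ M) F"
  using assms
proof (induction N)
  case empty
  then show ?case using pdvd_triv(1)[of 1 F] by simp
next
  case (insert b N)
  let ?G = "\<Prod>a\<in>N. [:- int a, 1:] ^ M"
  have G: "lead_coeff ?G = 1" by (simp add: lead_coeff_prod lead_coeff_power)
  have "pdvd ?G F" using insert by auto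
  then obtain Q where Q: "pz (F - ?G * Q)" by (auto simp: pdvd_def)
  have "pdvd ([:- int b, 1:] ^ M) (?G * Q)" using insert.prems Q by (simp add: pdvd_cong)
  moreover have "\<not> int p dvd poly ?G (int b)"
  proof
    assume "int p dvd poly ?G (int b)"
    then have "int p dvd (\<Prod>a\<in>N. (int b - int a) ^ M)"
      by (simp add: poly_prod)
    then obtain a where a: "a \<in> N" "int p dvd (int b - int a) ^ M"
      using prime_int_p insert.hyps(1) by (auto simp: prime_dvd_prod_iff)
    then have "int p dvd int b - int a"
      using prime_int_p prime_dvd_power by blast
    then have "[int b = int a] (mod int p)" by (simp add: cong_iff_dvd_diff)
    then have "a = b" using a(1) insert.prems by (auto simp: cong_int_iff cong_def)
    with a insert.hyps show False by simp
  qed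
  ultimately have "pdvd ([:- int b, 1:] ^ M) Q" by (rule pdvd_linear_power_cancel)
  then have "pdvd (?G * [:- int b, 1:] ^ M) (?G * Q)"
    by (subst pdvd_mult_cancel[OF monic_not_pz[OF G]])
  then have "pdvd (?G * [:- int b, 1:] ^ M) F"
    by (subst pdvd_cong[OF Q])
  then show ?case
    by (subst prod.insert[OF insert.hyps]) (simp only: mult.commute)
qed

lemma card_roots_le:
  assumes "N \<subseteq> {0..<p}" "\<And>a. a \<in> N \<Longrightarrow> pdvd ([:- int a, 1:] ^ M) F" "\<not> pz F" "degree F \<le> D"
  shows "M * card N \<le> D"
proof (rule ccontr)
  assume *: "\<not> M * card N \<le> D"
  have fin: "finite N" using assms(1) by (rule finite_subset) simp
  let ?G = "\<Prod>a\<in>N. [:- int a, 1:] ^ M"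
  have G: "lead_coeff ?G = 1" by (simp add: lead_coeff_prod lead_coeff_power)
  have "degree ?G = (\<Sum>a\<in>N. degree ([:- int a, 1:] ^ M))"
    by (rule degree_prod_eq_sum_degree) auto
  also have "\<dots> = M * card N" by (simp add: degree_power_eq)
  finally have "pz F"
    using pdvd_degree_lt[OF G pdvd_prod_linear_power[OF fin assms(1,2)]] * assms(4)
    by (simp add: coeff_eq_0)
  with assms(3) show False by simp
qed

text \<open>The auxiliary polynomials below satisfy first-order differential equations, by which their
  multiplicity at a point is found without higher derivatives.\<close>

lemma pdvd_linear_power_of_ode:
  assumes "pdvd ([:- a, 1:] ^ m) (u * pderiv F + v * F)" "int p dvd poly F a"
    "\<not> int p dvd poly u a" "m + 1 < p"
  shows "pdvd ([:- a, 1:] ^ Suc m) F"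
proof -
  define l where "l = [:- a, 1:]"
  have "pdvd (l ^ Suc i) F" if "i \<le> m" for i
    using that
  proof (induction i)
    case 0
    then show ?case using assms(2) by (simp add: l_def pdvd_linear_iff)
  next
    case (Suc i)
    have l: "\<not> pz (l ^ i)" for i by (rule monic_not_pz) (simp add: lead_coeff_power l_def)
    obtain Q where Q: "pz (F - l ^ Suc i * Q)" using Suc by (auto simp: pdvd_def l_def)
    obtain t where t: "pz (u * pderiv F + v * F - l ^ m * t)" using assms(1) by (auto simp: pdvd_def l_def)
    define w where "w = l ^ (m - Suc i) * t"
    have w: "l ^ m * t = l ^ Suc i * w"
      using Suc.prems by (simp add: w_def mult.assoc[symmetric] power_add[symmetric] del: power_Suc)
    have dl: "pderiv (l ^ Suc i) = smult (int (Suc i)) (l ^ i)"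
      by (simp only: pderiv_power_Suc) (simp add: pderiv_pCons l_def)
    have "pz (u * pderiv (F - l ^ Suc i * Q) + v * (F - l ^ Suc i * Q))"
      using Q by (intro pz_add pz_mult_left pz_pderiv)
    \<comment> \<open>With \<open>F = l ^ (i + 1) * Q\<close>, the only term of order
      \<open>i\<close> at \<open>a\<close> in \<open>u * F' + v * F\<close> is
      \<open>(i + 1) * l ^ i * u * Q\<close>. It must be divisible by a further \<open>l\<close>,
      and \<open>i + 1 < p\<close> keeps the factor \<open>i + 1\<close> invertible.\<close>
    from pz_diff[OF t this]
    have "pz (l ^ i * (smult (int (Suc i)) (u * Q) + l * (u * pderiv Q + v * Q - w)))"
      unfolding w by (simp only: pderiv_diff pderiv_mult dl) (simp add: algebra_simps)
    then have "pz (smult (int (Suc i)) (u * Q) + l * (u * pderiv Q + v * Q - w))"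
      using l pz_mult_iff by blast
    from pz_poly[OF this, of a] have "int p dvd int (Suc i) * (poly u a * poly Q a)"
      by (simp add: l_def)
    moreover have "\<not> int p dvd int (Suc i)"
      using Suc.prems assms(4) by (auto dest!: zdvd_imp_le)
    ultimately have "int p dvd poly Q a"
      using assms(3) prime_int_p by (simp only: prime_dvd_mult_iff) blast
    then have "pdvd l Q" by (simp only: l_def pdvd_linear_iff)
    then have "pdvd (l ^ Suc i * l) (l ^ Suc i * Q)"
      by (subst pdvd_mult_cancel[OF l])
    then show ?case using Q by (simp only: pdvd_cong power_Suc2)
  qed
  then show ?thesis by (simp add: l_def)
qed

end

section \<open>The derivation on a hyperelliptic curve\<close>

text \<open>On the curve \<open>y\<^sup>2 = f x\<close>, a polynomial \<open>q\<close> stands for \<open>q\<close> in even and for \<open>q * y\<close> in odd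
  position \<open>n\<close>. In this encoding \<open>dop\<close> is the derivation \<open>2 * y * d/dx\<close>, and \<open>yop\<close> is
  multiplication by \<open>y\<close>.\<close>

definition dop :: "int poly \<Rightarrow> nat \<Rightarrow> int poly \<Rightarrow> int poly" where
  "dop f n q = (if even n then 2 * pderiv q else 2 * f * pderiv q + pderiv f * q)"

definition yop :: "int poly \<Rightarrow> nat \<Rightarrow> int poly \<Rightarrow> int poly" where
  "yop f n q = (if even n then q else f * q)"

primrec dpow :: "int poly \<Rightarrow> nat \<Rightarrow> nat \<Rightarrow> int poly \<Rightarrow> int poly" where
  "dpow f b 0 q = q"
| "dpow f b (Suc k) q = dop f (b + k) (dpow f b k q)"

lemma dop_add: "dop f n (q + r) = dop f n q + dop f n r"
  and dop_diff: "dop f n (q - r) = dop f n q - dop f n r"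
  and dop_0: "dop f n 0 = 0"
  by (simp_all add: dop_def pderiv_add pderiv_diff algebra_simps)

lemma yop_add: "yop f n (q + r) = yop f n q + yop f n r"
  and yop_mult: "yop f n (g * q) = g * yop f n q"
  by (simp_all add: yop_def algebra_simps)

lemma dop_mult: "dop f n (g * q) = g * dop f n q + (2 * pderiv g) * yop f n q"
  by (simp add: dop_def yop_def pderiv_mult algebra_simps)

lemma dop_yop: "dop f (Suc n) (yop f n q) = yop f (Suc n) (dop f n q) + pderiv f * q"
  by (simp add: dop_def yop_def pderiv_mult algebra_simps)

lemma dpow_diff: "dpow f b k (q - r) = dpow f b k q - dpow f b k r"
  by (induction k) (simp_all add: dop_diff)

lemma dpow_0 [simp]: "dpow f b k 0 = 0"
  by (induction k) (simp_all add: dop_0)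

text \<open>On functions with a pole of order at most \<open>m = L + g * k\<close> at infinity, the operator
  \<open>x * (2 * y * d/dx) - 2 * m * y\<close> cancels the leading term. Its iterates differ from
  \<open>x ^ k\<close> times those of the derivation by lower derivatives only, so they bound the degree of the
  vanishing condition of order \<open>k\<close> once the lower ones are met.\<close>

primrec upow :: "int poly \<Rightarrow> nat \<Rightarrow> nat \<Rightarrow> nat \<Rightarrow> nat \<Rightarrow> int poly \<Rightarrow> int poly" where
  "upow f g L b 0 q = q"
| "upow f g L b (Suc k) q =
     monom 1 1 * dop f (b + k) (upow f g L b k q)
       - smult (2 * int (L + g * k)) (yop f (b + k) (upow f g L b k q))"

text \<open>The operators generated by the derivatives of order less than \<open>k\<close>. The index \<open>n\<close> is the
  position of the result, for an argument in position \<open>0\<close>.\<close>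

inductive low :: "int poly \<Rightarrow> nat \<Rightarrow> nat \<Rightarrow> (nat \<Rightarrow> int poly \<Rightarrow> int poly) \<Rightarrow> bool" for f k where
  low_base: "i < k \<Longrightarrow> low f k i (\<lambda>b q. dpow f b i q)"
| low_zero: "low f k n (\<lambda>b q. 0)"
| low_add: "low f k n \<Phi> \<Longrightarrow> low f k n \<Psi> \<Longrightarrow> low f k n (\<lambda>b q. \<Phi> b q + \<Psi> b q)"
| low_mult: "low f k n \<Phi> \<Longrightarrow> low f k n (\<lambda>b q. c * \<Phi> b q)"
| low_yop: "low f k n \<Phi> \<Longrightarrow> low f k (Suc n) (\<lambda>b q. yop f (b + n) (\<Phi> b q))"
| low_parity: "low f k n \<Phi> \<Longrightarrow> even m = even n \<Longrightarrow> low f k m \<Phi>"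

lemma low_mono: "low f k n \<Phi> \<Longrightarrow> k \<le> k' \<Longrightarrow> low f k' n \<Phi>"
proof (induction rule: low.induct)
  case (low_base i)
  then have "i < k'" by simp
  then show ?case by (rule low.low_base)
next
  case low_zero
  show ?case by (rule low.low_zero)
next
  case (low_add n \<Phi> \<Psi>)
  then show ?case by (intro low.low_add)
next
  case (low_mult n \<Phi> c)
  then show ?case by (intro low.low_mult)
next
  case (low_yop n \<Phi>)
  then show ?case by (intro low.low_yop)
next
  case (low_parity n \<Phi> m)
  show ?case by (rule low.low_parity[OF low_parity.IH]) (use low_parity in simp_all)
qed

text \<open>Moving the derivation past a polynomial factor or past \<open>y\<close> leaves extra
  terms free of new derivatives, so the class gains only one order. \<open>low_parity\<close> lets
  the term \<open>pderiv f * q\<close> count two positions higher.\<close>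

lemma low_dop: "low f k n \<Phi> \<Longrightarrow> low f (Suc k) (Suc n) (\<lambda>b q. dop f (b + n) (\<Phi> b q))"
proof (induction rule: low.induct)
  case (low_base i)
  then have "low f (Suc k) (Suc i) (\<lambda>b q. dpow f b (Suc i) q)" by (intro low.low_base) simp
  then show ?case by simp
next
  case (low_zero n)
  show ?case unfolding dop_0 by (rule low.low_zero)
next
  case (low_add n \<Phi> \<Psi>)
  then show ?case unfolding dop_add by (intro low.low_add)
next
  case (low_mult n \<Phi> c)
  have "low f (Suc k) (Suc n) (\<lambda>b q. (2 * pderiv c) * yop f (b + n) (\<Phi> b q))"
    by (rule low.low_mult, rule low.low_yop, rule low_mono[OF low_mult.hyps]) simp
  with low.low_add[OF low.low_mult[OF low_mult.IH, of c] this] show ?case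
    by (simp add: dop_mult)
next
  case (low_yop n \<Phi>)
  have "low f (Suc k) (Suc (Suc n)) \<Phi>"
    by (rule low.low_parity[of _ _ n], rule low_mono[OF low_yop.hyps]) simp_all
  from low.low_add[OF low.low_yop[OF low_yop.IH] low.low_mult[OF this, of "pderiv f"]]
  show ?case by (simp add: dop_yop)
next
  case (low_parity n \<Phi> m)
  have "(\<lambda>b q. dop f (b + m) (\<Phi> b q)) = (\<lambda>b q. dop f (b + n) (\<Phi> b q))"
    using low_parity by (auto simp: dop_def fun_eq_iff)
  then show ?case
    using low.low_parity[OF low_parity.IH, of "Suc m"] low_parity.hyps by simp
qed

lemma upow_eq_dpow_add_low:
  "\<exists>\<Phi>. low f k k \<Phi> \<and> (\<forall>b q. upow f g L b k q = monom 1 k * dpow f b k q + \<Phi> b q)"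
proof (induction k)
  case 0
  show ?case by (intro exI[of _ "\<lambda>b q. 0"] conjI low_zero) (simp add: monom_eq_1)
next
  case (Suc k)
  then obtain \<Phi> where \<Phi>: "low f k k \<Phi>"
    and u: "\<And>b q. upow f g L b k q = monom 1 k * dpow f b k q + \<Phi> b q" by blast
  define c where "c = [:2 * int (L + g * k):]"
  define x where "x = (monom 1 1 :: int poly)"
  define e where "e = x * (2 * pderiv (monom 1 k)) - c * monom 1 k"
  define \<Psi> where "\<Psi> = (\<lambda>b q. e * yop f (b + k) (dpow f b k q)
      + (x * dop f (b + k) (\<Phi> b q) + (- c) * yop f (b + k) (\<Phi> b q)))"
  have "low f (Suc k) (Suc k) \<Psi>"
    unfolding \<Psi>_def
    by (rule low_add low_mult low_yop low_dop low_base low_mono[OF \<Phi>] \<Phi> lessI le_SucI le_refl)+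
  moreover have "upow f g L b (Suc k) q = monom 1 (Suc k) * dpow f b (Suc k) q + \<Psi> b q" for b q
  proof -
    have "(monom 1 (Suc k) :: int poly) = x * monom 1 k" by (simp add: x_def mult_monom)
    moreover have "smult (2 * int (L + g * k)) v = c * v" for v by (simp add: c_def)
    ultimately show ?thesis
      by (simp only: upow.simps dpow.simps u x_def[symmetric] \<Psi>_def e_def dop_add yop_add dop_mult yop_mult)
        (simp add: algebra_simps)
  qed
  ultimately show ?case by blast
qed

section \<open>Degree bounds for the iterated operators\<close>

definition deglt :: "nat \<Rightarrow> int poly \<Rightarrow> bool" where
  "deglt n q \<longleftrightarrow> (\<forall>i\<ge>n. coeff q i = 0)"

lemma deglt_iff: "deglt n q \<longleftrightarrow> q = 0 \<or> degree q < n"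
proof
  assume "deglt n q"
  then show "q = 0 \<or> degree q < n"
    by (metis deglt_def leading_coeff_0_iff not_le)
qed (auto simp: deglt_def coeff_eq_0)

lemma deglt_mono: "deglt n q \<Longrightarrow> n \<le> m \<Longrightarrow> deglt m q"
  by (auto simp: deglt_def)

lemma deglt_add: "deglt n q \<Longrightarrow> deglt n r \<Longrightarrow> deglt n (q + r)"
  and deglt_smult: "deglt n q \<Longrightarrow> deglt n (smult c q)"
  by (auto simp: deglt_def)

lemma deglt_sum: "(\<And>i. i \<in> A \<Longrightarrow> deglt n (F i)) \<Longrightarrow> deglt n (sum F A)"
  by (auto simp: deglt_def coeff_sum)

lemma deglt_mult: "deglt n q \<Longrightarrow> degree r \<le> m \<Longrightarrow> deglt (n + m) (r * q)"
  unfolding deglt_iff by (cases "r = 0"; cases "q = 0") (auto simp: degree_mult_eq)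

text \<open>\<open>x * d/dx\<close> multiplies \<open>x ^ n\<close> by \<open>n\<close>, so the top
  term cancels.\<close>

lemma deglt_euler:
  assumes "deglt (Suc n) q" shows "deglt n (monom 1 1 * pderiv q - smult (int n) q)"
proof -
  have "coeff (monom 1 1 * pderiv q) i = int i * coeff q i" for i
    by (cases i) (simp_all add: coeff_monom_mult coeff_pderiv)
  then show ?thesis
    using assms by (auto simp: deglt_def)
qed

lemma smult_two_mult: "smult (2 * c) q = 2 * ([:c:] * q)" for q :: "int poly"
  by (simp only: mult_2 smult_add_left) simp

text \<open>Splits \<open>2 * m\<close> as \<open>2 * (m - g) + 2 * g\<close>, so that
  \<open>v\<close> and \<open>f\<close> each meet an Euler operator matching their own degree bound.
  It is used with \<open>g + 1\<close> for \<open>g\<close>, when \<open>v\<close> has degree at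
  most \<open>m - g - 1\<close> and \<open>f\<close> at most \<open>2 * g + 2\<close>.\<close>

lemma upow_odd_identity:
  fixes x :: "'a :: comm_ring_1"
  shows "x * (2 * f * dv + df * v) - 2 * m * (f * v)
     = 2 * f * (x * dv - (m - g) * v) + (x * df - 2 * g * f) * v"
  by (simp add: algebra_simps)

text \<open>At infinity \<open>x\<close> has a pole of order 1 and \<open>y\<close> one of order at
  most \<open>g + 1\<close>, so pole order at most \<open>m\<close> means degree at most
  \<open>m\<close> in even and \<open>m - g - 1\<close> in odd position. The derivation adds
  \<open>g\<close>, multiplication by \<open>x\<close> adds 1, and cancelling the leading term takes
  1 away.\<close>

lemma deglt_upow:
  assumes "deglt (Suc L) q" "even b \<or> deglt (L - g) q" "even b \<or> g \<le> L" "degree f \<le> 2 * Suc g"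
  shows "if even (b + k) then deglt (Suc (L + g * k)) (upow f g L b k q)
         else deglt (L + g * k - g) (upow f g L b k q) \<and> g \<le> L + g * k"
proof (induction k)
  case 0
  then show ?case using assms by auto
next
  case (Suc k)
  define v where "v = upow f g L b k q"
  define m where "m = L + g * k"
  define x where "x = (monom 1 1 :: int poly)"
  show ?case
  proof (cases "even (b + k)")
    case True
    have "deglt (Suc m) v" using Suc.IH True by (simp add: m_def v_def)
    then have "deglt m (x * pderiv v - smult (int m) v)" unfolding x_def by (rule deglt_euler)
    moreover have "upow f g L b (Suc k) q = smult 2 (x * pderiv v - smult (int m) v)"
      using True smult_two_mult[of "int m" v] smult_two_mult[of 1 "x * pderiv v - [:int m:] * v"]
      by (simp only: upow.simps dop_def yop_def v_def[symmetric] m_def[symmetric] x_def[symmetric] if_True)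
        (simp add: algebra_simps)
    ultimately show ?thesis using True by (auto simp: m_def intro!: deglt_smult)
  next
    case False
    have v: "deglt (m - g) v" "g \<le> m" using Suc.IH False by (simp_all add: m_def v_def)
    have "deglt (Suc (m + g)) (upow f g L b (Suc k) q)"
    \<comment> \<open>For nonzero \<open>v\<close> the bound yields \<open>g < m\<close>, which
      makes the truncated \<open>m - Suc g\<close> a genuine difference.\<close>
    proof (cases "v = 0")
      case True
      then show ?thesis using False by (simp add: dop_def yop_def v_def[symmetric] deglt_iff)
    next
      case v0: False
      then have mg: "m > g" using v by (auto simp: deglt_iff)
      then have "deglt (m - Suc g) (x * pderiv v - smult (int (m - Suc g)) v)"
        using v unfolding x_def by (intro deglt_euler) (simp add: Suc_diff_Suc)
      then have A: "deglt (m - Suc g + 2 * Suc g)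
          (smult 2 f * (x * pderiv v - smult (int (m - Suc g)) v))"
        using assms(4) by (intro deglt_mult) auto
      have "deglt (Suc (2 * Suc g)) f" using assms(4) by (simp add: deglt_iff)
      then have "deglt (2 * Suc g) (x * pderiv f - smult (int (2 * Suc g)) f)"
        unfolding x_def by (rule deglt_euler)
      then have "degree (x * pderiv f - smult (int (2 * Suc g)) f) \<le> 2 * g + 1"
        by (auto simp: deglt_iff)
      then have B: "deglt (m - g + (2 * g + 1)) ((x * pderiv f - smult (int (2 * Suc g)) f) * v)"
        using v(1) by (intro deglt_mult)
      have "upow f g L b (Suc k) q
          = smult 2 f * (x * pderiv v - smult (int (m - Suc g)) v)
            + (x * pderiv f - smult (int (2 * Suc g)) f) * v"
      proof -
        have "int (m - Suc g) = int m - int (Suc g)" using mg by auto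
        then have e: "[:int (m - Suc g):] = [:int m:] - [:int (Suc g):]" by simp
        have c: "smult z w = [:z:] * w" for z :: int and w by simp
        have s: "smult 2 f = 2 * f" using smult_two_mult[of 1 f] by simp
        have s': "smult (int (2 * Suc g)) f = 2 * [:int (Suc g):] * f"
          using smult_two_mult[of "int (Suc g)" f] by (simp only: of_nat_mult of_nat_numeral mult.assoc)
        show ?thesis
          using False upow_odd_identity[of x f "pderiv v" "pderiv f" v "[:int m:]" "[:int (Suc g):]"]
          by (simp only: upow.simps dop_def yop_def v_def[symmetric] m_def[symmetric] x_def[symmetric]
              s s' smult_two_mult if_False)
            (simp only: c e mult.assoc)
      qed
      then show ?thesis using deglt_add[OF A[THEN deglt_mono] B[THEN deglt_mono], of "Suc (m + g)"] mg
        by simp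
    qed
    then show ?thesis using False by (simp add: m_def add.commute add.left_commute)
  qed
qed

lemma upow_0 [simp]: "upow f g L b k 0 = 0"
  by (induction k) (simp_all add: dop_0 yop_def)

text \<open>The \<open>k\<close>-th derivative, with respect to the first point, of
  \<open>\<Sum>j. z ^ j * (r j (x) + s j (x) * y * w)\<close> for points \<open>(x, y)\<close>, \<open>(z, w)\<close> of the curve,
  restricted to the diagonal; a factor \<open>y\<close> is dropped for odd \<open>k\<close>.\<close>

definition diag :: "int poly \<Rightarrow> nat \<Rightarrow> (nat \<Rightarrow> int poly) \<Rightarrow> (nat \<Rightarrow> int poly) \<Rightarrow> nat \<Rightarrow> int poly" where
  "diag f J r s k = (\<Sum>j\<le>J. monom 1 j *
     (dpow f 0 k (r j) + (if even k then f else 1) * dpow f 1 k (s j)))"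

lemma diag_diff:
  "diag f J (\<lambda>j. r j - r' j) (\<lambda>j. s j - s' j) k = diag f J r s k - diag f J r' s' k"
  by (simp add: diag_def dpow_diff algebra_simps flip: sum_subtractf)

lemma large_fibre:
  fixes \<phi> :: "'a \<Rightarrow> 'b"
  assumes "finite S" "finite Y" "S \<noteq> {}" "\<phi> ` S \<subseteq> Y"
  shows "\<exists>y. card S \<le> card {u \<in> S. \<phi> u = y} * card Y"
proof (rule ccontr)
  assume "\<nexists>y. card S \<le> card {u \<in> S. \<phi> u = y} * card Y"
  then have less: "card {u \<in> S. \<phi> u = y} * card Y < card S" for y by (simp add: not_le)
  have "Y \<noteq> {}" using assms by auto
  have "card S = (\<Sum>y\<in>Y. card {u \<in> S. \<phi> u = y})"
    using sum.group[OF assms(1,2,4), of "\<lambda>_. 1 :: nat"] by simp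
  then have "card S * card Y = (\<Sum>y\<in>Y. card {u \<in> S. \<phi> u = y} * card Y)"
    by (simp add: sum_distrib_right)
  also have "\<dots> < (\<Sum>y\<in>Y. card S)"
    using \<open>Y \<noteq> {}\<close> assms(2) less by (intro sum_strict_mono) auto
  finally show False by simp
qed

context odd_prime
begin

text \<open>Beyond the base cases, which are the lower conditions, no rule of \<open>low\<close>
  differentiates, so the factors \<open>x ^ j\<close> pass through. Multiplication by
  \<open>y\<close> changes the two halves consistently with the factor \<open>f\<close> that is
  present at even order only.\<close>

lemma pz_low:
  assumes "low f k n \<Phi>" "\<And>i. i < k \<Longrightarrow> pz (diag f J r s i)"
  shows "pz (\<Sum>j\<le>J. monom 1 j * (\<Phi> 0 (r j) + (if even n then f else 1) * \<Phi> 1 (s j)))"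
  using assms(1)
proof (induction rule: low.induct)
  case (low_base i)
  then show ?case using assms(2)[of i] by (simp add: diag_def)
next
  case (low_zero n)
  then show ?case by simp
next
  case (low_add n \<Phi> \<Psi>)
  from pz_add[OF low_add.IH] show ?case
    by (simp only: sum.distrib[symmetric]) (simp add: algebra_simps)
next
  case (low_mult n \<Phi> c)
  from pz_mult_left[OF low_mult.IH, of c] show ?case
    by (simp only: sum_distrib_left) (simp add: algebra_simps)
next
  case (low_yop n \<Phi>)
  show ?case
  proof (cases "even n")
    case True
    then show ?thesis using low_yop.IH by (simp add: yop_def)
  next
    case False
    from pz_mult_left[OF low_yop.IH, of f] show ?thesis
      using False by (simp only: sum_distrib_left) (simp add: yop_def algebra_simps)
  qed
next
  case (low_parity n \<Phi> m)
  then show ?case by simp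
qed

text \<open>Given the lower conditions, \<open>x ^ k\<close> times the condition of order
  \<open>k\<close> is congruent to the same sum \<open>U\<close> built with \<open>upow\<close>,
  whose degree is at most \<open>L + g * k + J\<close>. Removing \<open>x ^ k\<close> lowers the
  bound by \<open>k\<close>, which is the saving behind the sharp constant.\<close>

lemma diag_degree:
  assumes "\<And>j. deglt (Suc L) (r j)" "\<And>j. deglt (L - g) (s j)" "\<And>j. j + g \<ge> J \<Longrightarrow> s j = 0"
    and "g \<le> L" "degree f \<le> 2 * Suc g"
    and "\<And>i. i < k \<Longrightarrow> pz (diag f J r s i)" "i + k > L + g * k + J"
  shows "int p dvd coeff (diag f J r s k) i"
proof -
  define m where "m = L + g * k"
  define c where "c = (if even k then f else 1)"
  define U where "U = (\<Sum>j\<le>J. monom 1 j * (upow f g L 0 k (r j) + c * upow f g L 1 k (s j)))"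
  have sL: "deglt (Suc L) (s j)" for j using assms(2)[of j] by (rule deglt_mono) simp
  have "deglt (Suc (m + J)) U"
    unfolding U_def
  proof (rule deglt_sum)
    fix j assume j: "j \<in> {..J}"
    have "deglt (Suc m) (upow f g L 0 k (r j))"
      using deglt_upow[OF assms(1)[of j], where b = 0 and g = g and f = f and k = k] assms(4,5)
      by (auto simp: m_def split: if_splits elim: deglt_mono)
    then have "deglt (Suc m + j) (monom 1 j * upow f g L 0 k (r j))"
      by (rule deglt_mult) (simp add: degree_monom_le)
    then have 1: "deglt (Suc (m + J)) (monom 1 j * upow f g L 0 k (r j))"
      by (rule deglt_mono) (use j in simp)
    have 2: "deglt (Suc (m + J)) (monom 1 j * (c * upow f g L 1 k (s j)))"
    \<comment> \<open>A nonzero \<open>s j\<close> has \<open>j \<le> J - g - 1\<close>, so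
      \<open>x ^ j * f\<close> times a polynomial of degree at most \<open>m - g - 1\<close> stays
      within \<open>m + J\<close>.\<close>
    proof (cases "j + g \<ge> J")
      case True
      then show ?thesis using assms(3) by (simp add: deglt_iff)
    next
      case False
      have up: "if even (1 + k) then deglt (Suc m) (upow f g L 1 k (s j))
         else deglt (m - g) (upow f g L 1 k (s j)) \<and> g \<le> m"
        using deglt_upow[OF sL[of j], where b = 1 and g = g and f = f and k = k] assms(2,4,5) by (simp add: m_def del: One_nat_def)
      show ?thesis
      proof (cases "even k")
        case True
        then have v: "deglt (m - g) (upow f g L 1 k (s j))" and "g \<le> m"
          using up by simp_all
        have "degree (monom 1 j * c) \<le> j + 2 * Suc g"
          using True assms(5) degree_mult_le[of "monom 1 j" f] degree_monom_le[of "1::int" j]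
          by (auto simp: c_def)
        from deglt_mult[OF v this] show ?thesis
          using False \<open>g \<le> m\<close> by (auto simp: mult.assoc elim!: deglt_mono)
      next
        case odd: False
        then have "deglt (Suc m + j) (monom 1 j * (c * upow f g L 1 k (s j)))"
          using up by (intro deglt_mult) (auto simp: c_def degree_monom_le)
        then show ?thesis by (rule deglt_mono) (use False in simp)
      qed
    qed
    show "deglt (Suc (m + J)) (monom 1 j * (upow f g L 0 k (r j) + c * upow f g L 1 k (s j)))"
      using deglt_add[OF 1 2] by (simp add: distrib_left)
  qed
  then have "coeff U (i + k) = 0" using assms(7) by (simp add: deglt_def m_def)
  moreover obtain \<Phi> where \<Phi>: "low f k k \<Phi>"
    and u: "\<And>b q. upow f g L b k q = monom 1 k * dpow f b k q + \<Phi> b q"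
    using upow_eq_dpow_add_low[of f k g L] by blast
  have "U = monom 1 k * diag f J r s k + (\<Sum>j\<le>J. monom 1 j * (\<Phi> 0 (r j) + c * \<Phi> 1 (s j)))"
    unfolding U_def diag_def sum_distrib_left u c_def[symmetric] sum.distrib[symmetric]
    by (intro sum.cong refl) (simp only: algebra_simps)
  then have "pz (U - monom 1 k * diag f J r s k)"
    using pz_low[OF \<Phi>, of J r s] assms(6) by (simp add: c_def)
  then have "int p dvd coeff U (i + k) - coeff (monom 1 k * diag f J r s k) (i + k)"
    by (simp add: pz_iff)
  ultimately show ?thesis by (simp add: coeff_monom_mult)
qed

text \<open>Successive kernels of linear maps, phrased through differences: at order
  \<open>m\<close> the surviving set \<open>S\<close> shrinks by a factor of at most
  \<open>p ^ c m\<close>, because for differences within \<open>S\<close> the assumption on degrees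
  makes all coordinates from \<open>c m\<close> on vanish.\<close>

lemma successive_pigeonhole:
  fixes T :: "nat \<Rightarrow> 'w \<Rightarrow> nat \<Rightarrow> int" and d :: "'w \<Rightarrow> 'w \<Rightarrow> 'w"
  assumes "finite X"
    and lin: "\<And>k u v z i. T k (d u v) i = T k (d u z) i - T k (d v z) i"
    and deg: "\<And>k u v i. k < M \<Longrightarrow> u \<in> X \<Longrightarrow> v \<in> X \<Longrightarrow> (\<And>l i. l < k \<Longrightarrow> int p dvd T l (d u v) i)
               \<Longrightarrow> i \<ge> c k \<Longrightarrow> int p dvd T k (d u v) i"
    and card: "p ^ (\<Sum>k<M. c k) < card X"
  shows "\<exists>u\<in>X. \<exists>v\<in>X. u \<noteq> v \<and> (\<forall>k<M. \<forall>i. int p dvd T k (d u v) i)"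
proof -
  have main: "m \<le> M \<Longrightarrow> \<exists>S\<subseteq>X. card X \<le> card S * p ^ (\<Sum>k<m. c k)
      \<and> (\<forall>u\<in>S. \<forall>v\<in>S. \<forall>k<m. \<forall>i. int p dvd T k (d u v) i)" for m
  proof (induction m)
    case 0
    then show ?case by (intro exI[of _ X]) simp
  next
    case (Suc m)
    then have "m \<le> M" by simp
    from Suc.IH[OF this] obtain S where S: "S \<subseteq> X" "card X \<le> card S * p ^ (\<Sum>k<m. c k)"
      and V': "\<forall>u\<in>S. \<forall>v\<in>S. \<forall>k<m. \<forall>i. int p dvd T k (d u v) i"
      by (elim exE conjE) (rule that)
    have V: "int p dvd T k (d u v) i" if "u \<in> S" "v \<in> S" "k < m" for u v k i
      using V' that by simp
    have fin: "finite S" using S(1) assms(1) by (rule finite_subset)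
    have "S \<noteq> {}"
    proof
      assume "S = {}"
      then have "card X \<le> 0" using S(2) by (simp only: card.empty mult_0)
      also have "0 \<le> p ^ (\<Sum>k<M. c k)" by (rule le0)
      also note card
      finally show False by (simp only: less_irrefl)
    qed
    \<comment> \<open>Linearity is assumed for differences only, so values are measured from a fixed
      member of \<open>S\<close>.\<close>
    then obtain z where z: "z \<in> S" by blast
    define Y where "Y = PiE {..<c m} (\<lambda>_. {0..<int p})"
    define \<phi> where "\<phi> u = restrict (\<lambda>i. T m (d u z) i mod int p) {..<c m}" for u
    have Y: "finite Y" "card Y = p ^ c m" by (auto simp: Y_def finite_PiE card_PiE)
    have "\<phi> ` S \<subseteq> Y" using p_pos by (auto simp: \<phi>_def Y_def split: if_splits)
    then obtain y where y: "card S \<le> card {u \<in> S. \<phi> u = y} * card Y"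
      using large_fibre[OF fin Y(1) \<open>S \<noteq> {}\<close>] by blast
    define S' where "S' = {u \<in> S. \<phi> u = y}"
    have "card X \<le> card S' * p ^ (\<Sum>k<Suc m. c k)"
    proof -
      have "card S * p ^ (\<Sum>k<m. c k) \<le> (card S' * p ^ c m) * p ^ (\<Sum>k<m. c k)"
        using y Y(2) unfolding S'_def by (intro mult_le_mono1) simp
      with S(2) have "card X \<le> (card S' * p ^ c m) * p ^ (\<Sum>k<m. c k)" by (rule order_trans)
      then show ?thesis by (simp add: power_add algebra_simps)
    qed
    moreover have last: "int p dvd T m (d u v) i" if uv: "u \<in> S'" "v \<in> S'" for u v i
    proof (cases "i < c m")
      case True
      have "\<phi> u i = \<phi> v i" using uv by (simp add: S'_def)
      then have "T m (d u z) i mod int p = T m (d v z) i mod int p"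
        using True by (simp add: \<phi>_def)
      then show ?thesis by (subst lin[of m u v i z]) (simp only: mod_eq_dvd_iff)
    next
      case False
      show ?thesis
      proof (rule deg)
        show "m < M" using Suc.prems by simp
        show "u \<in> X" "v \<in> X" using uv S(1) by (auto simp: S'_def)
        show "c m \<le> i" using False by simp
        show "int p dvd T l (d u v) i" if "l < m" for l i
          using V that uv by (auto simp: S'_def)
      qed
    qed
    moreover have "int p dvd T k (d u v) i" if "u \<in> S'" "v \<in> S'" "k < Suc m" for u v k i
      using V[of u v k i] last[of u v i] that by (cases "k = m") (auto simp: S'_def)
    moreover have "S' \<subseteq> X" using S(1) by (auto simp: S'_def)
    ultimately show ?case by (intro exI[of _ S'] conjI ballI allI impI)
  qed
  obtain S where S: "S \<subseteq> X" "card X \<le> card S * p ^ (\<Sum>k<M. c k)"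
    and V: "\<forall>u\<in>S. \<forall>v\<in>S. \<forall>k<M. \<forall>i. int p dvd T k (d u v) i"
    using main[OF order_refl] by (elim exE conjE) (rule that)
  have "card S > 1"
  proof (rule ccontr)
    assume "\<not> card S > 1"
    then have "card S * p ^ (\<Sum>k<M. c k) \<le> 1 * p ^ (\<Sum>k<M. c k)" by (intro mult_le_mono1) simp
    also have "\<dots> < card X" using card by (simp only: mult_1)
    also note S(2)
    finally show False by (simp only: less_irrefl)
  qed
  then have "finite S" "\<not> card S \<le> Suc 0" by (auto intro: card_ge_0_finite)
  then obtain u v where "u \<in> S" "v \<in> S" "u \<noteq> v"
    using card_le_Suc0_iff_eq[of S] by blast
  moreover from this have "\<forall>k<M. \<forall>i. int p dvd T k (d u v) i" using V by simp
  ultimately show ?thesis using S(1) by (intro bexI[of _ u] bexI[of _ v] conjI) auto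
qed

end

section \<open>The auxiliary polynomial\<close>

context odd_prime
begin

lemma sum_lessThan_odd: "(\<Sum>k<2 * \<mu> + 1. k) = \<mu> * (2 * \<mu> + 1)" for \<mu> :: nat
  by (induction \<mu>) auto

text \<open>The unknowns are the coefficients of \<open>r j\<close> for \<open>j \<le> J\<close> and
  of \<open>s j\<close> for \<open>j < \<mu>\<close>, and the condition of order \<open>k\<close>
  costs \<open>c k\<close> of them. Entries are taken from \<open>{0..<p}\<close> so that two
  different vectors differ mod \<open>p\<close>.\<close>

lemma exists_auxiliary:
  assumes L: "p = 2 * L + 1" and g: "1 \<le> g" "g \<le> L" and f: "degree f \<le> 2 * Suc g"
    and \<mu>: "2 * \<mu>\<^sup>2 + 5 * \<mu> < L" and M: "M = 2 * \<mu> + 1" and J: "J = \<mu> + g"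
  obtains r s where "\<And>j. deglt (Suc L) (r j)" "\<And>j. deglt (L - g) (s j)"
    "\<And>j. J \<le> j + g \<Longrightarrow> s j = 0" "\<And>j. j > J \<Longrightarrow> r j = 0"
    "\<exists>j. \<not> pz (r j) \<or> \<not> pz (s j)" "\<And>k. k < M \<Longrightarrow> pz (diag f J r s k)"
proof -
  define I where "I = {False} \<times> {..J} \<times> {..L} \<union> {True} \<times> {..<\<mu>} \<times> {..<L - g}"
  define X where "X = PiE I (\<lambda>_. {0..<int p})"
  define r where "r w j = (\<Sum>i\<le>L. monom (if j \<le> J then w (False, j, i) else 0) i)"
    for w :: "bool \<times> nat \<times> nat \<Rightarrow> int" and j
  define s where "s w j = (\<Sum>i<L - g. monom (if j < \<mu> then w (True, j, i) else 0) i)"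
    for w :: "bool \<times> nat \<times> nat \<Rightarrow> int" and j
  define d where "d u v x = u x - v x" for u v :: "bool \<times> nat \<times> nat \<Rightarrow> int" and x
  define T where "T k w = coeff (diag f J (r w) (s w) k)" for k w
  define c where "c k = L + J + (g - 1) * k + 1" for k
  have cr: "coeff (r w j) i = (if i \<le> L \<and> j \<le> J then w (False, j, i) else 0)" for w j i
    by (simp add: r_def coeff_sum sum.delta')
  have cs: "coeff (s w j) i = (if i < L - g \<and> j < \<mu> then w (True, j, i) else 0)" for w j i
    by (simp add: s_def coeff_sum sum.delta')
  have degr: "deglt (Suc L) (r w j)" and degs: "deglt (L - g) (s w j)" for w j
    by (auto simp: deglt_def cr cs)
  have s0: "s w j = 0" if "J \<le> j + g" for w j
    using that J by (intro poly_eqI) (simp add: cs)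
  have r0: "r w j = 0" if "j > J" for w j
    using that by (intro poly_eqI) (simp add: cr)
  have Td: "T k (d u v) i = T k u i - T k v i" for k u v i
  proof -
    have "r (d u v) = (\<lambda>j. r u j - r v j)" "s (d u v) = (\<lambda>j. s u j - s v j)"
      by (auto simp: fun_eq_iff poly_eq_iff cr cs d_def)
    then show ?thesis by (simp add: T_def diag_diff)
  qed
  have fin: "finite I" by (simp add: I_def)
  have "card I = Suc J * Suc L + \<mu> * (L - g)"
    unfolding I_def by (subst card_Un_disjoint) auto
  moreover have cX: "card X = p ^ card I" using fin by (simp add: X_def card_PiE)
  moreover have "(\<Sum>k<M. c k) < Suc J * Suc L + \<mu> * (L - g)"
  proof -
    have "(\<Sum>k<M. c k) = M * (L + J + 1) + (g - 1) * (\<Sum>k<M. k)"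
      unfolding c_def sum.distrib sum_distrib_left by (simp add: distrib_left)
    also have "(\<Sum>k<M. k) = \<mu> * (2 * \<mu> + 1)"
      unfolding M by (rule sum_lessThan_odd)
    finally have S: "(\<Sum>k<M. c k) = M * (L + J + 1) + (g - 1) * (\<mu> * (2 * \<mu> + 1))" .
    obtain l where l: "L = g + l" using g(2) by (metis le_Suc_ex)
    have "int (2 * \<mu>\<^sup>2 + 5 * \<mu>) < int L" using \<mu> by (simp only: of_nat_less_iff)
    then have "int g * (2 * int \<mu> ^ 2 + 5 * int \<mu>) < int g * int L"
      using g(1) by (intro mult_strict_left_mono) simp_all
    \<comment> \<open>The surplus of unknowns is exactly
      \<open>g * L - 2 * g * \<mu>\<^sup>2 - (4 * g + 1) * \<mu>\<close>. Bounding
      \<open>4 * g + 1\<close> by \<open>5 * g\<close> gives a condition on \<open>\<mu>\<close>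
      free of \<open>g\<close>.\<close>
    moreover have "(4 * int g + 1) * int \<mu> \<le> 5 * int g * int \<mu>"
      using g(1) by (intro mult_right_mono) auto
    ultimately have "0 < int g * int L - 2 * int g * int \<mu> ^ 2 - (4 * int g + 1) * int \<mu>"
      by (simp add: algebra_simps)
    also have "\<dots> = int (Suc J * Suc L + \<mu> * (L - g)) - int (M * (L + J + 1) + (g - 1) * (\<mu> * (2 * \<mu> + 1)))"
      using g(1) unfolding M J l by (cases g) (simp_all add: algebra_simps power2_eq_square)
    finally show ?thesis unfolding S by linarith
  qed
  ultimately have card: "p ^ (\<Sum>k<M. c k) < card X"
    unfolding cX using p_gt_2 by (intro power_strict_increasing) (simp_all only:)
  have finX: "finite X" using fin by (simp add: X_def finite_PiE)
  have "\<exists>u\<in>X. \<exists>v\<in>X. u \<noteq> v \<and> (\<forall>k<M. \<forall>i. int p dvd T k (d u v) i)"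
  proof (rule successive_pigeonhole[OF finX _ _ card])
    fix k u v z i
    show "T k (d u v) i = T k (d u z) i - T k (d v z) i" by (simp add: Td)
  next
    fix k u v i
    assume "\<And>l i. l < k \<Longrightarrow> int p dvd T l (d u v) i" and i: "c k \<le> i"
    then have "pz (diag f J (r (d u v)) (s (d u v)) l)" if "l < k" for l
      using that by (simp add: pz_iff T_def)
    moreover have "L + g * k + J < i + k"
      using i g(1) by (cases g) (auto simp: c_def)
    ultimately show "int p dvd T k (d u v) i"
      unfolding T_def by (intro diag_degree[of L _ g]) (use degr degs s0 g f in auto)
  qed
  then obtain u v where uv: "u \<in> X" "v \<in> X" "u \<noteq> v"
    and T: "\<forall>k<M. \<forall>i. int p dvd T k (d u v) i" by blast
  obtain x where x: "u x \<noteq> v x" using uv(3) by (auto simp: fun_eq_iff)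
  have xI: "x \<in> I" using x uv unfolding X_def by (metis PiE_E)
  have "u x \<in> {0..<int p}" "v x \<in> {0..<int p}"
    using uv xI unfolding X_def by (auto dest: PiE_mem)
  then have "\<bar>u x - v x\<bar> < int p" by auto
  then have nd: "\<not> int p dvd d u v x"
    using x dvd_imp_le_int[of "u x - v x" "int p"] by (auto simp: d_def)
  obtain b j i where x_eq: "x = (b, j, i)" by (cases x)
  have "\<exists>j. \<not> pz (r (d u v) j) \<or> \<not> pz (s (d u v) j)"
  proof (cases b)
    case False
    then have "coeff (r (d u v) j) i = d u v x" using xI x_eq by (auto simp: I_def cr)
    then have "\<not> pz (r (d u v) j)" using nd unfolding pz_iff by metis
    then show ?thesis by blast
  next
    case True
    then have "coeff (s (d u v) j) i = d u v x" using xI x_eq by (auto simp: I_def cs)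
    then have "\<not> pz (s (d u v) j)" using nd unfolding pz_iff by metis
    then show ?thesis by blast
  qed
  moreover have "pz (diag f J (r (d u v)) (s (d u v)) k)" if "k < M" for k
    using T that by (simp add: pz_iff T_def)
  ultimately show thesis using that[of "r (d u v)" "s (d u v)"] degr degs s0 r0 by blast
qed

section \<open>Frobenius map and Fermat's little theorem\<close>

lemma pz_freshman: "pz ((a + b) ^ p - (a ^ p + b ^ p))"
proof -
  have "(a + b) ^ p = (\<Sum>k\<le>p. of_nat (p choose k) * a ^ k * b ^ (p - k))"
    by (rule binomial_ring)
  also have "{..p} = insert 0 (insert p {0<..<p})" using p_pos by auto
  also have "(\<Sum>k\<in>\<dots>. of_nat (p choose k) * a ^ k * b ^ (p - k))
      = a ^ p + b ^ p + (\<Sum>k\<in>{0<..<p}. of_nat (p choose k) * a ^ k * b ^ (p - k))"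
    using p_pos by (simp add: add_ac)
  finally have "(a + b) ^ p - (a ^ p + b ^ p)
      = (\<Sum>k\<in>{0<..<p}. of_nat (p choose k) * a ^ k * b ^ (p - k))" by simp
  moreover have "pz (of_nat (p choose k) * a ^ k * b ^ (p - k))" if "k \<in> {0<..<p}" for k
  proof -
    have "p dvd (p choose k)"
      using that prime_p by (intro dvd_choose_prime) auto
    then have "pz (of_nat (p choose k))"
      by (simp add: of_nat_poly)
    then show ?thesis by (intro pz_mult_right)
  qed
  ultimately show ?thesis by (simp only:) (rule pz_sum)
qed

lemma dvd_fermat: "int p dvd a ^ p - a"
proof (cases "int p dvd a")
  case True
  then show ?thesis using p_pos by (intro dvd_diff) (auto intro: dvd_trans[OF _ dvd_power])
next
  case False
  define n where "n = nat (a mod int p)"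
  have n: "int n = a mod int p" using p_pos by (simp add: n_def)
  have "\<not> p dvd n" using False n by (metis dvd_mod_iff dvd_refl int_dvd_int_iff)
  then have "[n ^ (p - 1) = 1] (mod p)" using prime_p by (intro fermat_theorem)
  then have "[n * n ^ (p - 1) = n * 1] (mod p)" by (rule cong_scalar_left)
  then have "[n ^ p = n] (mod p)" using p_pos by (cases p) simp_all
  then have "[int n ^ p = int n] (mod int p)" by (metis cong_int_iff of_nat_power)
  then show ?thesis unfolding n by (simp add: cong_def power_mod mod_eq_dvd_iff)
qed

end

text \<open>The pullback of the same derivative along \<open>(x, y) \<mapsto> ((x, y), (x ^ p, y ^ p))\<close>. It agrees with
  \<open>diag\<close> at rational points, which are fixed by the Frobenius map.\<close>

definition auxiliary ::
    "nat \<Rightarrow> int poly \<Rightarrow> int \<Rightarrow> nat \<Rightarrow> nat \<Rightarrow> (nat \<Rightarrow> int poly) \<Rightarrow> (nat \<Rightarrow> int poly) \<Rightarrow> nat \<Rightarrow> int poly" where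
  "auxiliary p f \<epsilon> L J r s k = (\<Sum>j\<le>J. monom 1 (p * j) *
     (dpow f 0 k (r j) + [:\<epsilon>:] * f ^ (if even k then Suc L else L) * dpow f 1 k (s j)))"

lemma pderiv_sum: "pderiv (sum F A) = (\<Sum>i\<in>A. pderiv (F i))"
  by (induction A rule: infinite_finite_induct) (simp_all add: pderiv_add)

lemma pderiv_power_of_nat:
  "pderiv (f ^ Suc n) = of_nat (Suc n) * f ^ n * pderiv f" for f :: "int poly"
  by (simp only: pderiv_power_Suc of_nat_poly) simp

lemma pderiv_const_mult: "pderiv ([:c:] * f) = [:c:] * pderiv f" for f :: "int poly"
  by (simp add: pderiv_smult)

context odd_prime
begin

lemma pz_pderiv_monom: "pz (pderiv (monom 1 (p * j)))"
  by (simp add: pz_iff pderiv_monom coeff_monom)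

text \<open>Modulo \<open>p\<close> the factors \<open>x ^ (p * j)\<close> are constants for the
  derivation, and \<open>2 * (L + 1) = p + 1\<close> becomes 1, so \<open>f ^ (L + 1)\<close> is
  differentiated like \<open>y\<close> times the constant \<open>y ^ p\<close>.\<close>

lemma pz_auxiliary_Suc_even:
  assumes "p = 2 * L + 1" "even k"
  shows "pz (2 * pderiv (auxiliary p f \<epsilon> L J r s k) - auxiliary p f \<epsilon> L J r s (Suc k))"
proof -
  have "2 * pderiv (auxiliary p f \<epsilon> L J r s k) - auxiliary p f \<epsilon> L J r s (Suc k)
      = (\<Sum>j\<le>J. pderiv (monom 1 (p * j)) * (2 * (dpow f 0 k (r j) + [:\<epsilon>:] * f ^ Suc L * dpow f 1 k (s j)))
         + [:int p:] * (monom 1 (p * j) * [:\<epsilon>:] * pderiv f * f ^ L * dpow f 1 k (s j)))"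
    (is "_ = (\<Sum>j\<le>J. ?t j)")
  proof -
    have "2 * pderiv (monom 1 (p * j) * (a + [:\<epsilon>:] * f ^ Suc L * b))
          - monom 1 (p * j) * (2 * pderiv a + [:\<epsilon>:] * f ^ L * (2 * f * pderiv b + pderiv f * b))
        = pderiv (monom 1 (p * j)) * (2 * (a + [:\<epsilon>:] * f ^ Suc L * b))
         + [:int p:] * (monom 1 (p * j) * [:\<epsilon>:] * pderiv f * f ^ L * b)" for a b j
    proof -
      define x where "x = (monom 1 (p * j) :: int poly)"
      define E where "E = [:\<epsilon>:]"
      have "pderiv (x * (a + E * f ^ Suc L * b)) = pderiv x * (a + E * f ^ Suc L * b)
          + x * (pderiv a + E * (of_nat (Suc L) * f ^ L * pderiv f * b + f ^ Suc L * pderiv b))"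
        unfolding pderiv_mult[of x] pderiv_add E_def mult.assoc pderiv_const_mult pderiv_mult[of "f ^ Suc L"]
          pderiv_power_of_nat by (simp only: algebra_simps)
      moreover have "[:int p:] = 2 * of_nat (Suc L) - 1"
        by (simp only: of_nat_poly[of p, symmetric]) (simp add: assms(1))
      ultimately show ?thesis
        unfolding x_def[symmetric] E_def[symmetric]
        by (simp only: power_Suc) (simp only: algebra_simps)
    qed
    then show ?thesis
      using assms(2) unfolding auxiliary_def
      by (simp add: pderiv_sum sum_distrib_left dop_def flip: sum_subtractf)
  qed
  moreover have "pz (?t j)" for j
    by (intro pz_add pz_mult_right pz_pderiv_monom) simp
  ultimately show ?thesis by (simp add: pz_sum)
qed

text \<open>At odd order a factor \<open>y\<close> has been dropped, so the derivation reads
  \<open>2 * f * d/dx + f'\<close>. As \<open>2 * L = p - 1\<close> becomes -1 modulo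
  \<open>p\<close>, the derivative of \<open>f ^ L\<close> cancels against the term with
  \<open>f'\<close>.\<close>

lemma pz_auxiliary_Suc_odd:
  assumes "p = 2 * L + 1" "odd k" "0 < L"
  shows "pz (2 * f * pderiv (auxiliary p f \<epsilon> L J r s k) + pderiv f * auxiliary p f \<epsilon> L J r s k
     - auxiliary p f \<epsilon> L J r s (Suc k))"
proof -
  have "2 * f * pderiv (auxiliary p f \<epsilon> L J r s k) + pderiv f * auxiliary p f \<epsilon> L J r s k
       - auxiliary p f \<epsilon> L J r s (Suc k)
      = (\<Sum>j\<le>J. pderiv (monom 1 (p * j)) * (2 * f * (dpow f 0 k (r j) + [:\<epsilon>:] * f ^ L * dpow f 1 k (s j)))
         + [:int p:] * (monom 1 (p * j) * [:\<epsilon>:] * pderiv f * f ^ L * dpow f 1 k (s j)))"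
    (is "_ = (\<Sum>j\<le>J. ?t j)")
  proof -
    have "2 * f * pderiv (monom 1 (p * j) * (a + [:\<epsilon>:] * f ^ L * b))
          + pderiv f * (monom 1 (p * j) * (a + [:\<epsilon>:] * f ^ L * b))
          - monom 1 (p * j) * (2 * f * pderiv a + pderiv f * a + [:\<epsilon>:] * f ^ Suc L * (2 * pderiv b))
        = pderiv (monom 1 (p * j)) * (2 * f * (a + [:\<epsilon>:] * f ^ L * b))
         + [:int p:] * (monom 1 (p * j) * [:\<epsilon>:] * pderiv f * f ^ L * b)" for a b j
    proof -
      obtain l where l: "L = Suc l" using assms(3) by (cases L) auto
      define x where "x = (monom 1 (p * j) :: int poly)"
      define E where "E = [:\<epsilon>:]"
      have "pderiv (x * (a + E * f ^ L * b)) = pderiv x * (a + E * f ^ L * b)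
          + x * (pderiv a + E * (of_nat L * f ^ l * pderiv f * b + f ^ L * pderiv b))"
        unfolding l pderiv_mult[of x] pderiv_add E_def mult.assoc pderiv_const_mult pderiv_mult[of "f ^ Suc l"]
          pderiv_power_of_nat by (simp only: algebra_simps)
      moreover have "[:int p:] = 2 * of_nat L + 1"
        by (simp only: of_nat_poly[of p, symmetric]) (simp add: assms(1))
      ultimately show ?thesis
        unfolding x_def[symmetric] E_def[symmetric] l
        by (simp only: power_Suc) (simp only: algebra_simps)
    qed
    then show ?thesis
      using assms(2) unfolding auxiliary_def
      by (simp add: pderiv_sum sum_distrib_left dop_def flip: sum_subtractf sum.distrib)
  qed
  moreover have "pz (?t j)" for j
    by (intro pz_add pz_mult_right pz_pderiv_monom) simp
  ultimately show ?thesis by (simp add: pz_sum)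
qed

text \<open>At the points in question \<open>\<epsilon> * f a ^ L\<close> is 1 and
  \<open>a ^ p\<close> is \<open>a\<close>; this is what the sign in the auxiliary polynomial is
  for.\<close>

lemma poly_auxiliary_eq_diag:
  assumes "int p dvd poly f a ^ L - \<epsilon>" "\<epsilon>\<^sup>2 = 1"
  shows "int p dvd poly (auxiliary p f \<epsilon> L J r s k) a - poly (diag f J r s k) a"
proof -
  have "[a ^ p = a] (mod int p)"
    using dvd_fermat[of a] by (simp add: cong_iff_dvd_diff)
  then have 1: "[a ^ (p * j) = a ^ j] (mod int p)" for j
    unfolding power_mult by (rule cong_pow)
  have "[poly f a ^ L = \<epsilon>] (mod int p)" using assms(1) by (simp add: cong_iff_dvd_diff)
  then have "[\<epsilon> * poly f a ^ L = \<epsilon> * \<epsilon>] (mod int p)" by (rule cong_scalar_left)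
  then have 2: "[\<epsilon> * poly f a ^ L = 1] (mod int p)" using assms(2) by (simp add: power2_eq_square)
  have 3: "[\<epsilon> * poly f a ^ (if even k then Suc L else L) = (if even k then poly f a else 1)] (mod int p)"
    using 2 cong_scalar_left[OF 2, of "poly f a"] by (auto simp: algebra_simps)
  have "[(\<Sum>j\<le>J. a ^ (p * j) * (u j + (\<epsilon> * poly f a ^ (if even k then Suc L else L)) * v j))
      = (\<Sum>j\<le>J. a ^ j * (u j + (if even k then poly f a else 1) * v j))] (mod int p)" for u v
    by (intro cong_sum cong_mult cong_add 1 3 cong_refl)
  then have "[poly (auxiliary p f \<epsilon> L J r s k) a = poly (diag f J r s k) a] (mod int p)"
    by (simp add: auxiliary_def diag_def poly_sum poly_monom mult.assoc if_distrib[of "\<lambda>g. poly g a"] cong: if_cong)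
  then show ?thesis by (simp add: cong_iff_dvd_diff)
qed

text \<open>Downwards from order \<open>M\<close>: the polynomial of order \<open>k\<close> has a
  root at \<open>a\<close>, and its differential equation hands it the multiplicity of the one of
  order \<open>k + 1\<close>, plus one. The leading coefficient \<open>2\<close> or
  \<open>2 * f\<close> is a unit at \<open>a\<close> because \<open>\<epsilon>\<close>, hence
  \<open>f a\<close>, is nonzero mod \<open>p\<close>.\<close>

lemma pdvd_auxiliary:
  assumes "p = 2 * L + 1" "M < p" "\<And>k. k < M \<Longrightarrow> pz (diag f J r s k)"
    and "int p dvd poly f a ^ L - \<epsilon>" "\<epsilon>\<^sup>2 = 1"
  shows "pdvd ([:- a, 1:] ^ M) (auxiliary p f \<epsilon> L J r s 0)"
proof -
  have "0 < L" using assms(1) p_gt_2 by simp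
  have \<epsilon>: "\<not> int p dvd \<epsilon>"
  proof
    assume "int p dvd \<epsilon>"
    then have "int p dvd \<epsilon>\<^sup>2" by (simp add: power2_eq_square)
    with assms(5) show False using p_gt_2 by simp
  qed
  have fa: "\<not> int p dvd poly f a"
  proof
    assume "int p dvd poly f a"
    then have "int p dvd poly f a ^ L" using \<open>0 < L\<close> by (meson dvd_power dvd_trans)
    with assms(4) \<epsilon> show False by (metis dvd_diff_right_iff)
  qed
  have "m \<le> M \<Longrightarrow> pdvd ([:- a, 1:] ^ m) (auxiliary p f \<epsilon> L J r s (M - m))" for m
  proof (induction m)
    case 0
    then show ?case using pdvd_triv(1)[of 1] by simp
  next
    case (Suc m)
    define k where "k = M - Suc m"
    define F where "F = auxiliary p f \<epsilon> L J r s k"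
    have k: "k < M" "M - m = Suc k" using Suc.prems by (auto simp: k_def)
    have root: "int p dvd poly F a"
      using poly_auxiliary_eq_diag[OF assms(4,5), of J r s k] pz_poly[OF assms(3)[OF k(1)], of a]
      unfolding F_def by (metis dvd_diff_right_iff dvd_diff_left_iff diff_add_cancel dvd_add)
    have succ: "pdvd ([:- a, 1:] ^ m) (auxiliary p f \<epsilon> L J r s (Suc k))"
      using Suc k by simp
    have "pdvd ([:- a, 1:] ^ Suc m) F"
    proof (cases "even k")
      case True
      have "pz ((2 * pderiv F + 0 * F) - auxiliary p f \<epsilon> L J r s (Suc k))"
        using pz_auxiliary_Suc_even[OF assms(1) True, of f \<epsilon> J r s] by (simp add: F_def)
      then have "pdvd ([:- a, 1:] ^ m) (2 * pderiv F + 0 * F)"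
        using succ pdvd_cong by blast
      moreover have "\<not> int p dvd poly 2 a" using p_gt_2 by (auto dest: zdvd_imp_le)
      ultimately show ?thesis
        using root Suc.prems assms(2) by (intro pdvd_linear_power_of_ode[of a m 2 F 0]) auto
    next
      case False
      have "pz ((2 * f * pderiv F + pderiv f * F) - auxiliary p f \<epsilon> L J r s (Suc k))"
        using pz_auxiliary_Suc_odd[OF assms(1) False \<open>0 < L\<close>, of f \<epsilon> J r s] by (simp add: F_def)
      then have "pdvd ([:- a, 1:] ^ m) (2 * f * pderiv F + pderiv f * F)"
        using succ pdvd_cong by blast
      moreover have "\<not> int p dvd 2" using p_gt_2 by (auto dest: zdvd_imp_le)
      then have "\<not> int p dvd poly (2 * f) a"
        using fa prime_int_p by (simp add: prime_dvd_mult_iff)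
      ultimately show ?thesis
        using root Suc.prems assms(2) by (intro pdvd_linear_power_of_ode[of a m "2 * f" F "pderiv f"]) auto
    qed
    then show ?case by (simp add: F_def k_def)
  qed
  from this[of M] show ?thesis by simp
qed

text \<open>Take the least \<open>j0\<close> with \<open>r j0\<close> or \<open>s j0\<close> nonzero
  and divide by \<open>x ^ (p * j0)\<close>: then
  \<open>r j0 + \<epsilon> * f ^ (L + 1) * s j0\<close> is 0 modulo \<open>x ^ p\<close>. Squaring
  turns the power of \<open>f\<close> into \<open>f * f ^ p\<close>, and \<open>f ^ p\<close> is
  \<open>f 0\<close> modulo \<open>x ^ p\<close>. In the resulting congruence of
  \<open>(r j0)\<^sup>2\<close> with \<open>f 0 * f * (s j0)\<^sup>2\<close> both sides have degree
  at most \<open>2 * L < p\<close>, so it is an identity, which nondegeneracy excludes.\<close>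

lemma not_pz_auxiliary:
  assumes L: "p = 2 * L + 1" and g: "g \<le> L" and f: "degree f \<le> 2 * Suc g" and \<epsilon>: "\<epsilon>\<^sup>2 = 1"
    and nondegenerate: "\<And>u v. pz (u\<^sup>2 - [:coeff f 0:] * v\<^sup>2 * f) \<Longrightarrow> pz u \<and> pz v"
    and r: "\<And>j. deglt (Suc L) (r j)" and s: "\<And>j. deglt (L - g) (s j)"
    and r0: "\<And>j. j > J \<Longrightarrow> r j = 0" and s0: "\<And>j. j > J \<Longrightarrow> s j = 0"
    and "\<exists>j. \<not> pz (r j) \<or> \<not> pz (s j)"
  shows "\<not> pz (auxiliary p f \<epsilon> L J r s 0)"
proof
  assume F: "pz (auxiliary p f \<epsilon> L J r s 0)"
  define P where "P j \<longleftrightarrow> \<not> pz (r j) \<or> \<not> pz (s j)" for j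
  define j0 where "j0 = (LEAST j. P j)"
  have P: "P j0" unfolding j0_def by (rule LeastI_ex) (use assms(10) in \<open>simp add: P_def\<close>)
  have less: "\<not> P j" if "j < j0" for j using that not_less_Least unfolding j0_def by blast
  have j0: "j0 \<le> J"
  proof (rule ccontr)
    assume "\<not> j0 \<le> J"
    then show False using P r0 s0 by (simp add: P_def)
  qed
  define x where "x n = (monom 1 n :: int poly)" for n
  have x_add: "x (m + n) = x m * x n" for m n by (simp add: x_def mult_monom)
  define A where "A j = r j + [:\<epsilon>:] * f ^ Suc L * s j" for j
  define Z where "Z = (\<Sum>j\<in>{j0<..J}. x (p * (j - Suc j0)) * A j)"
  have "auxiliary p f \<epsilon> L J r s 0 = (\<Sum>j\<le>J. x (p * j) * A j)"
    by (simp add: auxiliary_def A_def x_def)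
  also have "{..J} = {..<j0} \<union> insert j0 {j0<..J}" using j0 by auto
  also have "(\<Sum>j\<in>\<dots>. x (p * j) * A j)
      = (\<Sum>j<j0. x (p * j) * A j) + (x (p * j0) * A j0 + (\<Sum>j\<in>{j0<..J}. x (p * j) * A j))"
    by (subst sum.union_disjoint) auto
  also have "(\<Sum>j\<in>{j0<..J}. x (p * j) * A j) = x (p * j0) * (x p * Z)"
    unfolding Z_def sum_distrib_left
  proof (rule sum.cong[OF refl])
    fix j assume "j \<in> {j0<..J}"
    then have "p * j = p * j0 + (p + p * (j - Suc j0))"
      by (metis add.assoc add_mult_distrib2 greaterThanAtMost_iff le_add_diff_inverse mult_Suc_right Suc_leI add_Suc_right)
    then show "x (p * j) * A j = x (p * j0) * (x p * (x (p * (j - Suc j0)) * A j))"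
      by (simp add: x_add mult.assoc)
  qed
  finally have eq: "auxiliary p f \<epsilon> L J r s 0
      = (\<Sum>j<j0. x (p * j) * A j) + x (p * j0) * (A j0 + x p * Z)"
    by (simp add: distrib_left)
  have "pz (\<Sum>j<j0. x (p * j) * A j)"
    using less unfolding A_def P_def by (intro pz_sum pz_mult_left pz_add) auto
  with F eq have "pz (x (p * j0) * (A j0 + x p * Z))"
    using pz_diff by fastforce
  moreover have "\<not> pz (x (p * j0))" unfolding x_def by (rule monic_not_pz) (simp add: degree_monom_eq)
  ultimately have B: "pz (A j0 + x p * Z)" by (simp add: pz_mult_iff)
  define R where "R = r j0"
  define S where "S = s j0"
  define c where "c = coeff f 0"
  define E where "E = [:\<epsilon>:]"
  have E: "E * E = 1" using \<epsilon> by (simp add: E_def power2_eq_square one_pCons)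
  obtain h where fh: "f = [:c:] + x 1 * h"
    by (cases f) (auto simp: c_def x_def monom_altdef)
  have "pz (f ^ p - ([:c:] ^ p + (x 1 * h) ^ p))" unfolding fh by (rule pz_freshman)
  moreover have "pz ([:c:] ^ p - [:c:])"
    using dvd_fermat[of c] by (simp add: poly_const_pow)
  moreover have "(x 1 * h) ^ p = x p * h ^ p"
    by (simp add: power_mult_distrib x_def monom_power)
  ultimately have fp: "pz (f ^ p - ([:c:] + x p * h ^ p))"
    by (metis add_diff_cancel_right pz_trans)
  define V where "V = x p * Z"
  have R2: "pz (R\<^sup>2 - (f * f ^ p * S\<^sup>2 + x p * Z * (2 * E * f ^ Suc L * S + x p * Z)))"
  proof -
    define G where "G = f ^ Suc L"
    have "Suc p = Suc L + Suc L" using L by simp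
    then have "f ^ Suc p = G * G" unfolding G_def by (simp only: power_add)
    then have "f * f ^ p = G * G" by simp
    then have "R\<^sup>2 - (f * f ^ p * S\<^sup>2 + V * (2 * E * G * S + V))
        = R\<^sup>2 - (E * G * S + V)\<^sup>2 + (E * E - 1) * (G * G * S\<^sup>2)"
      by (simp add: algebra_simps power2_eq_square)
    also have "\<dots> = (R + E * G * S + V) * (R - E * G * S - V)"
      unfolding E by (simp add: algebra_simps power2_eq_square)
    also have "pz \<dots>" using B by (intro pz_mult_right) (simp add: A_def R_def S_def E_def V_def G_def)
    finally show ?thesis by (simp only: G_def V_def)
  qed
  define Q where "Q = h ^ p * (f * S\<^sup>2) + Z * (2 * E * f ^ Suc L * S + x p * Z)"
  have "pz (R\<^sup>2 - [:c:] * S\<^sup>2 * f - x p * Q)"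
  proof -
    have "R\<^sup>2 - [:c:] * S\<^sup>2 * f - x p * Q
        = (R\<^sup>2 - (f * f ^ p * S\<^sup>2 + x p * Z * (2 * E * f ^ Suc L * S + x p * Z)))
          + (f ^ p - ([:c:] + x p * h ^ p)) * (f * S\<^sup>2)"
      unfolding Q_def by (simp only: algebra_simps)
    then show ?thesis using R2 fp by (metis pz_add pz_mult_right)
  qed
  moreover have "int p dvd coeff (R\<^sup>2 - [:c:] * S\<^sup>2 * f) i" if "degree (x p) \<le> i" for i
  proof -
    have i: "2 * L < i" using that L by (simp add: x_def degree_monom_eq)
    have dR: "degree R \<le> L" using r[of j0] by (auto simp: R_def deglt_iff)
    have "degree (R\<^sup>2) \<le> 2 * L" using degree_power_le[of R 2] dR by simp
    moreover have "degree ([:c:] * S\<^sup>2 * f) \<le> 2 * L"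
    proof (cases "S = 0")
      case False
      then have "degree S + Suc g \<le> L" using s[of j0] by (auto simp: S_def deglt_iff)
      moreover have "degree ([:c:] * S\<^sup>2 * f) \<le> degree ([:c:] * S\<^sup>2) + degree f"
        by (rule degree_mult_le)
      moreover have "degree ([:c:] * S\<^sup>2) \<le> 2 * degree S"
        using degree_mult_le[of "[:c:]" "S\<^sup>2"] degree_power_le[of S 2] by simp
      ultimately have "degree ([:c:] * S\<^sup>2 * f) \<le> 2 * degree S + 2 * Suc g"
        using f by (meson add_mono order_trans)
      also have "\<dots> \<le> 2 * L" using \<open>degree S + Suc g \<le> L\<close> by simp
      finally show ?thesis .
    qed simp
    ultimately have "degree (R\<^sup>2 - [:c:] * S\<^sup>2 * f) \<le> 2 * L" by (rule degree_diff_le)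
    then have "coeff (R\<^sup>2 - [:c:] * S\<^sup>2 * f) i = 0" using i by (intro coeff_eq_0) simp
    then show ?thesis by simp
  qed
  moreover have "lead_coeff (x p) = 1" by (simp add: x_def degree_monom_eq)
  ultimately have "pz (R\<^sup>2 - [:c:] * S\<^sup>2 * f)" using pz_degree_lt by blast
  then have "pz R \<and> pz S" using nondegenerate unfolding c_def by blast
  then show False using P by (simp add: P_def R_def S_def)
qed

lemma degree_auxiliary:
  assumes "p = 2 * L + 1" "degree f \<le> 2 * Suc g" "\<And>j. deglt (Suc L) (r j)" "\<And>j. deglt (L - g) (s j)"
    "\<And>j. J \<le> j + g \<Longrightarrow> s j = 0"
  shows "degree (auxiliary p f \<epsilon> L J r s 0) \<le> L + p * J"
proof -
  have "degree (monom 1 (p * j) * (r j + [:\<epsilon>:] * f ^ Suc L * s j)) \<le> L + p * J" if j: "j \<le> J" for j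
  proof -
    have pj: "p * j \<le> p * J" using j by simp
    have "degree (monom 1 (p * j) * r j) \<le> L + p * J"
    proof (cases "r j = 0")
      case False
      then have "degree (r j) \<le> L" using assms(3)[of j] by (simp add: deglt_iff)
      then show ?thesis
        using degree_mult_le[of "monom 1 (p * j)" "r j"] degree_monom_le[of "1::int" "p * j"] pj
        by linarith
    qed simp
    moreover have "degree (monom 1 (p * j) * ([:\<epsilon>:] * f ^ Suc L * s j)) \<le> L + p * J"
    proof (cases "s j = 0")
      case False
      have a: "degree (s j) + Suc g \<le> L" using assms(4)[of j] False by (auto simp: deglt_iff)
      have b: "j + Suc g \<le> J" using assms(5)[of j] False by (cases "J \<le> j + g") auto
      have "degree (f ^ Suc L) \<le> degree f * Suc L" by (rule degree_power_le)
      also have "\<dots> \<le> 2 * Suc g * Suc L" using assms(2) by (rule mult_le_mono1)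
      \<comment> \<open>By \<open>2 * (L + 1) = p + 1\<close> the power of \<open>f\<close> costs
        \<open>g + 1\<close> factors \<open>x ^ p\<close>, for which \<open>s j = 0\<close> from
        \<open>j = J - g\<close> on makes room, and a remainder \<open>g + 1\<close>, which the
        degree bound on \<open>s j\<close> absorbs.\<close>
      also have "\<dots> = Suc g + p * Suc g" unfolding assms(1) by simp
      finally have "degree (f ^ Suc L) \<le> Suc g + p * Suc g" .
      moreover have "degree ([:\<epsilon>:] * f ^ Suc L * s j) \<le> degree (f ^ Suc L) + degree (s j)"
        using degree_mult_le[of "[:\<epsilon>:] * f ^ Suc L" "s j"] degree_mult_le[of "[:\<epsilon>:]" "f ^ Suc L"] by simp
      moreover have "degree (monom 1 (p * j) * ([:\<epsilon>:] * f ^ Suc L * s j))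
          \<le> p * j + degree ([:\<epsilon>:] * f ^ Suc L * s j)"
        using degree_mult_le[of "monom 1 (p * j)" "[:\<epsilon>:] * f ^ Suc L * s j"] degree_monom_le[of "1::int" "p * j"]
        by simp
      moreover have "p * j + p * Suc g \<le> p * J"
        using mult_le_mono2[OF b, of p] by (simp only: add_mult_distrib2)
      ultimately show ?thesis using a by linarith
    qed simp
    ultimately show ?thesis by (simp only: distrib_left degree_add_le)
  qed
  then show ?thesis unfolding auxiliary_def by (intro degree_sum_le) auto
qed

text \<open>Each counted point is a zero of multiplicity \<open>2 * \<mu> + 1\<close>. As
  \<open>L + p * \<mu>\<close> is just below \<open>p / 2\<close> times that, the count exceeds
  \<open>p / 2\<close> by at most \<open>p * g / (2 * \<mu> + 1)\<close>.\<close>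

theorem card_character_value_le:
  assumes L: "p = 2 * L + 1" and g: "1 \<le> g" "g \<le> L" and f: "degree f \<le> 2 * Suc g" and \<epsilon>: "\<epsilon>\<^sup>2 = 1"
    and nondegenerate: "\<And>u v. pz (u\<^sup>2 - [:coeff f 0:] * v\<^sup>2 * f) \<Longrightarrow> pz u \<and> pz v"
    and \<mu>: "2 * \<mu>\<^sup>2 + 5 * \<mu> < L"
  shows "(2 * \<mu> + 1) * card {a \<in> {0..<p}. int p dvd poly f (int a) ^ L - \<epsilon>} \<le> L + p * (\<mu> + g)"
proof -
  obtain r s where rs: "\<And>j. deglt (Suc L) (r j)" "\<And>j. deglt (L - g) (s j)"
    "\<And>j. \<mu> + g \<le> j + g \<Longrightarrow> s j = 0" "\<And>j. j > \<mu> + g \<Longrightarrow> r j = 0"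
    "\<exists>j. \<not> pz (r j) \<or> \<not> pz (s j)" "\<And>k. k < 2 * \<mu> + 1 \<Longrightarrow> pz (diag f (\<mu> + g) r s k)"
    by (rule exists_auxiliary[OF L g f \<mu> refl refl]) blast
  have "\<not> pz (auxiliary p f \<epsilon> L (\<mu> + g) r s 0)"
    by (rule not_pz_auxiliary[OF L g(2) f \<epsilon> nondegenerate rs(1,2,4) _ rs(5)]) (use rs(3) in auto)
  moreover have "degree (auxiliary p f \<epsilon> L (\<mu> + g) r s 0) \<le> L + p * (\<mu> + g)"
    by (rule degree_auxiliary[OF L f rs(1-3)])
  moreover have "2 * \<mu> + 1 < p" using L \<mu> by simp
  ultimately show ?thesis
    using pdvd_auxiliary[OF L _ rs(6) _ \<epsilon>] by (intro card_roots_le) (auto simp del: power_Suc)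
qed

end

section \<open>Quadratic character sums\<close>

context odd_prime
begin

abbreviation chi :: "int \<Rightarrow> int" where
  "chi a \<equiv> Legendre a (int p)"

lemma chi_cases: "chi a \<in> {-1, 0, 1}"
  by (simp add: Legendre_def)

lemma chi_eq_0_iff: "chi a = 0 \<longleftrightarrow> int p dvd a"
  by (simp add: Legendre_def cong_0_iff)

lemma abs_chi_le: "\<bar>chi a\<bar> \<le> 1"
  using chi_cases[of a] by auto

lemma dvd_chi_diff: "int p dvd chi a - a ^ ((p - 1) div 2)"
  using euler_criterion[OF prime_p p_gt_2, of a] by (simp add: cong_iff_dvd_diff)

lemma chi_eqI:
  assumes "e \<in> {-1, 0, 1}" "int p dvd e - a ^ ((p - 1) div 2)"
  shows "chi a = e"
proof -
  have "int p dvd (chi a - a ^ ((p - 1) div 2)) - (e - a ^ ((p - 1) div 2))"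
    using dvd_chi_diff assms(2) by (rule dvd_diff)
  then have "int p dvd chi a - e" by simp
  moreover have "\<bar>chi a - e\<bar> < int p" using chi_cases[of a] assms(1) p_gt_2 by auto
  ultimately show ?thesis using dvd_imp_le_int[of "chi a - e" "int p"] by fastforce
qed

lemma chi_eq_iff:
  "e \<in> {-1, 0, 1} \<Longrightarrow> chi a = e \<longleftrightarrow> int p dvd a ^ ((p - 1) div 2) - e"
  using chi_eqI[of e a] dvd_chi_diff[of a] by (auto simp: dvd_diff_commute)

lemma chi_mult: "chi (a * b) = chi a * chi b"
proof (rule chi_eqI)
  show "chi a * chi b \<in> {-1, 0, 1}" using chi_cases[of a] chi_cases[of b] by auto
  define n where "n = (p - 1) div 2"
  have "chi a * chi b - (a * b) ^ n = chi a * (chi b - b ^ n) + (chi a - a ^ n) * b ^ n"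
    by (simp add: algebra_simps power_mult_distrib)
  then show "int p dvd chi a * chi b - (a * b) ^ ((p - 1) div 2)"
    using dvd_chi_diff[of a] dvd_chi_diff[of b] by (simp add: n_def)
qed

lemma chi_1 [simp]: "chi 1 = 1"
  by (rule chi_eqI) auto

lemma chi_prod: "chi (prod f A) = (\<Prod>x\<in>A. chi (f x))"
  by (induction A rule: infinite_finite_induct) (auto simp: chi_mult)

lemma chi_cong: "[a = b] (mod int p) \<Longrightarrow> chi a = chi b"
proof (rule chi_eqI[OF chi_cases])
  assume "[a = b] (mod int p)"
  then have "[a ^ ((p - 1) div 2) = b ^ ((p - 1) div 2)] (mod int p)" by (rule cong_pow)
  then have "int p dvd b ^ ((p - 1) div 2) - a ^ ((p - 1) div 2)"
    by (simp add: cong_iff_dvd_diff dvd_diff_commute)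
  from dvd_add[OF dvd_chi_diff[of b] this] show "int p dvd chi b - a ^ ((p - 1) div 2)"
    by simp
qed

lemma chi_mod [simp]: "chi (a mod int p) = chi a"
  by (rule chi_cong) simp

section \<open>The Hasse-Weil bound for quadratic character sums\<close>

lemma abs_sum_chi_le:
  assumes g: "1 \<le> g" "2 * g < p" and f: "degree f \<le> 2 * Suc g" "\<not> pz f" and p: "p \<ge> 100"
    and nondegenerate: "\<And>u v. pz (u\<^sup>2 - [:coeff f 0:] * v\<^sup>2 * f) \<Longrightarrow> pz u \<and> pz v"
  shows "\<bar>real_of_int (\<Sum>y<p. chi (poly f (int y)))\<bar> \<le> 2 * real g * (sqrt (real p) + 10) + 2 * (real g + 1)"
proof -
  define L where "L = (p - 1) div 2"
  have L: "p = 2 * L + 1" using odd_p by (simp add: L_def)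
  have gL: "g \<le> L" using g(2) L by simp
  define s where "s = sqrt (real p)"
  have s: "s \<ge> 10" unfolding s_def using p by (intro real_le_rsqrt) auto
  have s2: "s * s = real p" by (simp add: s_def)
  \<comment> \<open>The largest \<open>\<mu>\<close> with \<open>2 * \<mu> \<le> s - 4\<close>. It
    is admissible because \<open>(s - 4) * (s + 1) < s\<^sup>2 - 1\<close>, and
    \<open>2 * \<mu> + 1 > s - 5\<close> gives \<open>p / (2 * \<mu> + 1) \<le> s + 10\<close> once
    \<open>s \<ge> 10\<close>; hence the constant 10.\<close>
  define \<mu> where "\<mu> = nat \<lfloor>(s - 4) / 2\<rfloor>"
  have \<mu>1: "2 * real \<mu> \<le> s - 4" proof -
    have "real \<mu> \<le> (s - 4) / 2" unfolding \<mu>_def using s by (intro of_nat_floor) simp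
    then show ?thesis by simp
  qed
  have \<mu>2: "s - 6 < 2 * real \<mu>"
  proof -
    define n where "n = \<lfloor>(s - 4) / 2\<rfloor>"
    have "(s - 4) / 2 < real_of_int n + 1" unfolding n_def by (rule real_of_int_floor_add_one_gt)
    moreover have "0 \<le> n" using s by (simp add: n_def)
    then have "real \<mu> = real_of_int n" by (simp add: \<mu>_def n_def)
    ultimately show ?thesis by (simp add: field_simps)
  qed
  have "(2 * real \<mu>) * (2 * real \<mu> + 5) \<le> (s - 4) * (s - 4 + 5)"
    using \<mu>1 s by (intro mult_mono) auto
  also have "\<dots> < real p - 1" using s by (simp add: algebra_simps flip: s2)
  also have "\<dots> = 2 * real L" unfolding L by simp
  finally have "real (2 * \<mu>\<^sup>2 + 5 * \<mu>) < real L" by (simp add: algebra_simps power2_eq_square)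
  then have \<mu>L: "2 * \<mu>\<^sup>2 + 5 * \<mu> < L" by (simp only: of_nat_less_iff)
  define N where "N e = {a \<in> {0..<p}. chi (poly f (int a)) = e}" for e
  have bound: "real (card (N e)) \<le> real p / 2 + real g * (s + 10)" if "e = 1 \<or> e = -1" for e
  proof -
    have Ne: "N e = {a \<in> {0..<p}. int p dvd poly f (int a) ^ L - e}"
      using that unfolding N_def L_def by (subst chi_eq_iff) auto
    have "e\<^sup>2 = 1" using that by auto
    then have "(2 * \<mu> + 1) * card (N e) \<le> L + p * (\<mu> + g)"
      unfolding Ne by (rule card_character_value_le[OF L g(1) gL f(1) _ nondegenerate \<mu>L])
    then have "real ((2 * \<mu> + 1) * card (N e)) \<le> real (L + p * (\<mu> + g))" by (simp only: of_nat_le_iff)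
    moreover have "2 * real L \<le> real p" using L by simp
    ultimately have 1: "(2 * real \<mu> + 1) * real (card (N e)) \<le> (2 * real \<mu> + 1) * (real p / 2) + real p * real g"
      by (simp add: algebra_simps)
    have "real p \<le> (s - 5) * (s + 10)" using s by (simp add: algebra_simps flip: s2)
    also have "\<dots> \<le> (2 * real \<mu> + 1) * (s + 10)" using \<mu>2 s by (intro mult_right_mono) auto
    finally have "real p * real g \<le> (2 * real \<mu> + 1) * (s + 10) * real g" by (rule mult_right_mono) simp
    with 1 have "(2 * real \<mu> + 1) * real (card (N e)) \<le> (2 * real \<mu> + 1) * (real p / 2 + real g * (s + 10))"
      by (simp add: algebra_simps)
    then show ?thesis by (rule mult_left_le_imp_le) simp
  qed
  have "1 * card (N 0) \<le> 2 * Suc g"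
    using f by (intro card_roots_le[of _ _ f])
      (auto simp: N_def chi_eq_0_iff pdvd_linear_iff simp del: One_nat_def)
  then have N0: "real (card (N 0)) \<le> 2 * (real g + 1)" by simp
  have fin: "finite (N e)" for e by (simp add: N_def)
  have split: "{..<p} = N 0 \<union> (N 1 \<union> N (-1))" using chi_cases by (auto simp: N_def)
  have disj: "N 1 \<inter> N (-1) = {}" "N 0 \<inter> (N 1 \<union> N (-1)) = {}" by (auto simp: N_def)
  have "card {..<p} = card (N 0) + (card (N 1) + card (N (-1)))"
    unfolding split using disj fin by (simp add: card_Un_disjoint)
  then have total: "real p = real (card (N 0)) + real (card (N 1)) + real (card (N (-1)))" by simp
  have "(\<Sum>y<p. chi (poly f (int y))) = (\<Sum>y\<in>N 0. chi (poly f (int y)))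
      + ((\<Sum>y\<in>N 1. chi (poly f (int y))) + (\<Sum>y\<in>N (-1). chi (poly f (int y))))"
    unfolding split using disj fin by (simp add: sum.union_disjoint)
  moreover have "(\<Sum>y\<in>N e. chi (poly f (int y))) = int (card (N e)) * e" for e
    by (simp add: N_def)
  ultimately have "real_of_int (\<Sum>y<p. chi (poly f (int y))) = real (card (N 1)) - real (card (N (-1)))" by simp
  moreover define Q where "Q = real g * (s + 10)"
  \<comment> \<open>Upper bounds for both signs suffice: the three counts add up to
    \<open>p\<close>, so each bounds the other from below.\<close>
  have "2 * real (card (N e)) \<le> real p + 2 * Q" if "e = 1 \<or> e = -1" for e
    using bound[OF that] by (simp add: Q_def)
  from this[of 1] this[of "-1"]
  have "2 * real (card (N 1)) \<le> real p + 2 * Q" "2 * real (card (N (-1))) \<le> real p + 2 * Q" by simp_all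
  moreover have "2 * real g * (sqrt (real p) + 10) = 2 * Q" by (simp add: Q_def s_def)
  ultimately show ?thesis using N0 total by linarith
qed

section \<open>Products of binomials and their nondegeneracy\<close>

definition shifted_powers :: "nat \<Rightarrow> nat set \<Rightarrow> int poly" where
  "shifted_powers d C = (\<Prod>c\<in>C. monom 1 d + [:int c:])"

lemma lead_coeff_binomial: "0 < d \<Longrightarrow> lead_coeff (monom 1 d + [:c:]) = 1"
  and degree_binomial: "0 < d \<Longrightarrow> degree (monom 1 d + [:c:]) = d" for c :: int
proof -
  assume d: "0 < d"
  have "degree (monom 1 d + [:c:]) = degree (monom (1::int) d)"
    by (rule degree_add_eq_left) (simp add: degree_monom_eq d)
  then show deg: "degree (monom 1 d + [:c:]) = d" by (simp add: degree_monom_eq)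
  show "lead_coeff (monom 1 d + [:c:]) = 1" unfolding deg using d by (cases d) simp_all
qed

lemma pdvd_of_add: "pz (f + E * q) \<Longrightarrow> pdvd E f"
  unfolding pdvd_def by (rule exI[of _ "- q"]) simp

text \<open>For the remainder \<open>\<rho>\<close> of \<open>q\<close> modulo \<open>E\<close>, differentiating \<open>\<rho> ^ (m + 1) = E ^ m * Q\<close> yields
  \<open>E ^ (m + 1)\<close> as a divisor of \<open>\<rho> ^ (m + 2)\<close>; for \<open>m = d\<close> the degrees force \<open>\<rho> = 0\<close>.\<close>

lemma pdvd_binomial_of_square:
  assumes d: "0 < d" "d < p" and c: "\<not> int p dvd c" and E: "E = monom 1 d + [:c:]"
    and sq: "pdvd E (q\<^sup>2)"
  shows "pdvd E q"
proof -
  have lc: "lead_coeff E = 1" and degE: "degree E = d"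
    unfolding E by (rule lead_coeff_binomial[OF d(1)], rule degree_binomial[OF d(1)])
  have nz: "\<not> pz (E ^ m)" for m using lc by (intro monic_not_pz) (simp add: lead_coeff_power)
  obtain t \<rho> where "pseudo_divmod q E = (t, \<rho>)" by (meson surj_pair)
  moreover have "E \<noteq> 0" using lc by auto
  ultimately have q: "q = E * t + \<rho>" and \<rho>: "\<rho> = 0 \<or> degree \<rho> < d"
    using pseudo_divmod[of E q t \<rho>] lc by (simp_all add: degE)
  have "q\<^sup>2 = \<rho>\<^sup>2 + E * (t * (E * t + 2 * \<rho>))"
    by (simp add: q power2_eq_square algebra_simps)
  then have sq\<rho>: "pdvd E (\<rho>\<^sup>2)"
    using pdvd_diff[OF sq pdvd_triv(1)[of E "t * (E * t + 2 * \<rho>)"]] by simp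
  have "0 < m \<Longrightarrow> m \<le> d \<Longrightarrow> pdvd (E ^ m) (\<rho> ^ Suc m)" for m
  proof (induction m)
    case 0
    then show ?case by simp
  next
    case (Suc m)
    show ?case
    proof (cases "m = 0")
      case True
      then show ?thesis using sq\<rho> by (simp add: power2_eq_square)
    next
      case False
      then obtain m' where m': "m = Suc m'" by (cases m) auto
      obtain Q where Q: "pz (\<rho> ^ Suc m - E ^ m * Q)" using Suc False by (auto simp: pdvd_def)
      define x where "x = (monom 1 1 :: int poly)"
      \<comment> \<open>Modulo \<open>E\<close> this is the unit \<open>- d * c\<close>, so
        \<open>x ^ d + c\<close> is squarefree over the field.\<close>
      have xE: "x * pderiv E = of_nat d * (E - [:c:])"
      proof -
        have "x * pderiv (monom 1 d) = of_nat d * (monom 1 d :: int poly)"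
          using d by (simp add: x_def pderiv_monom mult_monom of_nat_monom)
        then show ?thesis by (simp add: E pderiv_add pderiv_pCons)
      qed
      \<comment> \<open>For \<open>G = \<rho> ^ (m + 1) - E ^ m * Q\<close>, the combination
        \<open>x * G' * \<rho> - (m + 1) * x * \<rho>' * G\<close> eliminates the power of
        \<open>\<rho>\<close>. After division by \<open>E ^ (m - 1)\<close>, what remains modulo
        \<open>E\<close> is \<open>m * d * c * Q * \<rho>\<close>.\<close>
      have "pz (x * pderiv (\<rho> ^ Suc m - E ^ m * Q) * \<rho> - of_nat (Suc m) * x * pderiv \<rho> * (\<rho> ^ Suc m - E ^ m * Q))"
        by (rule pz_diff[OF pz_mult_right[OF pz_mult_left[OF pz_pderiv[OF Q]]] pz_mult_left[OF Q]])
      moreover have "x * pderiv (\<rho> ^ Suc m - E ^ m * Q) * \<rho> - of_nat (Suc m) * x * pderiv \<rho> * (\<rho> ^ Suc m - E ^ m * Q)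
          = E ^ m' * (of_nat (m * d) * [:c:] * (Q * \<rho>)
             + E * (of_nat (Suc m) * x * pderiv \<rho> * Q - x * pderiv Q * \<rho> - of_nat (m * d) * Q * \<rho>))"
      proof -
        have "x * pderiv (E ^ m * Q) = of_nat m * E ^ m' * (x * pderiv E) * Q + E ^ m * (x * pderiv Q)"
          unfolding m' pderiv_mult pderiv_power_of_nat by (simp only: algebra_simps)
        then have "x * pderiv (\<rho> ^ Suc m - E ^ m * Q) * \<rho>
            = x * (of_nat (Suc m) * \<rho> ^ m * pderiv \<rho>) * \<rho>
               - (of_nat m * E ^ m' * (of_nat d * (E - [:c:])) * Q + E ^ m * (x * pderiv Q)) * \<rho>"
          unfolding pderiv_diff pderiv_power_of_nat xE by (simp only: right_diff_distrib left_diff_distrib)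
        then show ?thesis unfolding m' power_Suc of_nat_mult by (simp only: algebra_simps)
      qed
      ultimately have "pz (of_nat (m * d) * [:c:] * (Q * \<rho>)
             + E * (of_nat (Suc m) * x * pderiv \<rho> * Q - x * pderiv Q * \<rho> - of_nat (m * d) * Q * \<rho>))"
        using nz by (simp only: pz_mult_iff) blast
      then have "pdvd E (of_nat (m * d) * [:c:] * (Q * \<rho>))"
        by (rule pdvd_of_add)
      moreover have "of_nat (m * d) * [:c:] * (Q * \<rho>) = smult (int (m * d) * c) (Q * \<rho>)"
        by (simp add: of_nat_poly mult.commute mult.left_commute)
      moreover have "\<not> int p dvd int (m * d) * c"
      proof -
        have "\<not> p dvd m" "\<not> p dvd d" using False Suc.prems d by (auto dest: dvd_imp_le)
        then show ?thesis using c prime_p prime_int_p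
          by (simp add: prime_dvd_mult_iff)
      qed
      ultimately have "pdvd E (Q * \<rho>)" using pdvd_smult_cancel by simp
      then have "pdvd (E ^ m * E) (E ^ m * (Q * \<rho>))" by (subst pdvd_mult_cancel[OF nz])
      moreover have "pz (\<rho> ^ Suc (Suc m) - E ^ m * (Q * \<rho>))"
        using pz_mult_right[OF Q, of \<rho>] by (simp add: algebra_simps)
      ultimately show ?thesis by (simp only: pdvd_cong power_Suc2)
    qed
  qed
  from this[of d] d have "pdvd (E ^ d) (\<rho> ^ Suc d)" by simp
  moreover have "degree (\<rho> ^ Suc d) < degree (E ^ d)" if "\<rho> \<noteq> 0"
  proof -
    have "degree (\<rho> ^ Suc d) = Suc d * degree \<rho>" using that by (simp add: degree_power_eq del: power_Suc)
    also have "\<dots> \<le> Suc d * (d - 1)" using \<rho> that by (intro mult_le_mono) auto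
    also have "\<dots> < d * d" using d by (cases d) simp_all
    also have "d * d = degree (E ^ d)" using degE d by (subst degree_power_eq) auto
    finally show ?thesis .
  qed
  moreover have "lead_coeff (E ^ d) = 1" using lc by (simp add: lead_coeff_power)
  ultimately have "pz (\<rho> ^ Suc d)"
    using pdvd_degree_lt[of "E ^ d" "\<rho> ^ Suc d"] by (cases "\<rho> = 0") (auto simp: coeff_eq_0 simp del: power_Suc)
  then have "pz \<rho>" by (simp only: pz_power_iff)
  then show ?thesis unfolding q by (intro pdvd_add pdvd_triv pdvd_pz)
qed

text \<open>Modulo \<open>x ^ d + b\<close> the other factors are the constants
  \<open>c - b\<close>, units because the shifts are distinct mod \<open>p\<close>. So the chosen
  factor enters the product exactly once, as the descent below requires.\<close>

lemma shifted_powers_remove: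
  assumes "finite C" "b \<in> C" "C \<subseteq> {1..<p}"
  obtains \<gamma> H where "shifted_powers d C = (monom 1 d + [:int b:]) * ([:\<gamma>:] + (monom 1 d + [:int b:]) * H)"
    "\<not> int p dvd \<gamma>"
proof -
  define E where "E = monom 1 d + [:int b:]"
  have "\<exists>\<gamma> H. (\<Prod>c\<in>D. monom 1 d + [:int c:]) = [:\<gamma>:] + E * H \<and> \<not> int p dvd \<gamma>"
    if "finite D" "D \<subseteq> C - {b}" for D
    using that
  proof (induction D)
    case empty
    show ?case using p_gt_2 by (intro exI[of _ 1] exI[of _ 0]) (simp add: one_pCons)
  next
    case (insert c D)
    then obtain \<gamma> H where IH: "(\<Prod>c\<in>D. monom 1 d + [:int c:]) = [:\<gamma>:] + E * H" "\<not> int p dvd \<gamma>" by auto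
    have "monom 1 d + [:int c:] = E + [:int c - int b:]" by (simp add: E_def)
    then have "(\<Prod>c\<in>insert c D. monom 1 d + [:int c:]) = (E + [:int c - int b:]) * ([:\<gamma>:] + E * H)"
      using insert.hyps IH(1) by simp
    also have "\<dots> = [:(int c - int b) * \<gamma>:] + E * ([:\<gamma>:] + E * H + [:int c - int b:] * H)"
    proof -
      have "[:(int c - int b) * \<gamma>:] = [:int c - int b:] * [:\<gamma>:]" by simp
      then show ?thesis by (simp only: algebra_simps)
    qed
    finally have eq: "(\<Prod>c\<in>insert c D. monom 1 d + [:int c:])
      = [:(int c - int b) * \<gamma>:] + E * ([:\<gamma>:] + E * H + [:int c - int b:] * H)" .
    have "\<not> int p dvd int c - int b"
    proof
      assume "int p dvd int c - int b"
      moreover have "c < p" "b < p" "c \<noteq> b" using insert.prems assms by auto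
      moreover from this have "\<bar>int c - int b\<bar> < int p" by linarith
      ultimately show False using dvd_imp_le_int[of "int c - int b" "int p"] by auto
    qed
    then have "\<not> int p dvd (int c - int b) * \<gamma>" using IH(2) prime_int_p by (simp add: prime_dvd_mult_iff)
    with eq show ?case by blast
  qed
  from this[of "C - {b}"] assms(1) obtain \<gamma> H
    where "(\<Prod>c\<in>C - {b}. monom 1 d + [:int c:]) = [:\<gamma>:] + E * H" "\<not> int p dvd \<gamma>" by auto
  then show thesis
    using that[of \<gamma> H] assms(1,2) by (simp add: shifted_powers_def prod.remove[of C b] E_def)
qed

text \<open>A repeated descent on powers of the factor \<open>x ^ d + b\<close>: it divides the right-hand side
  of \<open>u\<^sup>2 = k * v\<^sup>2 * f\<close> to an odd power only.\<close>

lemma shifted_powers_nondegenerate: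
  assumes C: "finite C" "C \<noteq> {}" "C \<subseteq> {1..<p}" and d: "0 < d" "d < p" and k: "\<not> int p dvd k"
    and uv: "pz (u\<^sup>2 - [:k:] * v\<^sup>2 * shifted_powers d C)"
  shows "pz u \<and> pz v"
proof -
  obtain b where b: "b \<in> C" using C(2) by blast
  define E where "E = monom 1 d + [:int b:]"
  obtain \<gamma> H where f: "shifted_powers d C = E * ([:\<gamma>:] + E * H)" and \<gamma>: "\<not> int p dvd \<gamma>"
    unfolding E_def by (rule shifted_powers_remove[OF C(1) b C(3), of d]) blast
  have pb: "\<not> int p dvd int b" using b C(3) by (auto dest!: dvd_imp_le subsetD)
  have lc: "lead_coeff E = 1" and degE: "degree E = d"
    unfolding E_def by (rule lead_coeff_binomial[OF d(1)], rule degree_binomial[OF d(1)])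
  have nz: "\<not> pz (E ^ m)" for m using lc by (intro monic_not_pz) (simp add: lead_coeff_power)
  have nE: "\<not> pz E" using nz[of 1] by simp
  have square: "pdvd E q" if "pdvd E (q\<^sup>2)" for q
    using pdvd_binomial_of_square[OF d pb E_def that] .
  \<comment> \<open>Dividing by \<open>E\<close> reproduces the equation for the quotients:
    \<open>E\<close> divides \<open>r\<^sup>2\<close>, hence \<open>r\<close>; after cancelling one
    \<open>E\<close> it divides \<open>k * \<gamma> * s\<^sup>2\<close>, hence
    \<open>s\<close>.\<close>
  have main: "\<exists>r s. pz (u - E ^ m * r) \<and> pz (v - E ^ m * s)
      \<and> pz (r\<^sup>2 - [:k:] * s\<^sup>2 * (E * ([:\<gamma>:] + E * H)))" for m
  proof (induction m)
    case 0
    show ?case using uv f by (intro exI[of _ u] exI[of _ v]) simp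
  next
    case (Suc m)
    then obtain r s where rs: "pz (u - E ^ m * r)" "pz (v - E ^ m * s)"
      and eq: "pz (r\<^sup>2 - [:k:] * s\<^sup>2 * (E * ([:\<gamma>:] + E * H)))" by blast
    have "pdvd E (r\<^sup>2)"
      unfolding pdvd_def
      by (rule exI[of _ "[:k:] * s\<^sup>2 * ([:\<gamma>:] + E * H)"]) (use eq in \<open>simp only: algebra_simps\<close>)
    then obtain r' where r': "pz (r - E * r')" using square by (auto simp: pdvd_def)
    have "pz (E\<^sup>2 * r'\<^sup>2 - [:k:] * s\<^sup>2 * (E * ([:\<gamma>:] + E * H)))"
      using pz_diff[OF eq pz_diff_power[OF r', of 2]] by (simp add: power_mult_distrib)
    then have "pz (E * (E * r'\<^sup>2 - [:k:] * s\<^sup>2 * ([:\<gamma>:] + E * H)))"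
      by (simp only: power2_eq_square algebra_simps)
    then have eq2: "pz (E * r'\<^sup>2 - [:k:] * s\<^sup>2 * ([:\<gamma>:] + E * H))"
      using nE by (simp only: pz_mult_iff) blast
    have "pdvd E ([:k:] * [:\<gamma>:] * s\<^sup>2)"
      unfolding pdvd_def
    proof (rule exI[of _ "r'\<^sup>2 - [:k:] * s\<^sup>2 * H"])
      have "[:k:] * [:\<gamma>:] * s\<^sup>2 - E * (r'\<^sup>2 - [:k:] * s\<^sup>2 * H)
          = - (E * r'\<^sup>2 - [:k:] * s\<^sup>2 * ([:\<gamma>:] + E * H))" by (simp only: algebra_simps)
      then show "pz ([:k:] * [:\<gamma>:] * s\<^sup>2 - E * (r'\<^sup>2 - [:k:] * s\<^sup>2 * H))"
        using pz_minus[OF eq2] by (simp only:)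
    qed
    then have "pdvd E (smult (k * \<gamma>) (s\<^sup>2))" by (simp add: mult.commute)
    moreover have "\<not> int p dvd k * \<gamma>" using k \<gamma> prime_int_p by (simp add: prime_dvd_mult_iff)
    ultimately have "pdvd E (s\<^sup>2)" using pdvd_smult_cancel by blast
    then obtain s' where s': "pz (s - E * s')" using square by (auto simp: pdvd_def)
    have "pz (r\<^sup>2 - (E * r')\<^sup>2)" "pz (s\<^sup>2 - (E * s')\<^sup>2)" using r' s' by (simp_all add: pz_diff_power)
    then have "pz (E\<^sup>2 * (r'\<^sup>2 - [:k:] * s'\<^sup>2 * (E * ([:\<gamma>:] + E * H))))"
    proof -
      assume a: "pz (r\<^sup>2 - (E * r')\<^sup>2)" "pz (s\<^sup>2 - (E * s')\<^sup>2)"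
      have "E\<^sup>2 * (r'\<^sup>2 - [:k:] * s'\<^sup>2 * (E * ([:\<gamma>:] + E * H)))
        = (r\<^sup>2 - [:k:] * s\<^sup>2 * (E * ([:\<gamma>:] + E * H))) - (r\<^sup>2 - (E * r')\<^sup>2)
          + (s\<^sup>2 - (E * s')\<^sup>2) * ([:k:] * (E * ([:\<gamma>:] + E * H)))"
        unfolding power_mult_distrib by (simp only: algebra_simps)
      also have "pz \<dots>" by (rule pz_add[OF pz_diff[OF eq a(1)] pz_mult_right[OF a(2)]])
      finally show ?thesis .
    qed
    then have "pz (r'\<^sup>2 - [:k:] * s'\<^sup>2 * (E * ([:\<gamma>:] + E * H)))"
      using nz[of 2] pz_mult_iff by blast
    moreover have step: "pz (w - E ^ Suc m * t')" if "pz (w - E ^ m * t)" "pz (t - E * t')" for w t t'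
    proof -
      have "w - E ^ Suc m * t' = (w - E ^ m * t) + E ^ m * (t - E * t')"
        by (simp add: algebra_simps)
      then show ?thesis using that by (simp only: pz_add pz_mult_left)
    qed
    ultimately show ?case using step[OF rs(1) r'] step[OF rs(2) s'] by blast
  qed
  have "pz w" if "\<And>m. pdvd (E ^ m) w" for w
  proof (rule pdvd_degree_lt[OF _ that])
    show "lead_coeff (E ^ Suc (degree w)) = 1" using lc by (simp only: lead_coeff_power power_one)
    fix i assume "degree (E ^ Suc (degree w)) \<le> i"
    moreover have "degree (E ^ Suc (degree w)) = Suc (degree w) * d"
      using degE d by (subst degree_power_eq) auto
    moreover have "Suc (degree w) * 1 \<le> Suc (degree w) * d" using d by (intro mult_le_mono2) simp
    ultimately show "int p dvd coeff w i" by (simp add: coeff_eq_0)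
  qed
  moreover have "pdvd (E ^ m) u" "pdvd (E ^ m) v" for m using main[of m] by (auto simp: pdvd_def)
  ultimately show ?thesis by blast
qed

theorem abs_sum_chi_shifted_powers_le:
  assumes C: "finite C" "C \<noteq> {}" "C \<subseteq> {1..<p}" and d: "0 < d" "d < p"
    and g: "1 \<le> g" "2 * g < p" "d * card C \<le> 2 * Suc g" and p: "p \<ge> 100"
  shows "\<bar>real_of_int (\<Sum>y<p. \<Prod>c\<in>C. chi (int y ^ d + int c))\<bar>
    \<le> 2 * real g * (sqrt (real p) + 10) + 2 * (real g + 1)"
proof -
  let ?f = "shifted_powers d C"
  have "lead_coeff ?f = 1"
    unfolding shifted_powers_def lead_coeff_prod using lead_coeff_binomial[OF d(1)] by simp
  then have nz: "\<not> pz ?f" by (rule monic_not_pz)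
  have "degree ?f \<le> (\<Sum>c\<in>C. degree (monom 1 d + [:int c:]))"
    using degree_prod_sum_le[OF C(1), of "\<lambda>c. monom 1 d + [:int c:]"]
    by (simp add: shifted_powers_def comp_def)
  also have "\<dots> = d * card C" by (simp add: degree_binomial[OF d(1)])
  finally have deg: "degree ?f \<le> 2 * Suc g" using g(3) by simp
  have "coeff ?f 0 = (\<Prod>c\<in>C. int c)"
    using d(1) by (simp add: shifted_powers_def poly_prod poly_monom zero_power flip: poly_0_coeff_0)
  moreover have "\<not> int p dvd (\<Prod>c\<in>C. int c)"
  proof
    assume "int p dvd (\<Prod>c\<in>C. int c)"
    then obtain c where "c \<in> C" "int p dvd int c" using C(1) prime_int_p by (auto simp: prime_dvd_prod_iff)
    then show False using C(3) by (auto dest!: dvd_imp_le subsetD)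
  qed
  ultimately have "pz (u\<^sup>2 - [:coeff ?f 0:] * v\<^sup>2 * ?f) \<Longrightarrow> pz u \<and> pz v" for u v
    using shifted_powers_nondegenerate[OF C d] by metis
  from abs_sum_chi_le[OF g(1,2) deg nz p this]
  show ?thesis by (simp add: shifted_powers_def poly_prod poly_monom chi_prod)
qed

end

section \<open>Primitive roots\<close>

lemma prod_primes_dvd_iff:
  fixes Q :: "nat set"
  assumes "finite Q" "\<And>q. q \<in> Q \<Longrightarrow> prime q"
  shows "\<Prod>Q dvd n \<longleftrightarrow> (\<forall>q\<in>Q. q dvd n)"
  using assms
proof (induction Q)
  case empty
  then show ?case by simp
next
  case (insert q Q)
  have "\<not> q dvd \<Prod>Q"
  proof
    assume "q dvd \<Prod>Q"
    then obtain r where "r \<in> Q" "q dvd r" using insert by (auto simp: prime_dvd_prod_iff)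
    then have "q = r" using insert.prems by (intro primes_dvd_imp_eq) auto
    with \<open>r \<in> Q\<close> insert.hyps show False by simp
  qed
  then have "coprime q (\<Prod>Q)" using insert.prems by (intro prime_imp_coprime) auto
  then have "q * \<Prod>Q dvd n \<longleftrightarrow> q dvd n \<and> \<Prod>Q dvd n"
    by (auto intro: divides_mult dvd_trans[of q "q * \<Prod>Q"] dvd_trans[of "\<Prod>Q" "q * \<Prod>Q"])
  then show ?case using insert by simp
qed

lemma sum_mod_repeat: "(\<Sum>m<D * e. h (m mod e)) = of_nat D * (\<Sum>j<e. h j)"
  for h :: "nat \<Rightarrow> 'a :: comm_semiring_1"
proof (induction D)
  case (Suc D)
  have "(\<Sum>m<Suc D * e. h (m mod e)) = (\<Sum>m<D * e. h (m mod e)) + (\<Sum>m\<in>{D * e..<D * e + e}. h (m mod e))"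
    by (subst sum.union_disjoint[symmetric]) (auto intro!: sum.cong)
  also have "(\<Sum>m\<in>{D * e..<D * e + e}. h (m mod e)) = (\<Sum>j<e. h j)"
    by (rule sum.reindex_bij_witness[of _ "\<lambda>j. D * e + j" "\<lambda>m. m - D * e"]) (auto simp: mod_mult_self3 less_diff_conv2 elim!: le_Suc_ex[THEN exE])
  finally show ?case using Suc.IH by (simp add: algebra_simps)
qed simp

text \<open>\<open>D * m mod n\<close> runs \<open>D\<close> times through the multiples of
  \<open>D\<close> below \<open>n\<close>.\<close>

lemma sum_multiples:
  fixes H :: "nat \<Rightarrow> 'a :: comm_semiring_1"
  assumes "D dvd n" "0 < n"
  shows "(\<Sum>m<n. H (D * m mod n)) = of_nat D * (\<Sum>i<n. of_bool (D dvd i) * H i)"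
proof -
  obtain e where n: "n = D * e" using assms(1) by blast
  have "0 < D" "0 < e" using assms(2) n by auto
  have "(\<Sum>m<n. H (D * m mod n)) = (\<Sum>m<D * e. H (D * (m mod e)))"
    unfolding n by simp
  also have "\<dots> = of_nat D * (\<Sum>j<e. H (D * j))" by (rule sum_mod_repeat)
  also have "(\<Sum>j<e. H (D * j)) = (\<Sum>i | i < n \<and> D dvd i. H i)"
    by (rule sum.reindex_bij_witness[of _ "\<lambda>i. i div D" "\<lambda>j. D * j"])
      (use \<open>0 < D\<close> in \<open>auto simp: n mult.commute elim!: dvdE\<close>)
  also have "\<dots> = (\<Sum>i<n. of_bool (D dvd i) * H i)"
    by (rule sum.mono_neutral_cong_left) auto
  finally show ?thesis .
qed

context odd_prime
begin

lemma primitive_elems_conv: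
  "primitive_elems p = {x \<in> totatives p. residue_primroot p x}"
proof -
  have "x \<in> totatives p" if "residue_primroot p x" "x < p" for x
    using that p_gt_2 by (auto simp: residue_primroot_def totatives_def coprime_commute intro!: Nat.gr0I)
  moreover have "x < p" if "x \<in> totatives p" for x
    using that p_gt_2 by (auto simp: totatives_less)
  ultimately show ?thesis by (auto simp: primitive_elems_def)
qed

lemma totient_p: "totient p = p - 1" and totatives_p: "totatives p = {1..<p}"
  by (rule totient_prime[OF prime_p], subst totatives_prime[OF prime_p]) auto

lemma card_primitive_elems: "card (primitive_elems p) = totient (p - 1)"
proof -
  have "primitive_elems p = {x \<in> totatives p. ord p x = p - 1}"
    unfolding primitive_elems_conv using p_gt_2
    by (auto simp: residue_primroot_def totient_p totatives_def coprime_commute)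
  then show ?thesis using prime_card_primitive_roots(1)[OF _ prime_p] p_gt_2 by simp
qed

text \<open>Primitive roots are the \<open>w ^ i\<close> with \<open>i\<close> coprime to
  \<open>p - 1\<close>. Expanding the product of \<open>1 - of_bool (q dvd i)\<close> over the prime
  factors \<open>q\<close> leaves sums over the multiples of squarefree \<open>D\<close>. Each
  \<open>D\<close>-th power is \<open>y ^ D\<close> for \<open>D\<close> values of \<open>y\<close>,
  so the factor \<open>D\<close> in the hypothesis cancels.\<close>

lemma abs_sum_primitive_elems_le:
  fixes F :: "nat \<Rightarrow> real"
  assumes "\<And>D. D dvd p - 1 \<Longrightarrow> \<bar>\<Sum>y\<in>{1..<p}. F (y ^ D mod p)\<bar> \<le> real D * K"
  shows "\<bar>\<Sum>x\<in>primitive_elems p. F x\<bar> \<le> 2 ^ card (prime_factors (p - 1)) * K"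
proof -
  define n where "n = p - 1"
  have n: "0 < n" using p_gt_2 by (simp add: n_def)
  obtain w where w: "residue_primroot p w"
    using prime_primitive_root_exists[of p] prime_p p_gt_2 by auto
  then have cop: "coprime p w" and ord: "ord p w = n"
    by (simp_all add: residue_primroot_def totient_p n_def)
  define H where "H i = F (w ^ i mod p)" for i
  have H_mod: "H (i mod n) = H i" for i
    using order_divides_expdiff[OF cop, of "i mod n" i] by (simp add: H_def ord cong_def)
  have "(\<Sum>x\<in>primitive_elems p. F x) = (\<Sum>i\<in>totatives n. H i)"
    unfolding primitive_elems_conv H_def
    using residue_primroot_bij_betw_primroots[OF _ w] p_gt_2
    by (intro sum.reindex_bij_betw[symmetric]) (simp add: totient_p n_def)
  also have "\<dots> = (\<Sum>i\<in>{0<..n}. of_bool (coprime i n) * H i)"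
    by (rule sum.mono_neutral_cong_left) (auto simp: totatives_def)
  also have "\<dots> = (\<Sum>i\<in>{0<..n}. \<Sum>Q\<in>Pow (prime_factors n). (-1) ^ card Q * (of_bool (\<Prod>Q dvd i) * H i))"
  proof (rule sum.cong[OF refl])
    fix i assume i: "i \<in> {0<..n}"
    have "coprime i n \<longleftrightarrow> (\<forall>q\<in>prime_factors n. \<not> q dvd i)"
    proof
      assume "coprime i n"
      then show "\<forall>q\<in>prime_factors n. \<not> q dvd i"
        by (metis coprime_common_divisor in_prime_factors_iff not_prime_unit)
    next
      assume *: "\<forall>q\<in>prime_factors n. \<not> q dvd i"
      show "coprime i n"
      proof (rule ccontr)
        assume "\<not> coprime i n"
        then have "gcd i n \<noteq> 1" by (simp only: coprime_iff_gcd_eq_1 not_False_eq_True)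
        then obtain q where q: "prime q" "q dvd gcd i n" using prime_factor_nat by blast
        then have "q \<in> prime_factors n" using n by (auto simp: in_prime_factors_iff)
        with * q show False by auto
      qed
    qed
    then have "of_bool (coprime i n) = (\<Prod>q\<in>prime_factors n. 1 - of_bool (q dvd i) :: real)"
      by (auto simp: prod_zero_iff intro!: prod.neutral[symmetric])
    also have "\<dots> = (\<Sum>Q\<in>Pow (prime_factors n). (-1) ^ card Q * (\<Prod>q\<in>Q. of_bool (q dvd i)))"
      by (subst prod_diff_conv_sum) simp_all
    also have "\<dots> = (\<Sum>Q\<in>Pow (prime_factors n). (-1) ^ card Q * of_bool (\<Prod>Q dvd i))"
    proof (rule sum.cong[OF refl])
      fix Q assume "Q \<in> Pow (prime_factors n)"
      then have Q: "finite Q" "\<And>q. q \<in> Q \<Longrightarrow> prime q" by (auto intro: finite_subset)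
      have "(\<Prod>q\<in>Q. of_bool (q dvd i) :: real) = of_bool (\<forall>q\<in>Q. q dvd i)"
        using Q(1) by (auto simp: prod_zero_iff intro!: prod.neutral)
      then show "(-1) ^ card Q * (\<Prod>q\<in>Q. of_bool (q dvd i) :: real) = (-1) ^ card Q * of_bool (\<Prod>Q dvd i)"
        using prod_primes_dvd_iff[OF Q, of i] by simp
    qed
    finally show "of_bool (coprime i n) * H i
        = (\<Sum>Q\<in>Pow (prime_factors n). (-1) ^ card Q * (of_bool (\<Prod>Q dvd i) * H i))"
      by (simp only: sum_distrib_right mult.assoc)
  qed
  also have "\<dots> = (\<Sum>Q\<in>Pow (prime_factors n). (-1) ^ card Q * (\<Sum>i\<in>{0<..n}. of_bool (\<Prod>Q dvd i) * H i))"
    unfolding sum_distrib_left by (rule sum.swap)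
  finally have "\<bar>\<Sum>x\<in>primitive_elems p. F x\<bar>
      \<le> (\<Sum>Q\<in>Pow (prime_factors n). \<bar>(-1) ^ card Q * (\<Sum>i\<in>{0<..n}. of_bool (\<Prod>Q dvd i) * H i)\<bar>)"
    using sum_abs by (simp only:)
  also have "\<dots> \<le> (\<Sum>Q\<in>Pow (prime_factors n). K)"
  proof (rule sum_mono)
    fix Q assume "Q \<in> Pow (prime_factors n)"
    then have Q: "finite Q" "\<And>q. q \<in> Q \<Longrightarrow> prime q" "\<And>q. q \<in> Q \<Longrightarrow> q dvd n"
      by (auto intro: finite_subset)
    define D where "D = \<Prod>Q"
    have D: "D dvd n" using Q prod_primes_dvd_iff[OF Q(1,2), of n] by (auto simp: D_def)
    then have "0 < D" using n by (auto intro!: Nat.gr0I)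
    have "(\<Sum>y\<in>{1..<p}. F (y ^ D mod p)) = (\<Sum>m<n. F ((w ^ m mod p) ^ D mod p))"
      using residue_primroot_is_generator[OF _ w] p_gt_2
      by (intro sum.reindex_bij_betw[symmetric]) (simp add: totient_p totatives_p n_def)
    also have "\<dots> = (\<Sum>m<n. H (D * m mod n))"
      unfolding H_mod by (simp add: H_def power_mod power_mult[symmetric] mult.commute)
    also have "\<dots> = real D * (\<Sum>i<n. of_bool (D dvd i) * H i)"
      using D n by (rule sum_multiples)
    also have "(\<Sum>i<n. of_bool (D dvd i) * H i) = (\<Sum>i\<in>{0<..n}. of_bool (D dvd i) * H i)"
    proof -
      have "{..<n} = insert 0 {0<..<n}" "{0<..n} = insert n {0<..<n}" using n by auto
      then show ?thesis using D H_mod[of n] by simp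
    qed
    finally have "real D * \<bar>\<Sum>i\<in>{0<..n}. of_bool (D dvd i) * H i\<bar> \<le> real D * K"
      using assms[of D] D by (simp add: n_def abs_mult)
    then have "\<bar>\<Sum>i\<in>{0<..n}. of_bool (D dvd i) * H i\<bar> \<le> K" using \<open>0 < D\<close> by simp
    then show "\<bar>(-1) ^ card Q * (\<Sum>i\<in>{0<..n}. of_bool (\<Prod>Q dvd i) * H i)\<bar> \<le> K"
      by (simp add: abs_mult power_abs D_def)
  qed
  also have "\<dots> = 2 ^ card (prime_factors n) * K" by (simp add: card_Pow)
  finally show ?thesis by (simp add: n_def)
qed

lemma abs_prod_chi_le: "\<bar>real_of_int (\<Prod>c\<in>C. chi (h c))\<bar> \<le> 1"
proof -
  have "\<bar>\<Prod>c\<in>C. chi (h c)\<bar> \<le> 1"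
    unfolding abs_prod using abs_chi_le by (intro prod_le_1) auto
  then show ?thesis by linarith
qed

text \<open>For \<open>D \<le> sqrt p\<close> the Weil bound applies with
  \<open>g = D * card C\<close>, which is below \<open>p / 2\<close> by the assumption on
  \<open>card C\<close>. For larger \<open>D\<close> the trivial bound \<open>p\<close> is already
  at most \<open>D * sqrt p\<close>.\<close>

lemma abs_sum_primitive_chi_le:
  assumes C: "C \<noteq> {}" "C \<subseteq> {1..<p}" "2 * real (card C) < sqrt (real p)" and p: "p \<ge> 100"
  shows "\<bar>real_of_int (\<Sum>x\<in>primitive_elems p. \<Prod>c\<in>C. chi (int x + int c))\<bar>
    \<le> 2 ^ card (prime_factors (p - 1)) * (real (card C) * (2 * sqrt (real p) + 25))"
proof -
  have fin: "finite C" using C(2) by (rule finite_subset) simp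
  then have C1: "1 \<le> card C" using C(1) by (simp add: Suc_leI card_gt_0_iff)
  define s where "s = sqrt (real p)"
  have s: "s \<ge> 10" unfolding s_def using p by (intro real_le_rsqrt) auto
  have s2: "s * s = real p" by (simp add: s_def)
  define F where "F x = real_of_int (\<Prod>c\<in>C. chi (int x + int c))" for x
  have "\<bar>\<Sum>x\<in>primitive_elems p. F x\<bar> \<le> 2 ^ card (prime_factors (p - 1)) * (real (card C) * (2 * s + 25))"
  proof (rule abs_sum_primitive_elems_le)
    fix D assume D: "D dvd p - 1"
    have D0: "0 < D" using D p_gt_2 by (auto intro!: Nat.gr0I)
    have Dp: "D < p" using D p_gt_2 by (auto dest!: dvd_imp_le)
    have F_mod: "F (y ^ D mod p) = real_of_int (\<Prod>c\<in>C. chi (int y ^ D + int c))" for y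
    proof -
      have "chi (int (y ^ D mod p) + int c) = chi (int y ^ D + int c)" for c
        by (rule chi_cong) (simp add: cong_def zmod_int mod_simps)
      then show ?thesis by (simp add: F_def)
    qed
    have F1: "\<bar>F y\<bar> \<le> 1" for y unfolding F_def by (rule abs_prod_chi_le)
    show "\<bar>\<Sum>y\<in>{1..<p}. F (y ^ D mod p)\<bar> \<le> real D * (real (card C) * (2 * s + 25))"
    proof (cases "real D \<le> s")
      case True
      define g where "g = D * card C"
      have g1: "1 \<le> g" using D0 C1 by (simp add: g_def)
      have "2 * real g \<le> s * (2 * real (card C))" using True by (simp add: g_def mult_right_mono)
      also have "\<dots> < s * s" using C(3)[folded s_def] s by (intro mult_strict_left_mono) auto
      finally have "real (2 * g) < real p" by (simp add: s2)
      then have g2: "2 * g < p" by (simp only: of_nat_less_iff)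
      have "\<bar>\<Sum>y<p. F (y ^ D mod p)\<bar> \<le> 2 * real g * (s + 10) + 2 * (real g + 1)"
        using abs_sum_chi_shifted_powers_le[OF fin C(1,2) D0 Dp g1 g2 _ p]
        by (simp add: F_mod s_def g_def)
      moreover have "(\<Sum>y<p. F (y ^ D mod p)) = F (0 ^ D mod p) + (\<Sum>y\<in>{1..<p}. F (y ^ D mod p))"
      proof -
        have "{..<p} = insert 0 {1..<p}" using p_pos by auto
        then show ?thesis by simp
      qed
      ultimately have "\<bar>\<Sum>y\<in>{1..<p}. F (y ^ D mod p)\<bar> \<le> 2 * real g * (s + 10) + 2 * (real g + 1) + 1"
        using F1[of "0 ^ D mod p"] by linarith
      also have "\<dots> \<le> real g * (2 * s + 25)"
      proof -
        have "1 \<le> real g" using g1 by simp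
        then show ?thesis by (simp add: algebra_simps)
      qed
      finally show ?thesis by (simp add: g_def mult.assoc)
    next
      case False
      have "\<bar>\<Sum>y\<in>{1..<p}. F (y ^ D mod p)\<bar> \<le> (\<Sum>y\<in>{1..<p}. \<bar>F (y ^ D mod p)\<bar>)" by (rule sum_abs)
      also have "\<dots> \<le> (\<Sum>y\<in>{1..<p}. 1)" using F1 by (intro sum_mono)
      also have "\<dots> \<le> real p" by simp
      also have "\<dots> \<le> real D * (1 * (2 * s + 25))"
        unfolding s2[symmetric] using False s by (intro mult_mono) auto
      also have "\<dots> \<le> real D * (real (card C) * (2 * s + 25))"
        using C1 s by (intro mult_left_mono mult_right_mono) auto
      finally show ?thesis .
    qed
  qed
  then show ?thesis by (simp add: F_def s_def)
qed

lemma chi_primitive: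
  assumes "x \<in> primitive_elems p" shows "chi (int x) = -1"
proof -
  define n where "n = (p - 1) div 2"
  have n: "0 < n" "n < p - 1" using p_gt_2 by (auto simp: n_def)
  have x: "coprime p x" "ord p x = p - 1"
    using assms by (simp_all add: primitive_elems_def residue_primroot_def totient_p)
  have "\<not> [x ^ n = 1] (mod p)"
    unfolding ord_divides x(2) using n by (auto dest: dvd_imp_le)
  then have "\<not> [int x ^ n = 1] (mod int p)" by (metis cong_int_iff of_nat_1 of_nat_power)
  then have "chi (int x) \<noteq> 1" by (subst chi_eq_iff) (simp_all add: n_def cong_iff_dvd_diff)
  moreover have "\<not> p dvd x" using x(1) prime_p by (metis coprime_absorb_left not_prime_unit)
  then have "chi (int x) \<noteq> 0" by (simp add: chi_eq_0_iff)
  ultimately show ?thesis using chi_cases[of "int x"] by auto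
qed

end

section \<open>Fourth moment of character sums\<close>

lemma sum_mult_sum_pairs:
  "sum f A * sum g B = (\<Sum>(x, y)\<in>A \<times> B. f x * g y)"
  for f :: "'a \<Rightarrow> 'c :: comm_semiring_0" and g :: "'b \<Rightarrow> 'c"
  by (simp add: sum_product sum.cartesian_product)

context odd_prime
begin

lemma sum_shift:
  fixes G :: "int \<Rightarrow> 'a :: comm_monoid_add"
  assumes "\<And>x. G (x mod int p) = G x"
  shows "(\<Sum>x<p. G (int x + int t)) = (\<Sum>x<p. G (int x))"
proof (rule sum.reindex_bij_witness[of _ "\<lambda>y. nat ((int y - int t) mod int p)" "\<lambda>x. nat ((int x + int t) mod int p)"])
  have pos: "0 < int p" using p_pos by simp
  fix x assume x: "x \<in> {..<p}"
  show "nat ((int (nat ((int x + int t) mod int p)) - int t) mod int p) = x"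
    using x pos by (simp add: mod_simps)
  show "nat ((int x + int t) mod int p) \<in> {..<p}"
    using pos by (simp add: nat_less_iff)
  show "nat ((int (nat ((int x - int t) mod int p)) + int t) mod int p) = x"
    using x pos by (simp add: mod_simps)
  show "nat ((int x - int t) mod int p) \<in> {..<p}"
    using pos by (simp add: nat_less_iff)
  show "G (int (nat ((int x + int t) mod int p))) = G (int x + int t)"
    using pos assms[of "int x + int t"] by simp
qed

lemma chi_add_mod [simp]: "chi (x mod int p + c) = chi (x + c)"
  by (rule chi_cong) (simp add: cong_def mod_simps)

text \<open>The full sum is invariant under \<open>x \<mapsto> x + t\<close>, and at most four
  \<open>t\<close> send some shift to 0. For any other \<open>t\<close> the bound with
  \<open>d = g = 1\<close> applies.\<close>

lemma abs_sum_chi_translates_le: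
  assumes C: "C \<noteq> {}" "C \<subseteq> {0..<p}" "card C \<le> 4" and p: "p \<ge> 100"
  shows "\<bar>real_of_int (\<Sum>x<p. \<Prod>c\<in>C. chi (int x + int c))\<bar> \<le> 2 * sqrt (real p) + 24"
proof -
  have fin: "finite C" using C(2) by (rule finite_subset) simp
  have "card ((\<lambda>c. (p - c) mod p) ` C) \<le> 4" using card_image_le[OF fin] C(3) by (rule order_trans)
  then have "\<not> {0..<p} \<subseteq> (\<lambda>c. (p - c) mod p) ` C"
    using p card_mono[of "(\<lambda>c. (p - c) mod p) ` C" "{0..<p}"] fin by auto
  then obtain t where "t \<in> {0..<p}" and t2: "t \<notin> (\<lambda>c. (p - c) mod p) ` C" by blast
  then have t: "t < p" by simp
  define \<tau> where "\<tau> c = (c + t) mod p" for c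
  have inj: "inj_on \<tau> C"
  proof (rule inj_onI)
    fix c c' assume c: "c \<in> C" "c' \<in> C" "\<tau> c = \<tau> c'"
    then have "[c + t = c' + t] (mod p)" by (simp add: \<tau>_def cong_def)
    then have "[c = c'] (mod p)" by (simp only: cong_add_rcancel_nat)
    moreover have "c < p" "c' < p" using c(1,2) C(2) by auto
    ultimately show "c = c'" by (simp add: cong_def)
  qed
  have "\<tau> c \<noteq> 0" if "c \<in> C" for c
  proof
    assume "\<tau> c = 0"
    then have "p dvd c + t" by (simp add: \<tau>_def mod_eq_0_iff_dvd)
    have cp: "c < p" using that C(2) by auto
    obtain m where m: "c + t = p * m" using \<open>p dvd c + t\<close> by blast
    then have "p * m < p * 2" using cp t by linarith
    then have "m < 2" using mult_less_cancel1 by blast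
    then have "t = (p - c) mod p" using m cp t by (cases "m = 0") (auto simp: less_2_cases_iff)
    with t2 that show False by blast
  qed
  then have C': "\<tau> ` C \<subseteq> {1..<p}" using p_pos by (auto simp: \<tau>_def Suc_le_eq)
  have "\<bar>real_of_int (\<Sum>x<p. \<Prod>c\<in>\<tau> ` C. chi (int x ^ 1 + int c))\<bar>
      \<le> 2 * real 1 * (sqrt (real p) + 10) + 2 * (real 1 + 1)"
    using p C card_image[OF inj] fin
    by (intro abs_sum_chi_shifted_powers_le) (use C' in auto)
  also have "(\<Sum>x<p. \<Prod>c\<in>\<tau> ` C. chi (int x ^ 1 + int c)) = (\<Sum>x<p. \<Prod>c\<in>C. chi (int x + int t + int c))"
  proof (rule sum.cong[OF refl])
    fix x
    have "chi (int x + int (\<tau> c)) = chi (int x + int t + int c)" for c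
      by (rule chi_cong) (simp add: \<tau>_def cong_def zmod_int mod_simps add_ac)
    then show "(\<Prod>c\<in>\<tau> ` C. chi (int x ^ 1 + int c)) = (\<Prod>c\<in>C. chi (int x + int t + int c))"
      by (simp add: prod.reindex[OF inj])
  qed
  also have "\<dots> = (\<Sum>x<p. \<Prod>c\<in>C. chi (int x + int c))"
    by (rule sum_shift[of "\<lambda>x. \<Prod>c\<in>C. chi (x + int c)"]) simp
  finally show ?thesis by simp
qed

text \<open>The squared factor is 1 except at its single zero, which costs at most 1.\<close>

lemma abs_sum_chi_square_le:
  assumes "b < p" "c < p" "e < p" "c \<noteq> e" "p \<ge> 100"
  shows "\<bar>real_of_int (\<Sum>x<p. chi (int x + int b) * chi (int x + int b) * (chi (int x + int c) * chi (int x + int e)))\<bar>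
    \<le> 2 * sqrt (real p) + 25"
proof -
  define G where "G x = chi (int x + int c) * chi (int x + int e)" for x
  define Z where "Z = {x \<in> {..<p}. int p dvd int x + int b}"
  have G1: "\<bar>G x\<bar> \<le> 1" for x
    unfolding G_def abs_mult using abs_chi_le by (intro mult_le_one) auto
  have "card Z \<le> Suc 0"
  proof (subst card_le_Suc0_iff_eq)
    show "finite Z" by (simp add: Z_def)
    show "\<forall>x\<in>Z. \<forall>y\<in>Z. x = y"
    proof (intro ballI)
      fix x y assume "x \<in> Z" "y \<in> Z"
      then have xy: "x < p" "y < p" "int p dvd (int x + int b) - (int y + int b)"
        using dvd_diff[of "int p" "int x + int b" "int y + int b"] by (simp_all add: Z_def)
      then have "\<bar>int x - int y\<bar> < int p" "int p dvd int x - int y" by auto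
      then show "x = y" using dvd_imp_le_int[of "int x - int y" "int p"] by auto
    qed
  qed
  have sq: "chi a * chi a = 1 - of_bool (int p dvd a)" for a
    using chi_cases[of a] chi_eq_0_iff[of a] by auto
  have "(\<Sum>x<p. chi (int x + int b) * chi (int x + int b) * G x)
      = (\<Sum>x<p. G x) - (\<Sum>x<p. of_bool (int p dvd int x + int b) * G x)"
    unfolding sq by (simp add: left_diff_distrib sum_subtractf)
  also have "(\<Sum>x<p. of_bool (int p dvd int x + int b) * G x) = (\<Sum>x\<in>Z. G x)"
    by (rule sum.mono_neutral_cong_right) (auto simp: Z_def)
  finally have eq: "(\<Sum>x<p. chi (int x + int b) * chi (int x + int b) * G x) = (\<Sum>x<p. G x) - (\<Sum>x\<in>Z. G x)" .
  have "\<bar>\<Sum>x\<in>Z. G x\<bar> \<le> (\<Sum>x\<in>Z. \<bar>G x\<bar>)" by (rule sum_abs)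
  also have "\<dots> \<le> (\<Sum>x\<in>Z. 1)" using G1 by (intro sum_mono)
  also have "\<dots> \<le> 1" using \<open>card Z \<le> Suc 0\<close> by simp
  finally have "\<bar>real_of_int (\<Sum>x\<in>Z. G x)\<bar> \<le> 1" by linarith
  moreover have "\<bar>real_of_int (\<Sum>x<p. G x)\<bar> \<le> 2 * sqrt (real p) + 24"
    using abs_sum_chi_translates_le[of "{c, e}"] assms by (simp add: G_def)
  moreover have "real_of_int (\<Sum>x<p. chi (int x + int b) * chi (int x + int b) * G x)
      = real_of_int (\<Sum>x<p. G x) - real_of_int (\<Sum>x\<in>Z. G x)"
    unfolding eq by (rule of_int_diff)
  ultimately show ?thesis unfolding G_def[symmetric] by linarith
qed

section \<open>Quadruple correlations and the fourth moment\<close>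

definition chi4 :: "nat \<times> nat \<times> nat \<times> nat \<Rightarrow> int" where
  "chi4 = (\<lambda>(a, b, c, e). \<Sum>x<p. chi (int x + int a) * chi (int x + int b) * (chi (int x + int c) * chi (int x + int e)))"

definition paired :: "nat \<times> nat \<times> nat \<times> nat \<Rightarrow> bool" where
  "paired = (\<lambda>(a, b, c, e). a = b \<and> c = e \<or> a = c \<and> b = e \<or> a = e \<and> b = c)"

lemma abs_chi4_le:
  assumes "q \<in> {0..<p} \<times> {0..<p} \<times> {0..<p} \<times> {0..<p}" "p \<ge> 100"
  shows "\<bar>real_of_int (chi4 q)\<bar> \<le> real p * of_bool (paired q) + (2 * sqrt (real p) + 25)"
proof -
  obtain a b c e where q: "q = (a, b, c, e)" by (cases q) auto
  have lt: "a < p" "b < p" "c < p" "e < p" using assms(1) q by auto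
  show ?thesis
  proof (cases "paired q")
    case True
    have "\<bar>chi4 q\<bar> \<le> (\<Sum>x<p. \<bar>chi (int x + int a) * chi (int x + int b) * (chi (int x + int c) * chi (int x + int e))\<bar>)"
      unfolding q chi4_def split by (rule sum_abs)
    also have "\<dots> \<le> (\<Sum>x<p. 1)"
      unfolding abs_mult using abs_chi_le by (intro sum_mono mult_le_one) auto
    finally have "\<bar>real_of_int (chi4 q)\<bar> \<le> real p" by simp
    moreover have "0 \<le> sqrt (real p)" by simp
    moreover have "real p * of_bool (paired q) = real p" using True by simp
    ultimately show ?thesis by linarith
  next
    case False
    have "\<bar>real_of_int (chi4 q)\<bar> \<le> 2 * sqrt (real p) + 25"
    proof (cases "a = b \<or> a = c \<or> a = e \<or> b = c \<or> b = e \<or> c = e")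
      case True
      \<comment> \<open>In an unpaired quadruple, a coincidence leaves two different remaining
        entries.\<close>
      then consider "a = b" "c \<noteq> e" | "a = c" "b \<noteq> e" | "a = e" "b \<noteq> c"
        | "b = c" "a \<noteq> e" | "b = e" "a \<noteq> c" | "c = e" "a \<noteq> b"
        using False unfolding paired_def q by auto
      then show ?thesis
      proof cases
        case 1
        then show ?thesis using abs_sum_chi_square_le[of a c e] lt assms(2) by (simp add: chi4_def q mult_ac)
      next
        case 2
        then show ?thesis using abs_sum_chi_square_le[of a b e] lt assms(2) by (simp add: chi4_def q mult_ac)
      next
        case 3
        then show ?thesis using abs_sum_chi_square_le[of a b c] lt assms(2) by (simp add: chi4_def q mult_ac)
      next
        case 4
        then show ?thesis using abs_sum_chi_square_le[of b a e] lt assms(2) by (simp add: chi4_def q mult_ac)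
      next
        case 5
        then show ?thesis using abs_sum_chi_square_le[of b a c] lt assms(2) by (simp add: chi4_def q mult_ac)
      next
        case 6
        then show ?thesis using abs_sum_chi_square_le[of c a b] lt assms(2) by (simp add: chi4_def q mult_ac)
      qed
    next
      case distinct: False
      then have "\<bar>real_of_int (\<Sum>x<p. \<Prod>d\<in>{a, b, c, e}. chi (int x + int d))\<bar> \<le> 2 * sqrt (real p) + 24"
        using lt assms(2) by (intro abs_sum_chi_translates_le) auto
      then show ?thesis using distinct by (simp add: chi4_def q mult.assoc)
    qed
    then show ?thesis using False by simp
  qed
qed

lemma card_paired_le:
  assumes "finite B" shows "card {q \<in> B \<times> B \<times> B \<times> B. paired q} \<le> 3 * card B ^ 2"
proof -
  define X where "X = (\<lambda>(a, b). (a, a, b, b)) ` (B \<times> B)"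
  define Y where "Y = (\<lambda>(a, b). (a, b, a, b)) ` (B \<times> B)"
  define Z where "Z = (\<lambda>(a, b). (a, b, b, a)) ` (B \<times> B)"
  have "card X \<le> card B ^ 2" "card Y \<le> card B ^ 2" "card Z \<le> card B ^ 2"
    unfolding X_def Y_def Z_def using card_image_le[of "B \<times> B"] assms
    by (auto simp: card_cartesian_product power2_eq_square)
  moreover have "{q \<in> B \<times> B \<times> B \<times> B. paired q} \<subseteq> X \<union> (Y \<union> Z)"
    by (auto simp: paired_def X_def Y_def Z_def image_iff)
  then have "card {q \<in> B \<times> B \<times> B \<times> B. paired q} \<le> card (X \<union> (Y \<union> Z))"
    using assms by (intro card_mono) (auto simp: X_def Y_def Z_def)
  moreover have "card (X \<union> (Y \<union> Z)) \<le> card X + (card Y + card Z)"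
    by (rule order_trans[OF card_Un_le add_left_mono[OF card_Un_le]])
  ultimately show ?thesis by linarith
qed

lemma fourth_moment_le:
  assumes B: "B \<subseteq> {0..<p}" and p: "p \<ge> 100"
  shows "real_of_int (\<Sum>x<p. (\<Sum>b\<in>B. chi (int x + int b)) ^ 4)
    \<le> 3 * real (card B) ^ 2 * real p + real (card B) ^ 4 * (2 * sqrt (real p) + 25)"
proof -
  have fin: "finite B" using B by (rule finite_subset) simp
  define Q where "Q = B \<times> B \<times> B \<times> B"
  have finQ: "finite Q" using fin by (simp add: Q_def)
  have cQ: "card Q = card B ^ 4" by (simp add: Q_def card_cartesian_product power4_eq_xxxx)
  have "(\<Sum>b\<in>B. h b) ^ 4 = (\<Sum>(a, b, c, e)\<in>Q. h a * h b * (h c * h e))" for h :: "nat \<Rightarrow> int"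
  proof -
    have "(\<Sum>b\<in>B. h b) ^ 4 = (\<Sum>a\<in>B. h a) * ((\<Sum>b\<in>B. h b) * ((\<Sum>c\<in>B. h c) * (\<Sum>e\<in>B. h e)))"
      by (simp add: power4_eq_xxxx mult.assoc)
    also have "\<dots> = (\<Sum>(a, b, c, e)\<in>Q. h a * (h b * (h c * h e)))"
      unfolding Q_def by (simp only: sum_mult_sum_pairs case_prod_unfold)
    finally show ?thesis by (simp add: mult.assoc)
  qed
  then have "(\<Sum>x<p. (\<Sum>b\<in>B. chi (int x + int b)) ^ 4) = (\<Sum>x<p. \<Sum>(a, b, c, e)\<in>Q.
      chi (int x + int a) * chi (int x + int b) * (chi (int x + int c) * chi (int x + int e)))" by simp
  also have "\<dots> = (\<Sum>q\<in>Q. chi4 q)"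
    by (subst sum.swap) (simp add: chi4_def case_prod_unfold)
  finally have "real_of_int (\<Sum>x<p. (\<Sum>b\<in>B. chi (int x + int b)) ^ 4) = (\<Sum>q\<in>Q. real_of_int (chi4 q))" by simp
  also have "\<dots> \<le> (\<Sum>q\<in>Q. real p * of_bool (paired q) + (2 * sqrt (real p) + 25))"
  proof (rule sum_mono)
    fix q assume "q \<in> Q"
    then have "q \<in> {0..<p} \<times> {0..<p} \<times> {0..<p} \<times> {0..<p}" using B by (auto simp: Q_def)
    from abs_chi4_le[OF this p] show "real_of_int (chi4 q) \<le> real p * of_bool (paired q) + (2 * sqrt (real p) + 25)"
      by linarith
  qed
  also have "\<dots> = real p * (\<Sum>q\<in>Q. of_bool (paired q)) + real (card Q) * (2 * sqrt (real p) + 25)"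
    by (simp add: sum.distrib sum_distrib_left distrib_left)
  also have "(\<Sum>q\<in>Q. of_bool (paired q) :: real) = real (card {q \<in> Q. paired q})"
    using finQ by (simp add: of_bool_def sum.If_cases Int_def)
  also have "real p * real (card {q \<in> Q. paired q}) \<le> real p * (3 * real (card B) ^ 2)"
  proof (rule mult_left_mono)
    have "real (card {q \<in> Q. paired q}) \<le> real (3 * card B ^ 2)"
      using card_paired_le[OF fin] unfolding Q_def by (simp only: of_nat_le_iff)
    then show "real (card {q \<in> Q. paired q}) \<le> 3 * real (card B) ^ 2" by simp
  qed simp
  finally show ?thesis by (simp add: cQ mult_ac)
qed

end

section \<open>Bounds for the summands\<close>

context odd_prime
begin

lemma sumset_commute: "sumset_mod p A B = sumset_mod p B A"
  unfolding sumset_mod_def by (intro Collect_cong) (metis add.commute)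

lemma card_sumset_le:
  assumes "finite A" "finite B" shows "card (sumset_mod p A B) \<le> card A * card B"
proof -
  have "sumset_mod p A B = (\<lambda>(a, b). (a + b) mod p) ` (A \<times> B)" by (auto simp: sumset_mod_def)
  then show ?thesis using card_image_le[of "A \<times> B"] assms by (simp add: card_cartesian_product)
qed

lemma chi_sumset:
  assumes "sumset_mod p A B = primitive_elems p" "a \<in> A" "b \<in> B"
  shows "chi (int a + int b) = -1"
proof -
  have "(a + b) mod p \<in> primitive_elems p" using assms by (auto simp: sumset_mod_def)
  then have "chi (int ((a + b) mod p)) = -1" by (rule chi_primitive)
  then show ?thesis by (simp add: zmod_int)
qed

lemma card_summand_fourth_moment:
  assumes AB: "A \<subseteq> {0..<p}" "B \<subseteq> {0..<p}" "sumset_mod p A B = primitive_elems p" and p: "p \<ge> 100"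
  shows "real (card A) * real (card B) ^ 4
    \<le> 3 * real (card B) ^ 2 * real p + real (card B) ^ 4 * (2 * sqrt (real p) + 25)"
proof -
  have "int (card A) * int (card B) ^ 4 = (\<Sum>x\<in>A. (\<Sum>b\<in>B. chi (int x + int b)) ^ 4)"
  proof -
    have "(\<Sum>b\<in>B. chi (int x + int b)) = - int (card B)" if "x \<in> A" for x
      using chi_sumset[OF AB(3) that] by simp
    then show ?thesis by simp
  qed
  also have "\<dots> \<le> (\<Sum>x<p. (\<Sum>b\<in>B. chi (int x + int b)) ^ 4)"
    using AB(1) by (intro sum_mono2) auto
  finally have "real_of_int (int (card A) * int (card B) ^ 4)
      \<le> real_of_int (\<Sum>x<p. (\<Sum>b\<in>B. chi (int x + int b)) ^ 4)" by (simp only: of_int_le_iff)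
  also have "\<dots> \<le> 3 * real (card B) ^ 2 * real p + real (card B) ^ 4 * (2 * sqrt (real p) + 25)"
    by (rule fourth_moment_le[OF AB(2) p])
  finally show ?thesis by simp
qed

section \<open>Excluding small summands\<close>

lemma chi_add_diff_mod: "chi (int x + int ((b + (p - c)) mod p)) = chi (int x + int b - int c)" if "c \<le> p"
proof -
  have "int (b + (p - c)) = (int b - int c) + int p" using that by simp
  then have "int ((b + (p - c)) mod p) = (int b - int c) mod int p"
    by (simp only: zmod_int mod_add_self2)
  moreover have "[int x + (int b - int c) mod int p = int x + int b - int c] (mod int p)"
    by (simp add: cong_def mod_simps add_diff_eq)
  ultimately show ?thesis using chi_cong by metis
qed

lemma chi_translate:
  assumes "b \<le> p"
  shows "chi (int ((a + b) mod p) + int ((c + (p - b)) mod p)) = chi (int a + int c)"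
proof -
  have "[int ((a + b) mod p) + int c - int b = int a + int b + int c - int b] (mod int p)"
    unfolding zmod_int of_nat_add by (intro cong_diff cong_add cong_refl) (simp add: cong_def)
  then have "[int ((a + b) mod p) + int c - int b = int a + int c] (mod int p)" by simp
  then show ?thesis unfolding chi_add_diff_mod[OF assms] by (rule chi_cong)
qed

lemma diff_mod_ge_1:
  assumes "b < p" "c < p" "b \<noteq> c" shows "(b + (p - c)) mod p \<in> {1..<p}"
proof -
  have "(b + (p - c)) mod p \<noteq> 0"
  proof
    assume "(b + (p - c)) mod p = 0"
    then have "p dvd b + (p - c)" by (simp add: mod_eq_0_iff_dvd)
    then have "int p dvd int b + (int p - int c)" using assms by (metis int_dvd_int_iff less_imp_le of_nat_add of_nat_diff)
    then have "int p dvd int b - int c" by (metis add_diff_eq dvd_add_triv_left_iff diff_add_eq add.commute)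
    moreover have "\<bar>int b - int c\<bar> < int p" using assms by linarith
    ultimately show False using dvd_imp_le_int[of "int b - int c" "int p"] assms by auto
  qed
  then show ?thesis using p_pos by (simp add: Suc_le_eq)
qed

text \<open>A primitive root \<open>x\<close> is \<open>a + b\<close> or \<open>a + c\<close>, so
  \<open>\<chi>\<close> is -1 at \<open>x + (c - b)\<close> or at \<open>x + (b - c)\<close>, and
  the product of the two factors \<open>1 + \<chi>\<close> vanishes. Summed over all
  \<open>x\<close>, its expansion is \<open>\<phi> (p - 1)\<close> plus three error sums. The count
  used for larger \<open>B\<close> is inconclusive here, as \<open>A + b\<close> may fill half of
  the primitive roots.\<close>

lemma totient_le_of_card_2:
  assumes AB: "A \<subseteq> {0..<p}" "B \<subseteq> {0..<p}" "sumset_mod p A B = primitive_elems p"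
    and B: "card B = 2" and p: "p \<ge> 100"
  shows "real (totient (p - 1)) \<le> 2 ^ card (prime_factors (p - 1)) * (6 * (2 * sqrt (real p) + 25))"
proof -
  define t where "t = (2 :: real) ^ card (prime_factors (p - 1))"
  define r where "r = 2 * sqrt (real p) + 25"
  have s: "sqrt (real p) \<ge> 10" using p by (intro real_le_rsqrt) auto
  have tr: "0 \<le> t * r" using s by (simp add: t_def r_def)
  obtain b c where bc: "B = {b, c}" "b \<noteq> c" using B by (auto simp: card_2_iff)
  have lt: "b < p" "c < p" using bc AB(2) by auto
  define d where "d = (b + (p - c)) mod p"
  define e where "e = (c + (p - b)) mod p"
  have de: "d \<in> {1..<p}" "e \<in> {1..<p}" 
    unfolding d_def e_def
    by (rule diff_mod_ge_1[OF lt bc(2)], rule diff_mod_ge_1[OF lt(2,1) bc(2)[symmetric]])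
  have "d \<noteq> e"
  proof
    assume "d = e"
    have "(d + e) mod p = (b + (p - c) + (c + (p - b))) mod p" by (simp add: d_def e_def mod_simps)
    also have "b + (p - c) + (c + (p - b)) = 2 * p" using lt by simp
    finally have "p dvd 2 * d" using \<open>d = e\<close> by (simp add: mod_eq_0_iff_dvd mult_2)
    then have "p dvd d" using prime_p p_gt_2 by (auto simp: prime_dvd_mult_iff dest: dvd_imp_le)
    then show False using de by (auto dest: dvd_imp_le)
  qed
  have err: "\<bar>real_of_int (\<Sum>x\<in>primitive_elems p. \<Prod>c\<in>C. chi (int x + int c))\<bar> \<le> 2 * (t * r)"
    if C: "C \<noteq> {}" "C \<subseteq> {d, e}" for C
  proof -
    have "card C \<le> 2" using card_mono[OF _ C(2)] \<open>d \<noteq> e\<close> by simp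
    then have "real (card C) * r \<le> 2 * r" using s by (intro mult_right_mono) (auto simp: r_def)
    then have "t * (real (card C) * r) \<le> t * (2 * r)" by (intro mult_left_mono) (auto simp: t_def)
    moreover have "C \<subseteq> {1..<p}" using C(2) de by auto
    ultimately show ?thesis
      using abs_sum_primitive_chi_le[OF C(1) _ _ p] \<open>card C \<le> 2\<close> s
      unfolding t_def[symmetric] r_def[symmetric] by fastforce
  qed
  have zero: "(1 + chi (int x + int d)) * (1 + chi (int x + int e)) = 0" if "x \<in> primitive_elems p" for x
  proof -
    obtain a b' where x: "a \<in> A" "b' \<in> B" "x = (a + b') mod p" 
      using \<open>x \<in> primitive_elems p\<close> unfolding AB(3)[symmetric] sumset_mod_def by auto
    have *: "chi (int x + int z) = chi (int a + int b' + int z)" for z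
      unfolding x(3) zmod_int by simp
    consider "b' = b" | "b' = c" using x(2) bc by auto
    then show ?thesis
    proof cases
      case 1
      have "chi (int x + int e) = chi (int a + int c)"
        unfolding x(3) 1 e_def using lt by (intro chi_translate) simp
      also have "\<dots> = -1" using chi_sumset[OF AB(3) x(1)] bc by simp
      finally show ?thesis by simp
    next
      case 2
      have "chi (int x + int d) = chi (int a + int b)"
        unfolding x(3) 2 d_def using lt by (intro chi_translate) simp
      also have "\<dots> = -1" using chi_sumset[OF AB(3) x(1)] bc by simp
      finally show ?thesis by simp
    qed
  qed
  have "0 = (\<Sum>x\<in>primitive_elems p. (1 + chi (int x + int d)) * (1 + chi (int x + int e)))"
    by (rule sum.neutral[symmetric]) (use zero in blast)
  also have "\<dots> = int (totient (p - 1)) + (\<Sum>x\<in>primitive_elems p. \<Prod>c\<in>{d}. chi (int x + int c))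
      + (\<Sum>x\<in>primitive_elems p. \<Prod>c\<in>{e}. chi (int x + int c))
      + (\<Sum>x\<in>primitive_elems p. \<Prod>c\<in>{d, e}. chi (int x + int c))"
    using \<open>d \<noteq> e\<close> by (simp add: distrib_left distrib_right sum.distrib card_primitive_elems)
  finally have "real (totient (p - 1)) = - real_of_int (\<Sum>x\<in>primitive_elems p. \<Prod>c\<in>{d}. chi (int x + int c))
      - real_of_int (\<Sum>x\<in>primitive_elems p. \<Prod>c\<in>{e}. chi (int x + int c))
      - real_of_int (\<Sum>x\<in>primitive_elems p. \<Prod>c\<in>{d, e}. chi (int x + int c))" by linarith
  moreover have "\<bar>real_of_int (\<Sum>x\<in>primitive_elems p. \<Prod>c\<in>{d}. chi (int x + int c))\<bar> \<le> 2 * (t * r)"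
    "\<bar>real_of_int (\<Sum>x\<in>primitive_elems p. \<Prod>c\<in>{e}. chi (int x + int c))\<bar> \<le> 2 * (t * r)"
    "\<bar>real_of_int (\<Sum>x\<in>primitive_elems p. \<Prod>c\<in>{d, e}. chi (int x + int c))\<bar> \<le> 2 * (t * r)"
    by (rule err; blast)+
  ultimately have "real (totient (p - 1)) \<le> 6 * (t * r)" by linarith
  then show ?thesis unfolding t_def r_def by (simp only: mult.left_commute)
qed

text \<open>\<open>A + b\<close> lies among the primitive roots \<open>x\<close> with
  \<open>\<chi> (x + c - b) = -1\<close> for the \<open>k - 1\<close> other elements
  \<open>c\<close>. Their expected number is \<open>\<phi> / 2 ^ (k - 1)\<close>, while
  \<open>card A \<ge> \<phi> / k\<close>. As \<open>k / 2 ^ (k - 1) \<le> 3 / 4\<close> for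
  \<open>k \<ge> 3\<close>, the error must account for \<open>\<phi> / (4 * k)\<close>.\<close>

lemma totient_le_of_card_ge_3:
  assumes AB: "A \<subseteq> {0..<p}" "B \<subseteq> {0..<p}" "sumset_mod p A B = primitive_elems p"
    and B: "card B \<ge> 3" "2 * real (card B) < sqrt (real p)" and p: "p \<ge> 100"
  shows "real (totient (p - 1))
    \<le> 2 ^ card (prime_factors (p - 1)) * (4 * real (card B) ^ 2 * (2 * sqrt (real p) + 25))"
proof -
  define t where "t = (2 :: real) ^ card (prime_factors (p - 1))"
  define r where "r = 2 * sqrt (real p) + 25"
  define k where "k = card B"
  define P where "P = primitive_elems p"
  have s: "sqrt (real p) \<ge> 10" using p by (intro real_le_rsqrt) auto
  have finA: "finite A" using AB(1) by (rule finite_subset) simp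
  have finB: "finite B" using AB(2) by (rule finite_subset) simp
  have finP: "finite P" by (simp add: P_def primitive_elems_def)
  obtain b where b: "b \<in> B" using B(1) by fastforce
  have bp: "b < p" using b AB(2) by auto
  define C where "C = (\<lambda>c. (c + (p - b)) mod p) ` (B - {b})"
  have C: "C \<subseteq> {1..<p}"
    unfolding C_def using AB(2) bp by (intro image_subsetI diff_mod_ge_1) auto
  have finC: "finite C" using finB by (simp add: C_def)
  have "inj_on (\<lambda>c. (c + (p - b)) mod p) (B - {b})"
  proof (rule inj_onI)
    fix c c' assume c: "c \<in> B - {b}" "c' \<in> B - {b}" "(c + (p - b)) mod p = (c' + (p - b)) mod p"
    then have "[c = c'] (mod p)" by (simp only: cong_def[symmetric] cong_add_rcancel_nat)
    moreover have "c < p" "c' < p" using c(1,2) AB(2) by auto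
    ultimately show "c = c'" by (simp add: cong_def)
  qed
  then have cC: "card C = k - 1" using b finB by (simp add: C_def card_image k_def)
  have err: "\<bar>real_of_int (\<Sum>x\<in>P. \<Prod>c\<in>X. chi (int x + int c))\<bar> \<le> t * (real k * r)"
    if X: "X \<noteq> {}" "X \<subseteq> C" for X
  proof -
    have "card X \<le> k" using card_mono[OF finC X(2)] cC by simp
    then have "t * (real (card X) * r) \<le> t * (real k * r)"
      using s by (intro mult_left_mono mult_right_mono) (auto simp: r_def t_def)
    moreover have "2 * real (card X) < sqrt (real p)" using \<open>card X \<le> k\<close> B(2) by (simp add: k_def)
    moreover have "X \<subseteq> {1..<p}" using X(2) C by auto
    ultimately show ?thesis
      using abs_sum_primitive_chi_le[OF X(1) _ _ p]
      unfolding t_def[symmetric] r_def[symmetric] P_def by fastforce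
  qed
  define \<sigma> where "\<sigma> a = (a + b) mod p" for a
  have inj: "inj_on \<sigma> A"
  proof (rule inj_onI)
    fix a a' assume a: "a \<in> A" "a' \<in> A" "\<sigma> a = \<sigma> a'"
    then have "[a = a'] (mod p)" by (simp only: \<sigma>_def cong_def[symmetric] cong_add_rcancel_nat)
    moreover have "a < p" "a' < p" using a(1,2) AB(1) by auto
    ultimately show "a = a'" by (simp add: cong_def)
  qed
  have \<sigma>P: "\<sigma> ` A \<subseteq> P" using AB(3) b by (auto simp: \<sigma>_def P_def sumset_mod_def)
  have \<sigma>chi: "(\<Prod>c\<in>C. 1 - chi (int x + int c)) = 2 ^ (k - 1)" if "x \<in> \<sigma> ` A" for x
  proof -
    obtain a where a: "a \<in> A" "x = \<sigma> a" using \<open>x \<in> \<sigma> ` A\<close> by blast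
    have "chi (int x + int c) = -1" if "c \<in> C" for c
    proof -
      obtain b' where b': "b' \<in> B" "c = (b' + (p - b)) mod p" using \<open>c \<in> C\<close> by (auto simp: C_def)
      have "chi (int x + int c) = chi (int a + int b')"
        unfolding a(2) b'(2) \<sigma>_def using bp by (intro chi_translate) simp
      also have "\<dots> = -1" using chi_sumset[OF AB(3) a(1) b'(1)] .
      finally show ?thesis .
    qed
    then show ?thesis by (simp add: cC)
  qed
  have "int (card A) * 2 ^ (k - 1) = (\<Sum>x\<in>\<sigma> ` A. \<Prod>c\<in>C. 1 - chi (int x + int c))"
    using \<sigma>chi by (simp add: card_image[OF inj])
  also have "\<dots> \<le> (\<Sum>x\<in>P. \<Prod>c\<in>C. 1 - chi (int x + int c))"
  proof (rule sum_mono2[OF finP \<sigma>P])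
    show "0 \<le> (\<Prod>c\<in>C. 1 - chi (int x + int c))" for x
      using abs_chi_le by (intro prod_nonneg) (auto simp: abs_le_iff)
  qed
  also have "\<dots> = (\<Sum>X\<in>Pow C. (-1) ^ card X * (\<Sum>x\<in>P. \<Prod>c\<in>X. chi (int x + int c)))"
    using finC by (simp add: prod_diff_conv_sum sum_distrib_left) (rule sum.swap)
  finally have "real_of_int (int (card A) * 2 ^ (k - 1))
      \<le> real_of_int (\<Sum>X\<in>Pow C. (-1) ^ card X * (\<Sum>x\<in>P. \<Prod>c\<in>X. chi (int x + int c)))"
    by (simp only: of_int_le_iff)
  also have "\<dots> = (\<Sum>X\<in>Pow C. (-1) ^ card X * real_of_int (\<Sum>x\<in>P. \<Prod>c\<in>X. chi (int x + int c)))" by simp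
  also have "\<dots> = real (totient (p - 1))
      + (\<Sum>X\<in>Pow C - {{}}. (-1) ^ card X * real_of_int (\<Sum>x\<in>P. \<Prod>c\<in>X. chi (int x + int c)))"
    using finC by (subst sum.remove[of _ "{}"]) (auto simp: P_def card_primitive_elems)
  also have "(\<Sum>X\<in>Pow C - {{}}. (-1) ^ card X * real_of_int (\<Sum>x\<in>P. \<Prod>c\<in>X. chi (int x + int c)))
      \<le> (\<Sum>X\<in>Pow C - {{}}. t * (real k * r))"
  proof (rule sum_mono)
    fix X assume X: "X \<in> Pow C - {{}}"
    have "(-1) ^ card X * real_of_int (\<Sum>x\<in>P. \<Prod>c\<in>X. chi (int x + int c))
        \<le> \<bar>(-1) ^ card X * real_of_int (\<Sum>x\<in>P. \<Prod>c\<in>X. chi (int x + int c))\<bar>" by (rule abs_ge_self)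
    also have "\<dots> = \<bar>real_of_int (\<Sum>x\<in>P. \<Prod>c\<in>X. chi (int x + int c))\<bar>" by (simp only: abs_mult power_abs abs_neg_one power_one mult_1)
    also have "\<dots> \<le> t * (real k * r)" using X by (intro err) auto
    finally show "(-1) ^ card X * real_of_int (\<Sum>x\<in>P. \<Prod>c\<in>X. chi (int x + int c)) \<le> t * (real k * r)" .
  qed
  also have "(\<Sum>X\<in>Pow C - {{}}. t * (real k * r)) \<le> 2 ^ (k - 1) * (t * (real k * r))"
  proof -
    have "card (Pow C - {{}}) \<le> 2 ^ (k - 1)" using finC by (simp add: card_Diff_singleton card_Pow cC)
    then have "real (card (Pow C - {{}})) \<le> 2 ^ (k - 1)" by (metis of_nat_le_iff of_nat_numeral of_nat_power)
    then have "real (card (Pow C - {{}})) * (t * (real k * r)) \<le> 2 ^ (k - 1) * (t * (real k * r))"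
      using s by (intro mult_right_mono) (auto simp: t_def r_def)
    then show ?thesis by simp
  qed
  finally have upper: "real (card A) * 2 ^ (k - 1) \<le> real (totient (p - 1)) + 2 ^ (k - 1) * (t * (real k * r))"
    by simp
  have "totient (p - 1) \<le> card A * card B"
    using card_sumset_le[OF finA finB] AB(3) by (simp add: card_primitive_elems)
  then have "real (totient (p - 1)) \<le> real (card A * card B)" by (simp only: of_nat_le_iff)
  then have lower: "real (totient (p - 1)) \<le> real (card A) * real k" by (simp add: k_def)
  define T where "T = real (totient (p - 1))"
  define w where "w = (2 :: real) ^ (k - 1)"
  have pow: "4 * j \<le> 3 * 2 ^ (j - 1)" if "3 \<le> j" for j :: nat
    using that
  proof (induction j rule: dec_induct)
    case (step n)
    then show ?case by (cases n) auto
  qed simp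
  have "real (4 * k) \<le> real (3 * 2 ^ (k - 1))" using pow[of k] B(1) unfolding k_def by (simp only: of_nat_le_iff)
  then have kw: "4 * real k \<le> 3 * w" by (simp add: w_def)
  have w: "0 < w" by (simp add: w_def)
  have "T * w \<le> real (card A) * real k * w" using lower w by (simp add: T_def)
  also have "\<dots> = real k * (real (card A) * w)" by simp
  also have "\<dots> \<le> real k * (T + w * (t * (real k * r)))"
    using upper by (intro mult_left_mono) (simp_all add: T_def w_def)
  finally have "4 * (T * w) \<le> 4 * real k * T + 4 * real k * (w * (t * (real k * r)))" by (simp add: algebra_simps)
  also have "4 * real k * T \<le> 3 * w * T" using kw by (rule mult_right_mono) (simp add: T_def)
  finally have "w * T \<le> w * (t * (4 * real k ^ 2 * r))" by (simp add: algebra_simps power2_eq_square)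
  then have "T \<le> t * (4 * real k ^ 2 * r)" using w by simp
  then show ?thesis by (simp add: T_def t_def r_def k_def)
qed

end

text \<open>At most \<open>c\<close> prime factors are below \<open>c\<close>; the others are at
  least \<open>c\<close> and their product divides \<open>n\<close>. For large \<open>c\<close> this
  shows that \<open>2 ^ card (prime_factors n)\<close> grows slower than any power of
  \<open>n\<close>.\<close>

lemma power_card_prime_factors_le:
  fixes c n :: nat
  assumes "0 < n" "1 \<le> c"
  shows "c ^ card (prime_factors n) \<le> c ^ c * n"
proof -
  define S where "S = {q \<in> prime_factors n. q < c}"
  define B where "B = {q \<in> prime_factors n. \<not> q < c}"
  have fin: "finite S" "finite B" by (simp_all add: S_def B_def)
  have "card S \<le> card {..<c}" by (rule card_mono) (auto simp: S_def)
  then have S: "c ^ card S \<le> c ^ c" using assms(2) by (intro power_increasing) auto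
  have "c ^ card B = (\<Prod>q\<in>B. c)" by simp
  also have "\<dots> \<le> \<Prod>B" by (rule prod_mono) (auto simp: B_def)
  also have "\<Prod>B dvd n"
    by (subst prod_primes_dvd_iff) (auto simp: B_def)
  then have "\<Prod>B \<le> n" using assms(1) by (rule dvd_imp_le)
  finally have B: "c ^ card B \<le> n" .
  have "prime_factors n = S \<union> B" "S \<inter> B = {}" by (auto simp: S_def B_def)
  then have "card (prime_factors n) = card S + card B"
    using card_Un_disjoint[OF fin] by (simp only:)
  then show ?thesis using mult_le_mono[OF S B] by (simp add: power_add)
qed

lemma totient_ge: "real n \<le> 2 ^ card (prime_factors n) * real (totient n)"
proof -
  have "(\<Prod>q\<in>prime_factors n. 1 / 2) \<le> (\<Prod>q\<in>prime_factors n. 1 - 1 / real q)"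
  proof (rule prod_mono)
    fix q assume "q \<in> prime_factors n"
    then have "2 \<le> q" by (auto intro: prime_ge_2_nat)
    then have "1 / real q \<le> 1 / 2" by (intro divide_left_mono) auto
    then show "0 \<le> (1 / 2 :: real) \<and> 1 / 2 \<le> 1 - 1 / real q" by simp
  qed
  then have "real n * (1 / 2) ^ card (prime_factors n) \<le> real (totient n)"
    unfolding totient_formula2 by (intro mult_left_mono) auto
  then show ?thesis by (simp add: field_simps power_divide)
qed

context odd_prime
begin

text \<open>\<open>6 * s \<le> \<eta> * k\<^sup>2\<close> is the point from which
  \<open>3 * p / k\<^sup>2\<close> is at most \<open>\<eta> * s / 2\<close>; the term 25 fits in the
  other half. Otherwise the fourth moment and \<open>card A \<ge> \<phi> / k\<close> force
  \<open>k \<le> 12 * t\<close>, against equidistribution.\<close>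

lemma card_summand_le:
  fixes \<eta> :: real
  defines "s \<equiv> sqrt (real p)" and "t \<equiv> (2 :: real) ^ card (prime_factors (p - 1))"
  assumes AB: "A \<subseteq> {0..<p}" "B \<subseteq> {0..<p}" "sumset_mod p A B = primitive_elems p" "card B \<ge> 2"
    and \<eta>: "0 < \<eta>" and t: "t ^ 8 \<le> s"
    and s: "3456\<^sup>2 < s" "50 \<le> \<eta> * s" "(864 / \<eta>) ^ 4 \<le> s ^ 3"
  shows "real (card A) \<le> (2 + \<eta>) * s"
proof -
  define k where "k = real (card B)"
  define \<phi> where "\<phi> = real (totient (p - 1))"
  have s_large: "11943936 < s" using s(1) by simp
  have s2: "s * s = real p" by (simp add: s_def)
  have t1: "1 \<le> t" by (simp add: t_def)
  have k2: "2 \<le> k" using AB(4) by (simp add: k_def)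
  have "11943936 * 11943936 \<le> s * s" using s_large by (intro mult_mono) auto
  then have p100: "p \<ge> 100" unfolding s2 by linarith
  have finA: "finite A" using AB(1) by (rule finite_subset) simp
  have finB: "finite B" using AB(2) by (rule finite_subset) simp
  have moment: "real (card A) * k ^ 4 \<le> 3 * k ^ 2 * real p + k ^ 4 * (2 * s + 25)"
    using card_summand_fourth_moment[OF AB(1-3) p100] by (simp add: k_def s_def)
  show ?thesis
  proof (cases "6 * s \<le> \<eta> * k ^ 2")
    case True
    have "3 * k ^ 2 * real p = 6 * s * (k ^ 2 * s / 2)" by (simp add: s2[symmetric])
    also have "\<dots> \<le> \<eta> * k ^ 2 * (k ^ 2 * s / 2)"
      using True s_large by (intro mult_right_mono) auto
    also have "\<dots> = k ^ 4 * (\<eta> * s / 2)" by (simp add: power2_eq_square power4_eq_xxxx)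
    finally have "real (card A) * k ^ 4 \<le> k ^ 4 * (\<eta> * s / 2 + (2 * s + 25))"
      using moment by (simp add: algebra_simps)
    then have "real (card A) \<le> \<eta> * s / 2 + (2 * s + 25)" using k2 by (simp add: mult.commute)
    then show ?thesis using s(2) by (simp add: algebra_simps)
  next
    case False
    have "totient (p - 1) \<le> card A * card B"
      using card_sumset_le[OF finA finB] AB(3) by (simp add: card_primitive_elems)
    then have "real (totient (p - 1)) \<le> real (card A * card B)" by (simp only: of_nat_le_iff)
    then have AB_ge: "\<phi> \<le> real (card A) * k" by (simp add: \<phi>_def k_def)
    have "real (p - 1) \<le> t * \<phi>" unfolding t_def \<phi>_def by (rule totient_ge)
    then have \<phi>_ge: "real p \<le> 2 * (t * \<phi>)" using p100 by (simp add: of_nat_diff)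
    have "\<phi> * k ^ 3 \<le> real (card A) * k * k ^ 3" using AB_ge k2 by (intro mult_right_mono) auto
    also have "\<dots> = real (card A) * k ^ 4" by (simp add: power3_eq_cube power4_eq_xxxx)
    also have "\<dots> \<le> 3 * k ^ 2 * real p + k ^ 4 * (2 * s + 25)" by (rule moment)
    also have "\<dots> \<le> 3 * k ^ 2 * real p + k ^ 4 * (3 * s)"
      using s_large by (intro add_left_mono mult_left_mono) auto
    finally have "k ^ 2 * (\<phi> * k) \<le> k ^ 2 * (3 * real p + k ^ 2 * (3 * s))"
      by (simp add: power2_eq_square power3_eq_cube power4_eq_xxxx algebra_simps)
    then have "\<phi> * k \<le> 3 * real p + k ^ 2 * (3 * s)" using k2 by simp
    then have "2 * t * (\<phi> * k) \<le> 2 * t * (3 * real p + k ^ 2 * (3 * s))"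
      using t1 by (intro mult_left_mono) auto
    moreover have "real p * k \<le> 2 * (t * \<phi>) * k" using \<phi>_ge k2 by (intro mult_right_mono) auto
    ultimately have "real p * k \<le> 6 * t * real p + 6 * t * s * k\<^sup>2" by (simp add: algebra_simps)
    \<comment> \<open>Multiplying \<open>864 * t\<^sup>2 \<le> \<eta> * s\<close> by
      \<open>\<eta> * k\<^sup>2 \<le> 6 * s\<close> gives \<open>12 * t * k \<le> s\<close>, as
      \<open>864 = 6 * 144\<close>; the quadratic term is then absorbed.\<close>
    also have "6 * t * s * k\<^sup>2 \<le> real p * k / 2"
    proof -
      have "(864 * t\<^sup>2 / \<eta>) ^ 4 = (864 / \<eta>) ^ 4 * t ^ 8"
        by (simp add: power_mult_distrib power_divide flip: power_mult)
      also have "\<dots> \<le> s ^ 3 * s" using s(3) t t1 s_large by (intro mult_mono) auto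
      also have "\<dots> = s ^ 4" by (simp add: power3_eq_cube power4_eq_xxxx)
      finally have "864 * t\<^sup>2 / \<eta> \<le> s" using s_large by (rule_tac power_le_imp_le_base[of _ 3]) (auto simp: numeral_eq_Suc)
      then have a: "864 * t\<^sup>2 \<le> \<eta> * s" using \<eta> by (simp add: field_simps)
      have b: "\<eta> * k ^ 2 \<le> 6 * s" using False by simp
      have "864 * t\<^sup>2 * (\<eta> * k ^ 2) \<le> \<eta> * s * (6 * s)"
        by (rule mult_mono[OF a b]) (use \<eta> t1 s_large in auto)
      then have "\<eta> * (144 * (t\<^sup>2 * k\<^sup>2)) \<le> \<eta> * (s * s)" by (simp add: algebra_simps)
      then have "144 * (t\<^sup>2 * k\<^sup>2) \<le> s\<^sup>2" using \<eta> by (simp add: power2_eq_square[of s])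
      then have "(12 * t * k)\<^sup>2 \<le> s\<^sup>2" by (simp add: power_mult_distrib)
      then have "12 * t * k \<le> s" using s_large by (rule_tac power2_le_imp_le) auto
      then have "(s * k / 2) * (12 * t * k) \<le> (s * k / 2) * s" using s_large k2 by (intro mult_left_mono) auto
      then show ?thesis by (simp add: power2_eq_square s2[symmetric] algebra_simps)
    qed
    finally have "real p * k \<le> real p * (12 * t)" by (simp add: field_simps)
    then have k12: "k \<le> 12 * t" using p100 by simp
    have t4: "1 \<le> t ^ 4" "t \<le> t ^ 4" using t1 self_le_power[of t 4] by auto
    \<comment> \<open>Otherwise \<open>t ^ 8 \<le> s\<close> would give
      \<open>s\<^sup>2 \<le> c\<^sup>2 * s\<close>. The value
      \<open>3456 = 2 * 4 * 12\<^sup>2 * 3\<close> is the constant of the final inequality.\<close>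
    have small: "s > c * t ^ 4" if c: "0 \<le> c" "c \<le> 3456" for c
    proof (rule ccontr)
      assume "\<not> s > c * t ^ 4"
      then have "s * s \<le> (c * t ^ 4) * (c * t ^ 4)" using s_large by (intro mult_mono) auto
      also have "\<dots> = (c * c) * t ^ 8" by (simp add: power_add[symmetric] algebra_simps)
      also have "\<dots> \<le> (3456 * 3456) * s" using c t by (intro mult_mono) auto
      finally have "s \<le> 3456 * 3456" using s_large by simp
      then show False using s_large by simp
    qed
    have "2 * k \<le> 24 * t ^ 4" using k12 t4 by linarith
    then have ks: "2 * real (card B) < sqrt (real p)" using small[of 24] by (simp add: k_def s_def)
    have r: "2 * s + 25 \<le> 3 * s" using s_large by simp
    have "\<phi> \<le> t * (4 * k\<^sup>2 * (2 * s + 25))"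
    proof (cases "card B = 2")
      case True
      have "\<phi> \<le> t * (6 * (2 * s + 25))"
        unfolding \<phi>_def t_def s_def by (rule totient_le_of_card_2[OF AB(1-3) True p100])
      also have "\<dots> \<le> t * (4 * k\<^sup>2 * (2 * s + 25))"
        using True t1 s_large by (intro mult_left_mono mult_right_mono) (auto simp: k_def)
      finally show ?thesis .
    next
      case False
      then show ?thesis
        unfolding \<phi>_def t_def s_def k_def using AB(4) ks
        by (intro totient_le_of_card_ge_3[OF AB(1-3) _ _ p100]) auto
    qed
    also have "\<dots> \<le> t * (4 * (12 * t)\<^sup>2 * (3 * s))"
      using k12 k2 t1 r s_large by (intro mult_left_mono mult_mono power_mono) auto
    also have "\<dots> = 1728 * s * t ^ 3" by (simp add: power2_eq_square power3_eq_cube)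
    finally have "t * \<phi> \<le> t * (1728 * s * t ^ 3)" using t1 by (intro mult_left_mono) auto
    then have "s * s \<le> s * (3456 * t ^ 4)"
      using \<phi>_ge by (simp add: s2 power3_eq_cube power4_eq_xxxx algebra_simps)
    then have "s \<le> 3456 * t ^ 4" using s_large by simp
    then show ?thesis using small[of 3456] by simp
  qed
qed

end

lemma exists_large_threshold:
  fixes \<eta> :: real
  assumes "0 < \<eta>"
  shows "\<exists>p0::nat. \<forall>p. prime p \<and> p > p0 \<longrightarrow> odd_prime p
    \<and> ((2 :: real) ^ card (prime_factors (p - 1))) ^ 8 \<le> sqrt (real p)
    \<and> 3456\<^sup>2 < sqrt (real p) \<and> 50 \<le> \<eta> * sqrt (real p) \<and> (864 / \<eta>) ^ 4 \<le> sqrt (real p) ^ 3"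
proof -
  \<comment> \<open>For \<open>t = 2 ^ card (prime_factors (p - 1))\<close> this makes
    \<open>t ^ 32\<close> a power of \<open>c\<close>, at most
    \<open>c ^ c * p \<le> p\<^sup>2 = s ^ 4\<close>, so \<open>t ^ 8 \<le> s\<close>.\<close>
  define c :: nat where "c = 2 ^ 32"
  define K where "K = real (c ^ c)"
  define S where "S = max (3456\<^sup>2 + 1) (max (50 / \<eta>) ((864 / \<eta>) ^ 4))"
  define p0 where "p0 = nat \<lceil>max K (S\<^sup>2)\<rceil>"
  have "odd_prime p \<and> ((2 :: real) ^ card (prime_factors (p - 1))) ^ 8 \<le> sqrt (real p)
    \<and> 3456\<^sup>2 < sqrt (real p) \<and> 50 \<le> \<eta> * sqrt (real p) \<and> (864 / \<eta>) ^ 4 \<le> sqrt (real p) ^ 3"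
    if p: "prime p" "p > p0" for p
  proof -
    define s where "s = sqrt (real p)"
    have "max K (S\<^sup>2) \<le> real p" using p(2) unfolding p0_def by linarith
    then have K: "K \<le> real p" and Sp: "S\<^sup>2 \<le> real p" by simp_all
    have S: "3456\<^sup>2 + 1 \<le> S" "50 / \<eta> \<le> S" "(864 / \<eta>) ^ 4 \<le> S" by (simp_all add: S_def)
    have sS: "S \<le> s" unfolding s_def using Sp S(1) by (intro real_le_rsqrt) auto
    have s2: "s * s = real p" by (simp add: s_def)
    have s1: "3456\<^sup>2 < s" using sS S(1) by linarith
    then have s_ge: "1 \<le> s" by simp
    have "p > 2"
    proof (rule ccontr)
      assume "\<not> p > 2"
      then have "real p \<le> 2" by simp
      moreover have "3456\<^sup>2 * 1 \<le> s * s" using s1 s_ge by (intro mult_mono) auto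
      ultimately show False by (simp add: s2)
    qed
    then have "odd_prime p" using p(1) by unfold_locales
    moreover have "50 \<le> \<eta> * s"
      using order_trans[OF S(2) sS] assms by (simp add: field_simps)
    moreover have "(864 / \<eta>) ^ 4 \<le> s ^ 3"
    proof -
      have "(864 / \<eta>) ^ 4 \<le> s" using S(3) sS by (rule order_trans)
      also have "s \<le> s ^ 3" using s_ge by (rule self_le_power) simp
      finally show ?thesis .
    qed
    moreover have "((2 :: real) ^ card (prime_factors (p - 1))) ^ 8 \<le> s"
    proof -
      define t where "t = (2 :: real) ^ card (prime_factors (p - 1))"
      have "c ^ card (prime_factors (p - 1)) \<le> c ^ c * (p - 1)"
        using \<open>p > 2\<close> by (intro power_card_prime_factors_le) (auto simp: c_def)
      then have "real (c ^ card (prime_factors (p - 1))) \<le> real (c ^ c * (p - 1))"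
        by (simp only: of_nat_le_iff)
      also have "\<dots> = K * real (p - 1)" unfolding K_def by (rule of_nat_mult)
      also have "\<dots> \<le> real p * real p" using K by (intro mult_mono) (auto simp: K_def)
      also have "real (c ^ card (prime_factors (p - 1))) = t ^ 32"
        unfolding c_def t_def by (simp only: of_nat_power of_nat_numeral power_mult[symmetric] mult.commute)
      also have "t ^ 32 = (t ^ 8) ^ 4" by (simp flip: power_mult)
      also have "real p * real p = s ^ 4" by (simp add: power4_eq_xxxx flip: s2)
      finally have "(t ^ 8) ^ 4 \<le> s ^ 4" .
      then have "t ^ 8 \<le> s" using s_ge by (rule_tac power_le_imp_le_base[of _ 3]) (auto simp: numeral_eq_Suc)
      then show ?thesis by (simp only: t_def)
    qed
    ultimately show ?thesis using s1 by (simp only: s_def) 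
  qed
  then show ?thesis by blast
qed

theorem theorem1p2:
  fixes \<epsilon> :: real
  assumes "0 < \<epsilon>" and "\<epsilon> < 1/2"
  shows "\<exists>p0::nat. \<forall>p::nat. prime p \<and> p > p0 \<longrightarrow>
     (\<forall>A B. A \<subseteq> {0..<p} \<and> B \<subseteq> {0..<p} \<and> card A \<ge> 2 \<and> card B \<ge> 2 \<and>
        sumset_mod p A B = primitive_elems p \<longrightarrow>
        (1/2 - \<epsilon>) * real (totient (p - 1)) / sqrt (real p) \<le> real (card A) \<and>
        real (card A) \<le> 3 * sqrt (real p) \<and>
        (1/2 - \<epsilon>) * real (totient (p - 1)) / sqrt (real p) \<le> real (card B) \<and>
        real (card B) \<le> 3 * sqrt (real p))"
proof -
  \<comment> \<open>\<open>(1/2 - \<epsilon>) * (2 + 4 * \<epsilon>) = 1 - 4 *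
    \<epsilon>\<^sup>2\<close> stays below 1 for the lower bound, and
    \<open>2 + \<eta> \<le> 3\<close> serves the upper one.\<close>
  define \<eta> where "\<eta> = min 1 (4 * \<epsilon>)"
  have \<eta>: "0 < \<eta>" "\<eta> \<le> 1" "\<eta> \<le> 4 * \<epsilon>" using assms by (auto simp: \<eta>_def)
  obtain p0 where p0: "\<And>p. prime p \<Longrightarrow> p > p0 \<Longrightarrow> odd_prime p
    \<and> ((2 :: real) ^ card (prime_factors (p - 1))) ^ 8 \<le> sqrt (real p)
    \<and> 3456\<^sup>2 < sqrt (real p) \<and> 50 \<le> \<eta> * sqrt (real p) \<and> (864 / \<eta>) ^ 4 \<le> sqrt (real p) ^ 3"
    using exists_large_threshold[OF \<eta>(1)] by blast
  have "(1/2 - \<epsilon>) * real (totient (p - 1)) / sqrt (real p) \<le> real (card A) \<and>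
        real (card A) \<le> 3 * sqrt (real p)"
    if p: "prime p" "p > p0" and A: "A \<subseteq> {0..<p}" "card A \<ge> 2" and B: "B \<subseteq> {0..<p}" "card B \<ge> 2"
      and AB: "sumset_mod p A B = primitive_elems p" for p A B
  proof -
    interpret odd_prime p using p0[OF p] by blast
    define s where "s = sqrt (real p)"
    have s: "0 < s" using p_pos by (simp add: s_def)
    have BA: "sumset_mod p B A = primitive_elems p" using AB by (simp only: sumset_commute)
    have cA: "real (card A) \<le> (2 + \<eta>) * s"
      unfolding s_def using p0[OF p] by (intro card_summand_le[OF A(1) B(1) AB B(2) \<eta>(1)]) auto
    have cB: "real (card B) \<le> (2 + \<eta>) * s"
      unfolding s_def using p0[OF p] by (intro card_summand_le[OF B(1) A(1) BA A(2) \<eta>(1)]) auto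
    have "finite A" "finite B" using A(1) B(1) by (auto intro: finite_subset)
    then have "totient (p - 1) \<le> card A * card B"
      using card_sumset_le[of A B] AB by (simp add: card_primitive_elems)
    then have "real (totient (p - 1)) \<le> real (card A * card B)" by (simp only: of_nat_le_iff)
    also have "\<dots> \<le> real (card A) * ((2 + \<eta>) * s)" using cB by (simp add: mult_left_mono)
    finally have "(1/2 - \<epsilon>) * real (totient (p - 1)) \<le> (1/2 - \<epsilon>) * (real (card A) * ((2 + \<eta>) * s))"
      using assms by (intro mult_left_mono) auto
    also have "\<dots> = (1/2 - \<epsilon>) * (2 + \<eta>) * (real (card A) * s)" by simp
    also have "\<dots> \<le> 1 * (real (card A) * s)"
    proof (rule mult_right_mono)
      have "(1/2 - \<epsilon>) * (2 + \<eta>) \<le> (1/2 - \<epsilon>) * (2 + 4 * \<epsilon>)"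
        using assms \<eta> by (intro mult_left_mono) auto
      also have "\<dots> = 1 - 4 * \<epsilon> * \<epsilon>" by (simp add: algebra_simps)
      also have "\<dots> \<le> 1" using assms by simp
      finally show "(1/2 - \<epsilon>) * (2 + \<eta>) \<le> 1" .
    qed (use s in simp)
    finally have "(1/2 - \<epsilon>) * real (totient (p - 1)) / s \<le> real (card A)"
      using s by (simp add: pos_divide_le_eq)
    moreover have "(2 + \<eta>) * s \<le> 3 * s" using \<eta> s by (intro mult_right_mono) auto
    ultimately show ?thesis using cA unfolding s_def by linarith
  qed
  note bounds = this
  show ?thesis
  proof (intro exI[of _ p0] allI impI)
    fix p A B
    assume p: "prime p \<and> p > p0"
      and *: "A \<subseteq> {0..<p} \<and> B \<subseteq> {0..<p} \<and> card A \<ge> 2 \<and> card B \<ge> 2 \<and>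
        sumset_mod p A B = primitive_elems p"
    have "sumset_mod p B A = sumset_mod p A B"
      unfolding sumset_mod_def by (intro Collect_cong) (metis add.commute)
    then show "(1/2 - \<epsilon>) * real (totient (p - 1)) / sqrt (real p) \<le> real (card A) \<and>
        real (card A) \<le> 3 * sqrt (real p) \<and>
        (1/2 - \<epsilon>) * real (totient (p - 1)) / sqrt (real p) \<le> real (card B) \<and>
        real (card B) \<le> 3 * sqrt (real p)"
      using bounds[of p A B] bounds[of p B A] p * by simp
  qed
qed

end
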